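(* Let $k$ be a field and let $Q$ be a connected, finite and acyclic quiver. (a) If $Q=Q_n$ is the linearly oriented Dynkin quiver $1\to 2\to\cdots\to n$ of type $A$, then the Gabriel quiver of $\mathcal{B}_{Q_n}$ has exactly $n+1$ connected components. (b) If $Q$ is distinct from the linearly oriented Dynkin quiver of type $A$ (that is, distinct from $Q_n$ for every $n$), then the Gabriel quiver of $\mathcal{B}_Q$ has exactly $3$ connected components.
   Context: For a finite acyclic quiver $Q$ with vertex set $Q_0$, $\mathcal{B}_Q$ is the associative unital $k$-algebra with generators $X_t$ ($t\in Q_0$) and relations: $X_s^2=X_s$ for all $s\in Q_0$; $X_sX_tX_s=X_tX_sX_t$ for all $s,t\in Q_0$; $X_tX_sX_t=X_sX_t$ for all $s,t\in Q_0$ such that there is no arrow from $t$ to $s$ in $Q$. The algebra $\mathcal{B}_Q$ is finite dimensional. The Gabriel quiver of $\mathcal{B}_Q$ has as vertices the isomorphism classes of simple $\mathcal{B}_Q$-modules, and the number of arrows from $[E]$ to $[E']$ is $\dim_k\mathrm{Ext}^1_{\mathcal{B}_Q}(E,E')$. Connected components are those of the underlying undirected graph.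
   Formalization: In (b), Q is also assumed not to become Q_n, n ≥ 3, when parallel arrows are merged; otherwise (b) fails: two arrows 1→2 and one arrow 2→3 give the same algebra as Q_3, whose Gabriel quiver has 4 components. *)

theory Defs
  imports
    "HOL-Algebra.QuotRing"
    "Graph_Theory.Graph_Theory"
    "Jordan_Normal_Form.Missing_VectorSpace"
begin

section \<open>Modules over a not necessarily commutative ring\<close>

text \<open>
  The library locale \<open>module\<close> requires a commutative ring of scalars.  Modules are left
  modules; the fields \<open>mult\<close> and \<open>one\<close> of a module record carry no meaning.
\<close>

locale left_module = R?: ring R + M?: abelian_group M
  for R :: "('r, 'x) ring_scheme" (structure) and M :: "('r, 'm, 'y) module_scheme" (structure) +
  assumes smult_closed:
      "\<lbrakk>a \<in> carrier R; x \<in> carrier M\<rbrakk> \<Longrightarrow> a \<odot>\<^bsub>M\<^esub> x \<in> carrier M"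
    and smult_l_distr:
      "\<lbrakk>a \<in> carrier R; b \<in> carrier R; x \<in> carrier M\<rbrakk> \<Longrightarrow>
        (a \<oplus>\<^bsub>R\<^esub> b) \<odot>\<^bsub>M\<^esub> x = a \<odot>\<^bsub>M\<^esub> x \<oplus>\<^bsub>M\<^esub> b \<odot>\<^bsub>M\<^esub> x"
    and smult_r_distr:
      "\<lbrakk>a \<in> carrier R; x \<in> carrier M; y \<in> carrier M\<rbrakk> \<Longrightarrow>
        a \<odot>\<^bsub>M\<^esub> (x \<oplus>\<^bsub>M\<^esub> y) = a \<odot>\<^bsub>M\<^esub> x \<oplus>\<^bsub>M\<^esub> a \<odot>\<^bsub>M\<^esub> y"
    and smult_assoc:
      "\<lbrakk>a \<in> carrier R; b \<in> carrier R; x \<in> carrier M\<rbrakk> \<Longrightarrow>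
        (a \<otimes>\<^bsub>R\<^esub> b) \<odot>\<^bsub>M\<^esub> x = a \<odot>\<^bsub>M\<^esub> (b \<odot>\<^bsub>M\<^esub> x)"
    and smult_one:
      "x \<in> carrier M \<Longrightarrow> \<one>\<^bsub>R\<^esub> \<odot>\<^bsub>M\<^esub> x = x"

definition simple_module ::
    "('r, 'x) ring_scheme \<Rightarrow> ('r, 'm, 'y) module_scheme \<Rightarrow> bool" where
  "simple_module R M \<longleftrightarrow>
     left_module R M \<and> carrier M \<noteq> {\<zero>\<^bsub>M\<^esub>} \<and>
     (\<forall>H. Module.submodule H R M \<longrightarrow> H = {\<zero>\<^bsub>M\<^esub>} \<or> H = carrier M)"

definition module_iso ::
    "('r, 'x) ring_scheme \<Rightarrow> ('r, 'm, 'y) module_scheme \<Rightarrow>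
     ('r, 'n, 'z) module_scheme \<Rightarrow> bool" where
  "module_iso R M N \<longleftrightarrow>
     (\<exists>f \<in> LinearCombinations.module_hom R M N. bij_betw f (carrier M) (carrier N))"

definition quotient_module ::
    "('k, 'm, 'y) module_scheme \<Rightarrow> 'm set \<Rightarrow> ('k, 'm set) module" where
  "quotient_module V W =
     \<lparr>carrier = a_rcosets\<^bsub>V\<^esub> W, monoid.mult = undefined, one = undefined,
      zero = W, add = set_add V,
      smult = (\<lambda>c X. \<Union>x\<in>X. W +>\<^bsub>V\<^esub> (c \<odot>\<^bsub>V\<^esub> x))\<rparr>"

definition free_module ::
    "('r, 'x) ring_scheme \<Rightarrow> 's set \<Rightarrow> ('r, 's \<Rightarrow> 'r) module" where
  "free_module R S =
     \<lparr>carrier = {f. (\<forall>s. f s \<in> carrier R) \<and> finite {s. f s \<noteq> \<zero>\<^bsub>R\<^esub>} \<and>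
                     {s. f s \<noteq> \<zero>\<^bsub>R\<^esub>} \<subseteq> S},
      monoid.mult = undefined, one = undefined,
      zero = (\<lambda>s. \<zero>\<^bsub>R\<^esub>), add = (\<lambda>f g s. f s \<oplus>\<^bsub>R\<^esub> g s),
      smult = (\<lambda>a f s. a \<otimes>\<^bsub>R\<^esub> f s)\<rparr>"


section \<open>Ext and the Gabriel quiver of an algebra over a field\<close>

text \<open>
  A \<open>K\<close>-algebra is a ring \<open>R\<close> together with its structure map \<open>\<iota>\<close>, a ring homomorphism
  from \<open>K\<close> to the centre of \<open>R\<close>; \<open>K\<close> acts on an \<open>R\<close>-module through \<open>\<iota>\<close>.
  Homomorphisms are made extensional, so that a map is determined by its values on the domain.
\<close>

definition hom_space ::
    "('r, 'x) ring_scheme \<Rightarrow> ('k \<Rightarrow> 'r) \<Rightarrow> ('r, 'm, 'y) module_scheme \<Rightarrow>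
     ('r, 'n, 'z) module_scheme \<Rightarrow> ('k, 'm \<Rightarrow> 'n) module" where
  "hom_space R \<iota> M N =
     \<lparr>carrier = LinearCombinations.module_hom R M N \<inter> extensional (carrier M),
      monoid.mult = undefined, one = undefined,
      zero = (\<lambda>x\<in>carrier M. \<zero>\<^bsub>N\<^esub>),
      add = (\<lambda>f g. \<lambda>x\<in>carrier M. f x \<oplus>\<^bsub>N\<^esub> g x),
      smult = (\<lambda>c f. \<lambda>x\<in>carrier M. \<iota> c \<odot>\<^bsub>N\<^esub> f x)\<rparr>"

text \<open>
  With \<open>P\<close> the free module on the underlying set of \<open>M\<close> and \<open>Z\<close> the kernel of the
  canonical surjection \<open>P \<rightarrow> M\<close>, the sequence \<open>0 \<rightarrow> Z \<rightarrow> P \<rightarrow> M \<rightarrow> 0\<close> is a projective presentation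
  of \<open>M\<close>, and \<open>Ext\<^sup>1(M, N)\<close> is the cokernel of the restriction map
  \<open>Hom(P, N) \<rightarrow> Hom(Z, N)\<close> (Hilton and Stammbach, A Course in Homological Algebra, III.2).
\<close>

definition canonical_map ::
    "('r, 'x) ring_scheme \<Rightarrow> ('r, 'm, 'y) module_scheme \<Rightarrow> ('m \<Rightarrow> 'r) \<Rightarrow> 'm" where
  "canonical_map R M f = (\<Oplus>\<^bsub>M\<^esub>x\<in>{x. f x \<noteq> \<zero>\<^bsub>R\<^esub>}. f x \<odot>\<^bsub>M\<^esub> x)"

definition syzygy ::
    "('r, 'x) ring_scheme \<Rightarrow> ('r, 'm, 'y) module_scheme \<Rightarrow> ('r, 'm \<Rightarrow> 'r) module" where
  "syzygy R M =
     (free_module R (carrier M))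
       \<lparr>carrier := {f \<in> carrier (free_module R (carrier M)). canonical_map R M f = \<zero>\<^bsub>M\<^esub>}\<rparr>"

definition Ext1 ::
    "('r, 'x) ring_scheme \<Rightarrow> ('k \<Rightarrow> 'r) \<Rightarrow> ('r, 'm, 'y) module_scheme \<Rightarrow>
     ('r, 'n, 'z) module_scheme \<Rightarrow> ('k, (('m \<Rightarrow> 'r) \<Rightarrow> 'n) set) module" where
  "Ext1 R \<iota> M N =
     quotient_module (hom_space R \<iota> (syzygy R M) N)
       ((\<lambda>\<phi>. restrict \<phi> (carrier (syzygy R M))) `
          LinearCombinations.module_hom R (free_module R (carrier M)) N)"

text \<open>
  Every simple \<open>R\<close>-module is isomorphic to \<open>R/L\<close> for a maximal left ideal \<open>L\<close>, and the
  elements of \<open>R/L\<close> are subsets of \<open>R\<close>.  Hence modules whose carrier consists of sets of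
  elements of \<open>R\<close> represent all isomorphism classes of simple modules.
\<close>

type_synonym 'r set_module = "('r, 'r set) module"

definition simple_classes :: "('r, 'x) ring_scheme \<Rightarrow> 'r set_module set set" where
  "simple_classes R =
     (\<lambda>M. {N. simple_module R N \<and> module_iso R M N}) `
       {M :: 'r set_module. simple_module R M}"

text \<open>
  The number of arrows from \<open>C\<close> to \<open>D\<close> is the dimension of \<open>Ext\<^sup>1\<close>, which does not depend on the
  chosen representatives.  The algebra is assumed to be finite dimensional, so that this
  dimension is finite.
\<close>

definition gabriel_quiver ::
    "('k, 'w) ring_scheme \<Rightarrow> ('r, 'x) ring_scheme \<Rightarrow> ('k \<Rightarrow> 'r) \<Rightarrow>
     ('r set_module set, 'r set_module set \<times> 'r set_module set \<times> nat) pre_digraph" where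
  "gabriel_quiver K R \<iota> =
     \<lparr>verts = simple_classes R,
      arcs = {(C, D, i). C \<in> simple_classes R \<and> D \<in> simple_classes R \<and>
                i < vectorspace.dim K (Ext1 R \<iota> (SOME M. M \<in> C) (SOME N. N \<in> D))},
      tail = (\<lambda>(C, D, i). C), head = (\<lambda>(C, D, i). D)\<rparr>"

definition num_connected_components :: "('a, 'b) pre_digraph \<Rightarrow> nat" where
  "num_connected_components G = card (pre_digraph.sccs_verts (with_proj (mk_symmetric G)))"


section \<open>The algebra of a quiver\<close>

text \<open>
  The free associative unital \<open>K\<close>-algebra on the set \<open>V\<close>: finitely supported functions on words
  over \<open>V\<close>, multiplied by convolution along concatenation of words.
\<close>

definition free_algebra ::
    "('k, 'w) ring_scheme \<Rightarrow> 'v set \<Rightarrow> ('v list \<Rightarrow> 'k) ring" where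
  "free_algebra K V =
     \<lparr>carrier = {f. (\<forall>w. f w \<in> carrier K) \<and> finite {w. f w \<noteq> \<zero>\<^bsub>K\<^esub>} \<and>
                     {w. f w \<noteq> \<zero>\<^bsub>K\<^esub>} \<subseteq> lists V},
      monoid.mult = (\<lambda>f g w. \<Oplus>\<^bsub>K\<^esub>i\<in>{..length w}. f (take i w) \<otimes>\<^bsub>K\<^esub> g (drop i w)),
      one = (\<lambda>w. if w = [] then \<one>\<^bsub>K\<^esub> else \<zero>\<^bsub>K\<^esub>),
      zero = (\<lambda>w. \<zero>\<^bsub>K\<^esub>),
      add = (\<lambda>f g w. f w \<oplus>\<^bsub>K\<^esub> g w)\<rparr>"

definition free_gen :: "('k, 'w) ring_scheme \<Rightarrow> 'v \<Rightarrow> 'v list \<Rightarrow> 'k" where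
  "free_gen K t = (\<lambda>w. if w = [t] then \<one>\<^bsub>K\<^esub> else \<zero>\<^bsub>K\<^esub>)"

definition BQ_relations ::
    "('k, 'w) ring_scheme \<Rightarrow> ('v, 'e) pre_digraph \<Rightarrow> ('v list \<Rightarrow> 'k) set" where
  "BQ_relations K Q =
     (let F = free_algebra K (verts Q); X = free_gen K in
        {X s \<otimes>\<^bsub>F\<^esub> X s \<ominus>\<^bsub>F\<^esub> X s | s. s \<in> verts Q}
      \<union> {X s \<otimes>\<^bsub>F\<^esub> X t \<otimes>\<^bsub>F\<^esub> X s \<ominus>\<^bsub>F\<^esub> X t \<otimes>\<^bsub>F\<^esub> X s \<otimes>\<^bsub>F\<^esub> X t | s t.
           s \<in> verts Q \<and> t \<in> verts Q}
      \<union> {X t \<otimes>\<^bsub>F\<^esub> X s \<otimes>\<^bsub>F\<^esub> X t \<ominus>\<^bsub>F\<^esub> X s \<otimes>\<^bsub>F\<^esub> X t | s t.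
           s \<in> verts Q \<and> t \<in> verts Q \<and> \<not> t \<rightarrow>\<^bsub>Q\<^esub> s})"

definition BQ_ideal ::
    "('k, 'w) ring_scheme \<Rightarrow> ('v, 'e) pre_digraph \<Rightarrow> ('v list \<Rightarrow> 'k) set" where
  "BQ_ideal K Q = Idl\<^bsub>free_algebra K (verts Q)\<^esub> (BQ_relations K Q)"

definition BQ ::
    "('k, 'w) ring_scheme \<Rightarrow> ('v, 'e) pre_digraph \<Rightarrow> ('v list \<Rightarrow> 'k) set ring" where
  "BQ K Q = free_algebra K (verts Q) Quot BQ_ideal K Q"

text \<open>The structure map making \<open>BQ K Q\<close> a \<open>K\<close>-algebra: \<open>c\<close> is sent to the class of \<open>c \<cdot> 1\<close>.\<close>

definition BQ_unit ::
    "('k, 'w) ring_scheme \<Rightarrow> ('v, 'e) pre_digraph \<Rightarrow> 'k \<Rightarrow> ('v list \<Rightarrow> 'k) set" where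
  "BQ_unit K Q c =
     BQ_ideal K Q +>\<^bsub>free_algebra K (verts Q)\<^esub> (\<lambda>w. if w = [] then c else \<zero>\<^bsub>K\<^esub>)"


section \<open>Quivers\<close>

text \<open>A quiver is a digraph in the sense of \<open>pre_digraph\<close>; parallel arrows are allowed.\<close>

definition acyclic_quiver :: "('v, 'e) pre_digraph \<Rightarrow> bool" where
  "acyclic_quiver Q \<longleftrightarrow> (\<nexists>p. pre_digraph.cycle Q p)"

text \<open>\<open>1 \<rightarrow> 2 \<rightarrow> \<dots> \<rightarrow> n\<close>; the arrow \<open>i \<rightarrow> i + 1\<close> is labelled \<open>i\<close>.\<close>

definition linear_quiver :: "nat \<Rightarrow> (nat, nat) pre_digraph" where
  "linear_quiver n =
     \<lparr>verts = {1..n}, arcs = {1..<n}, tail = (\<lambda>i. i), head = Suc\<rparr>"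

text \<open>
  All arrows with the same source and target are replaced by a single one.  The algebra
  \<open>BQ K Q\<close> does not see the multiplicity of arrows.
\<close>

definition merge_parallel :: "('v, 'e) pre_digraph \<Rightarrow> ('v, 'v \<times> 'v) pre_digraph" where
  "merge_parallel Q =
     \<lparr>verts = verts Q, arcs = arcs_ends Q, tail = fst, head = snd\<rparr>"

end

theory Submission
  imports Defs
begin

text \<open>
  On a simple module the image of \<open>X\<^sub>t\<close> is a submodule as soon as all successors of \<open>t\<close> act as
  scalars.  As the quiver is acyclic, all generators act by 0 or 1, and the simple modules are
  the one-dimensional modules \<open>S\<^sub>A\<close> for sets \<open>A\<close> of vertices, where \<open>X\<^sub>t\<close> acts as the identity if
  \<open>t \<in> A\<close> and as 0 otherwise.

  For one-dimensional modules, \<open>Ext\<^sup>1\<close> is the space of derivations modulo the inner ones.  A derivation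
  \<open>D\<close> between the characters of \<open>A\<close> and \<open>B\<close> is determined by the values \<open>D (X\<^sub>t)\<close>, which vanish outside
  the symmetric difference and are constant on \<open>A - B\<close> and on \<open>B - A\<close>.  The relation for a pair
  \<open>s \<in> A - B\<close>, \<open>t \<in> B - A\<close> without an arrow \<open>s \<rightarrow> t\<close> forces the two constants to be opposite, which
  makes \<open>D\<close> inner.  Hence \<open>Ext\<^sup>1(S\<^sub>A, S\<^sub>B)\<close> is nonzero exactly if \<open>A - B\<close> and \<open>B - A\<close> are nonempty and
  every element of the former has an arrow to every element of the latter.

  In particular \<open>S\<^sub>A\<close> is isolated if \<open>A\<close> is empty or contains all vertices.  Moving single elements
  along arrows connects all sets of the same size.  For a linearly oriented quiver nothing else is
  possible, so the size classifies the components.  Otherwise some vertex \<open>v\<close> has two successors or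
  two predecessors \<open>a, b\<close>, and the exchange of \<open>{v}\<close> for \<open>{a, b}\<close> connects different sizes.
\<close>

section \<open>Exchanges of vertex sets\<close>

text \<open>No basis of the algebra is computed. A character is a homomorphism to \<open>K\<close>,
  a derivation is the corner entry of a homomorphism to triangular matrices, and both exist by the
  universal property once the relations are checked on values 0 and 1. They are unique because the
  \<open>X t\<close> generate.

  \<open>Ext1\<close> is built from the free module on all elements of \<open>M\<close>, which is
  far too large to compute with. As \<open>M\<close> is spanned by one vector, that free module
  retracts onto the multiples of one basis vector, and the syzygy is governed by the left ideal ker
  \<alpha>. A derivation is a homomorphism on this ideal, extended by zero to the scalars.

  Components ignore multiplicities of arrows, so only positivity of the dimension matters. Yet
  \<open>dim\<close> is informative only for a finitely generated space; hence the criterion for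
  \<open>Ext1\<close> is stated relative to one derivation \<open>D\<^sub>0\<close> that generates
  all others modulo inner ones.\<close>

text \<open>
  This will turn out to be the condition for \<open>Ext\<^sup>1\<close> from the simple module of \<open>A\<close> to the
  simple module of \<open>B\<close> to be nonzero.
\<close>

definition exchange :: "('v \<times> 'v) set \<Rightarrow> 'v set \<Rightarrow> 'v set \<Rightarrow> bool" where
  "exchange E A B \<longleftrightarrow> A - B \<noteq> {} \<and> B - A \<noteq> {} \<and> (A - B) \<times> (B - A) \<subseteq> E"

definition exchange_rel :: "('v \<times> 'v) set \<Rightarrow> 'v set \<Rightarrow> ('v set \<times> 'v set) set" where
  "exchange_rel E V = {(A, B). A \<subseteq> V \<and> B \<subseteq> V \<and> (exchange E A B \<or> exchange E B A)}"

lemma exchange_rel_sym: "(A, B) \<in> exchange_rel E V \<Longrightarrow> (B, A) \<in> exchange_rel E V"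
  by (auto simp: exchange_rel_def)

lemma exchange_rel_rtrancl_sym:
  "(A, B) \<in> (exchange_rel E V)\<^sup>* \<Longrightarrow> (B, A) \<in> (exchange_rel E V)\<^sup>*"
  by (meson exchange_rel_sym symD sym_rtrancl symI)

text \<open>Each step needs an element to give up and one to receive, so neither \<open>{}\<close>
  nor \<open>V\<close> has a neighbour and a chain starting there stays put.\<close>

lemma exchange_trivial:
  assumes "(A, B) \<in> (exchange_rel E V)\<^sup>*" "A = {} \<or> A = V"
  shows "B = A"
  using assms by induction (auto simp: exchange_rel_def exchange_def)

section \<open>Sets of equal size: moving single elements along arrows\<close>

lemma exchange_slide:
  assumes "E \<subseteq> V \<times> V" "A \<subseteq> V" "(w, v) \<in> E \<union> E\<inverse>" "w \<in> A" "v \<notin> A"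
  shows "(A, insert v (A - {w})) \<in> exchange_rel E V"
proof -
  have "A - insert v (A - {w}) = {w}" "insert v (A - {w}) - A = {v}" using assms by auto
  then show ?thesis using assms by (auto simp: exchange_rel_def exchange_def)
qed

text \<open>
  Token sliding along a walk from \<open>u\<close> to \<open>v\<close>: if the last vertex \<open>w\<close> before \<open>v\<close> is occupied, its
  token moves to \<open>v\<close> first and the token of \<open>u\<close> takes its place.
\<close>

lemma exchange_jump:
  assumes E: "E \<subseteq> V \<times> V" and path: "(u, v) \<in> (E \<union> E\<inverse>)\<^sup>*"
    and "A \<subseteq> V" "u \<in> A" "v \<notin> A"
  shows "(A, insert v (A - {u})) \<in> (exchange_rel E V)\<^sup>*"
  using path assms(3-)
proof (induction arbitrary: A rule: rtrancl_induct)
  case base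
  then show ?case by simp
next
  case (step w v)
  have V: "v \<in> V" "w \<in> V" using E step(2) by auto
  consider "w \<notin> A" | "w = u" | "w \<in> A" "w \<noteq> u" by blast
  then show ?case
  proof cases
    case 1
    \<comment> \<open>Loops in \<open>E\<close> are not ruled out here, so \<open>w\<close> may be
      \<open>v\<close>; then the induction hypothesis is already the claim.\<close>
    then have same: "v = w \<Longrightarrow> ?thesis" using step.IH step.prems by blast
    have "(A, insert w (A - {u})) \<in> (exchange_rel E V)\<^sup>*"
      using step.IH step.prems 1 by blast
    moreover have "(insert w (A - {u}), insert v (insert w (A - {u}) - {w})) \<in> exchange_rel E V" if "v \<noteq> w"
      using E step V that by (intro exchange_slide) auto
    moreover have "insert w (A - {u}) - {w} = A - {u}" using 1 by auto
    ultimately show ?thesis using same by (metis rtrancl.rtrancl_into_rtrancl)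
  next
    case 2
    then show ?thesis using exchange_slide[OF E _ step(2)] step.prems by auto
  next
    case 3
    let ?A' = "insert v (A - {w})"
    have "(A, ?A') \<in> exchange_rel E V" using exchange_slide[OF E _ step(2)] step.prems 3 by auto
    moreover have "(?A', insert w (?A' - {u})) \<in> (exchange_rel E V)\<^sup>*"
      using step.IH[of ?A'] step.prems 3 V by auto
    moreover have "insert w (?A' - {u}) = insert v (A - {u})" using 3 step.prems by auto
    ultimately show ?thesis by (metis converse_rtrancl_into_rtrancl)
  qed
qed

text \<open>A jump trades an element of \<open>A - B\<close> for one of \<open>B - A\<close> and so
  lowers \<open>card (A - B)\<close> by one. Equality of the sizes guarantees a target
  \<open>v\<close> whenever there is a source \<open>u\<close>.\<close>

lemma exchange_same_card:
  assumes E: "E \<subseteq> V \<times> V" and fin: "finite V"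
    and conn: "V \<times> V \<subseteq> (E \<union> E\<inverse>)\<^sup>*"
    and "A \<subseteq> V" "B \<subseteq> V" "card A = card B"
  shows "(A, B) \<in> (exchange_rel E V)\<^sup>*"
  using assms(4-)
proof (induction "card (A - B)" arbitrary: A)
  case 0
  then have "A \<subseteq> B" using fin by (simp add: finite_subset)
  then show ?case using 0 fin by (metis card_subset_eq finite_subset rtrancl.rtrancl_refl)
next
  case (Suc n)
  have fA: "finite A" "finite B" using Suc.prems fin finite_subset by auto
  obtain u where u: "u \<in> A - B" using Suc(2) by (metis card.empty nat.distinct(1) equals0I)
  have "\<not> B \<subseteq> A" using u Suc.prems fA by (metis DiffD1 DiffD2 card_subset_eq)
  then obtain v where v: "v \<in> B - A" by blast
  let ?A' = "insert v (A - {u})"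
  have "(A, ?A') \<in> (exchange_rel E V)\<^sup>*"
    using exchange_jump[OF E, of u v A] conn u v Suc.prems by blast
  moreover have "?A' - B = (A - B) - {u}" using u v by auto
  then have "n = card (?A' - B)" using Suc(2) u fA by simp
  moreover have "card ?A' = card B" using u v fA Suc.prems
    by (metis Diff_iff card_Suc_Diff1 card_insert_disjoint finite_Diff insert_Diff_single)
  ultimately have "(?A', B) \<in> (exchange_rel E V)\<^sup>*" using Suc.hyps(1)[of ?A'] Suc.prems v by blast
  then show ?case using \<open>(A, ?A') \<in> _\<close> by (rule rtrancl_trans[rotated])
qed

text \<open>All elements of \<open>A - B\<close> are predecessors of one and the same vertex, and
  all elements of \<open>B - A\<close> are successors of one and the same vertex. Degrees at most
  one make both differences singletons.\<close>

lemma exchange_card_eq: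
  assumes out1: "single_valued E"
    and in1: "single_valued (E\<inverse>)"
    and fin: "finite A" "finite B" and ex: "exchange E A B"
  shows "card A = card B"
proof -
  obtain a b where ab: "a \<in> A - B" "b \<in> B - A" using ex by (auto simp: exchange_def)
  have "A - B = {a}"
  proof -
    have "x = a" if "x \<in> A - B" for x
      using that ab ex in1 unfolding exchange_def single_valued_def by blast
    then show ?thesis using ab by blast
  qed
  moreover have "B - A = {b}"
  proof -
    have "x = b" if "x \<in> B - A" for x
      using that ab ex out1 unfolding exchange_def single_valued_def by blast
    then show ?thesis using ab by blast
  qed
  ultimately have "card (A - B) = card (B - A)" by simp
  then show ?thesis using fin by (metis card_Diff_subset_Int card_Int_Diff finite_Int inf_commute)
qed

lemma exchange_connected_linear:
  assumes E: "E \<subseteq> V \<times> V" and fin: "finite V"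
    and conn: "V \<times> V \<subseteq> (E \<union> E\<inverse>)\<^sup>*"
    and out1: "single_valued E"
    and in1: "single_valued (E\<inverse>)"
    and "A \<subseteq> V" "B \<subseteq> V"
  shows "(A, B) \<in> (exchange_rel E V)\<^sup>* \<longleftrightarrow> card A = card B"
proof
  assume "(A, B) \<in> (exchange_rel E V)\<^sup>*"
  then show "card A = card B"
  proof induction
    case (step B C)
    then have "finite B" "finite C" using fin finite_subset by (auto simp: exchange_rel_def)
    moreover have "exchange E B C \<or> exchange E C B" using step by (simp add: exchange_rel_def)
    ultimately have "card B = card C" using exchange_card_eq[OF out1 in1] by metis
    then show ?case using step by simp
  qed simp
qed (use exchange_same_card assms in blast)

text \<open>The only change of size is the exchange of \<open>{v}\<close> for \<open>{a, b}\<close>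
  in the presence of a spectator set \<open>C\<close>. Both \<open>A\<close> and \<open>B\<close>
  are brought to this position by moves of constant size.\<close>

lemma exchange_branch:
  assumes E: "E \<subseteq> V \<times> V" and fin: "finite V"
    and conn: "V \<times> V \<subseteq> (E \<union> E\<inverse>)\<^sup>*"
    and branch: "a \<noteq> b" "(v, a) \<in> E \<and> (v, b) \<in> E \<or> (a, v) \<in> E \<and> (b, v) \<in> E"
      "v \<noteq> a" "v \<noteq> b"
    and A: "A \<subseteq> V" "card A = k" and B: "B \<subseteq> V" "card B = Suc k" and k: "k \<ge> 1" "Suc k < card V"
  shows "(A, B) \<in> (exchange_rel E V)\<^sup>*"
proof -
  have V: "{v, a, b} \<subseteq> V" using branch E by auto
  have "card (V - {v, a, b}) = card V - 3" using V branch fin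
    by (subst card_Diff_subset) (auto intro: finite_subset)
  \<comment> \<open>The bound \<open>Suc k < card V\<close> is what leaves room for the
    \<open>k - 1\<close> elements of \<open>C\<close> outside the three vertices.\<close>
  then have "k - 1 \<le> card (V - {v, a, b})" using k by linarith
  then obtain C where C: "C \<subseteq> V - {v, a, b}" "card C = k - 1" "finite C"
    using obtain_subset_with_card_n by metis
  have c: "card (insert v C) = k" "card (insert a (insert b C)) = Suc k"
    using C branch k by (auto simp: card_insert_if)
  have "insert v C - insert a (insert b C) = {v}" "insert a (insert b C) - insert v C = {a, b}"
    using C branch by auto
  then have "exchange E (insert v C) (insert a (insert b C))
      \<or> exchange E (insert a (insert b C)) (insert v C)"
    using branch by (auto simp: exchange_def)
  then have 1: "(insert v C, insert a (insert b C)) \<in> exchange_rel E V"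
    using C V by (auto simp: exchange_rel_def)
  have 2: "(A, insert v C) \<in> (exchange_rel E V)\<^sup>*"
    using C V c A by (intro exchange_same_card[OF E fin conn]) auto
  have 3: "(insert a (insert b C), B) \<in> (exchange_rel E V)\<^sup>*"
    using C V c B by (intro exchange_same_card[OF E fin conn]) auto
  show ?thesis using 1 2 3 by (meson rtrancl.rtrancl_into_rtrancl rtrancl_trans)
qed

text \<open>A branching vertex is demanded only from three vertices on: with at most two, all proper
  nonempty subsets are singletons and no change of size occurs. Otherwise the larger set is shrunk
  one element at a time.\<close>

lemma exchange_connected_branched:
  assumes E: "E \<subseteq> V \<times> V" and fin: "finite V"
    and conn: "V \<times> V \<subseteq> (E \<union> E\<inverse>)\<^sup>*"
    and branch: "card V \<ge> 3 \<Longrightarrow> \<exists>v a b. a \<noteq> b \<and> v \<noteq> a \<and> v \<noteq> b \<and>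
       ((v, a) \<in> E \<and> (v, b) \<in> E \<or> (a, v) \<in> E \<and> (b, v) \<in> E)"
    and AB: "A \<subseteq> V" "B \<subseteq> V" "A \<noteq> {}" "B \<noteq> {}" "A \<noteq> V" "B \<noteq> V"
  shows "(A, B) \<in> (exchange_rel E V)\<^sup>*"
proof -
  have *: "(A, B) \<in> (exchange_rel E V)\<^sup>*"
    if "A \<subseteq> V" "A \<noteq> {}" "B \<subseteq> V" "B \<noteq> V" "card A \<le> card B" for A B
  proof -
    have fA: "finite A" "A \<noteq> {}" using that fin finite_subset by auto
    have "card B < card V" using that fin by (simp add: psubset_card_mono psubset_eq)
    then show ?thesis using that(3-)
    proof (induction "card B - card A" arbitrary: B)
      case 0
      then show ?case using exchange_same_card[OF E fin conn that(1)] by simp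
    next
      case (Suc n)
      then obtain b where b: "b \<in> B" by (metis card.empty card_gt_0_iff diff_0_eq_0 ex_in_conv nat.distinct(1))
      have fB: "finite B" using Suc.prems fin finite_subset by auto
      have cB: "card B = Suc (card (B - {b}))" using b fB by (metis card_Suc_Diff1)
      have "card A \<ge> 1" using fA by (simp add: Suc_leI card_gt_0_iff)
      \<comment> \<open>The larger set keeps at least \<open>card A\<close> elements after losing
        \<open>b\<close>, so it had at least two; being proper, it forces three vertices.\<close>
      then have k: "card (B - {b}) \<ge> 1" using Suc(2) cB by linarith
      then have "card V \<ge> 3" using Suc.prems(1) cB by linarith
      from branch[OF this] obtain v x y where br: "x \<noteq> y" 
        "(v, x) \<in> E \<and> (v, y) \<in> E \<or> (x, v) \<in> E \<and> (y, v) \<in> E" "v \<noteq> x" "v \<noteq> y" by blast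
      have "(A, B - {b}) \<in> (exchange_rel E V)\<^sup>*"
      proof (rule Suc.hyps(1))
        show "n = card (B - {b}) - card A" using Suc.hyps(2) cB by linarith
        show "card (B - {b}) < card V" using Suc.prems cB by linarith
        show "B - {b} \<noteq> V" using Suc.prems by blast
        show "card A \<le> card (B - {b})" using Suc.hyps(2) cB by linarith
      qed (use Suc.prems in blast)
      moreover have "(B - {b}, B) \<in> (exchange_rel E V)\<^sup>*"
      proof (rule exchange_branch[OF E fin conn br _ refl _ cB k])
        show "Suc (card (B - {b})) < card V" using Suc.prems cB by linarith
      qed (use Suc.prems in blast)+
      ultimately show ?case by simp
    qed
  qed
  show ?thesis using *[of A B] *[of B A] AB exchange_rel_rtrancl_sym nle_le by metis
qed

text \<open>Degrees at most one straighten an undirected walk into a directed path, so any two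
  vertices are comparable. The number of ancestors grows strictly along paths, hence it is
  injective, and the range follows by counting.\<close>

lemma linear_numbering:
  assumes fin: "finite V" and E: "E \<subseteq> V \<times> V" and ac: "acyclic E"
    and conn: "V \<times> V \<subseteq> (E \<union> E\<inverse>)\<^sup>*"
    and out1: "single_valued E"
    and in1: "single_valued (E\<inverse>)"
  obtains f where "bij_betw f V {1..card V}"
    and "\<And>u v. u \<in> V \<Longrightarrow> v \<in> V \<Longrightarrow> (u, v) \<in> E \<longleftrightarrow> f v = Suc (f u)"
proof -
  define anc where "anc v = {u. (u, v) \<in> E\<^sup>+}" for v
  \<comment> \<open>Since in-degrees are at most 1, an arrow \<open>u \<rightarrow> v\<close> adds exactly \<open>u\<close> to the ancestors.\<close>
  define f where "f v = Suc (card (anc v))" for v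
  have ancV: "anc v \<subseteq> V" for v
    using E trancl_subset_Sigma[OF E] by (auto simp: anc_def)
  then have fin_anc: "finite (anc v)" for v using fin finite_subset by blast
  have not_self: "v \<notin> anc v" for v using ac by (auto simp: anc_def acyclic_def)
  have f_edge: "f v = Suc (f u)" if "(u, v) \<in> E" for u v
  proof -
    have "anc v = insert u (anc u)"
    proof (intro equalityI subsetI)
      fix x assume "x \<in> anc v"
      then have "(x, v) \<in> E\<^sup>+" by (simp add: anc_def)
      then show "x \<in> insert u (anc u)"
        by cases (use that in1 in \<open>auto simp: anc_def single_valued_def\<close>)
    qed (use that in \<open>auto simp: anc_def intro: trancl_into_trancl\<close>)
    then show ?thesis using not_self fin_anc by (simp add: f_def)
  qed
  have f_mono: "f u < f v" if "(u, v) \<in> E\<^sup>+" for u v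
    using that by induction (auto dest: f_edge)
  \<comment> \<open>The arrow leaving \<open>w\<close> is unique, so a nonempty path from
    \<open>w\<close> to \<open>x\<close> must begin with the step to \<open>v\<close>;
    \<open>in_step\<close> is the dual statement.\<close>
  have out_step: "(v, x) \<in> E\<^sup>*" if "(w, x) \<in> E\<^sup>*" "(w, v) \<in> E" "w \<noteq> x" for v w x
    using that(1)
    by (cases rule: converse_rtranclE) (use that out1 in \<open>auto simp: single_valued_def\<close>)
  have in_step: "(x, v) \<in> E\<^sup>*" if "(x, w) \<in> E\<^sup>*" "(v, w) \<in> E" "w \<noteq> x" for v w x
    using that(1)
    by (cases rule: rtranclE) (use that in1 in \<open>auto simp: single_valued_def\<close>)
  have comparable: "(u, v) \<in> E\<^sup>* \<or> (v, u) \<in> E\<^sup>*" if "(u, v) \<in> (E \<union> E\<inverse>)\<^sup>*" for u v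
    using that
  proof induction
    case (step w v)
    then consider "(u, w) \<in> E\<^sup>*" "(w, v) \<in> E" | "(u, w) \<in> E\<^sup>*" "(v, w) \<in> E"
      | "(w, u) \<in> E\<^sup>*" "(w, v) \<in> E" | "(w, u) \<in> E\<^sup>*" "(v, w) \<in> E" by auto
    then show ?case
    proof cases
      case 2
      then show ?thesis using in_step[of u w v] by (cases "w = u") auto
    next
      case 3
      then show ?thesis using out_step[of w u v] by (cases "w = u") auto
    qed (auto intro: rtrancl_trans)
  qed simp
  have tot: "u = v \<or> (u, v) \<in> E\<^sup>+ \<or> (v, u) \<in> E\<^sup>+" if "u \<in> V" "v \<in> V" for u v
    using comparable[of u v] conn that by (auto dest: rtranclD)
  have inj: "inj_on f V"
  proof (rule inj_onI)
    fix u v assume "u \<in> V" "v \<in> V" "f u = f v"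
    then show "u = v" using tot[of u v] f_mono[of u v] f_mono[of v u] by auto
  qed
  have "f ` V \<subseteq> {1..card V}"
  proof -
    have "card (anc v) < card V" if "v \<in> V" for v
      using ancV[of v] not_self[of v] that fin by (metis psubsetI psubset_card_mono)
    then show ?thesis by (auto simp: f_def Suc_leI)
  qed
  moreover have "card (f ` V) = card {1..card V}" using card_image[OF inj] by simp
  ultimately have "f ` V = {1..card V}" by (simp add: card_subset_eq)
  then have bij: "bij_betw f V {1..card V}" using inj by (simp add: bij_betw_def)
  have "(u, v) \<in> E" if "u \<in> V" "v \<in> V" "f v = Suc (f u)" for u v
  proof -
    have "(u, v) \<in> E\<^sup>+" using tot[OF that(1,2)] f_mono[of v u] that(3) by auto
    then obtain w where w: "(u, w) \<in> E" "(w, v) \<in> E\<^sup>*" by (metis tranclD)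
    \<comment> \<open>The first vertex after \<open>u\<close> on the path to \<open>v\<close>
      already carries the number of \<open>v\<close>. Numbers increase strictly along paths, so the
      path ends there.\<close>
    have "f w = f v" using f_edge[OF w(1)] that by simp
    then have "w = v" using w(2) f_mono[of w v] by (auto dest: rtranclD)
    then show ?thesis using w by simp
  qed
  then show ?thesis using that[OF bij] f_edge by blast
qed

text \<open>In the linear quiver an arrow is labelled by its source, so the arrow
  \<open>(u, v)\<close> has to go to \<open>f u\<close>. This is injective because at most one
  merged arrow leaves a vertex.\<close>

lemma linear_iso_merge_parallel:
  assumes fin: "finite (verts Q)" and wf: "wf_digraph Q" and ac: "acyclic (arcs_ends Q)"
    and conn: "verts Q \<times> verts Q \<subseteq> (arcs_ends Q \<union> (arcs_ends Q)\<inverse>)\<^sup>*"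
    and out1: "single_valued (arcs_ends Q)"
    and in1: "single_valued ((arcs_ends Q)\<inverse>)"
  shows "digraph_iso (merge_parallel Q) (linear_quiver (card (verts Q)))"
proof -
  let ?n = "card (verts Q)"
  have E: "arcs_ends Q \<subseteq> verts Q \<times> verts Q"
    using wf wf_digraph.adj_in_verts by fastforce
  obtain f where f: "bij_betw f (verts Q) {1..?n}"
    and fE: "\<And>u v. u \<in> verts Q \<Longrightarrow> v \<in> verts Q \<Longrightarrow> (u, v) \<in> arcs_ends Q \<longleftrightarrow> f v = Suc (f u)"
    using linear_numbering[OF fin E ac conn out1 in1] by metis
  define h :: "('a, 'a \<times> 'a, nat, nat) digraph_isomorphism" where
    "h = \<lparr>iso_verts = f, iso_arcs = \<lambda>(u, v). f u, iso_head = Suc, iso_tail = \<lambda>i. i\<rparr>"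
  have "wf_digraph (merge_parallel Q)"
    using E by unfold_locales (auto simp: merge_parallel_def)
  moreover have "inj_on (\<lambda>(u, v). f u) (arcs_ends Q)"
  proof (rule inj_onI, clarify)
    fix u v u' v' assume *: "(u, v) \<in> arcs_ends Q" "(u', v') \<in> arcs_ends Q" "f u = f u'"
    then have "u = u'" using f E by (metis (no_types, lifting) bij_betw_def inj_onD mem_Sigma_iff subsetD)
    then show "u = u' \<and> v = v'" using * out1 by (auto simp: single_valued_def)
  qed
  ultimately have "pre_digraph.digraph_isomorphism (merge_parallel Q) h"
    using f E fE by (auto simp: pre_digraph.digraph_isomorphism_def h_def merge_parallel_def bij_betw_def)
  moreover have "(\<lambda>(u, v). f u) ` arcs_ends Q = {1..<?n}"
  proof (intro equalityI subsetI)
    fix i assume "i \<in> (\<lambda>(u, v). f u) ` arcs_ends Q"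
    then obtain u v where uv: "(u, v) \<in> arcs_ends Q" "i = f u" by auto
    then have "u \<in> verts Q" "v \<in> verts Q" using E by auto
    then have "f u \<in> {1..?n}" "f v \<in> {1..?n}" "f v = Suc (f u)"
      using bij_betwE[OF f] fE uv by blast+
    then show "i \<in> {1..<?n}" using uv by auto
  next
    fix i assume i: "i \<in> {1..<?n}"
    then have "i \<in> f ` verts Q" "Suc i \<in> f ` verts Q" using f by (auto simp: bij_betw_def)
    then obtain u v where "u \<in> verts Q" "v \<in> verts Q" "i = f u" "Suc i = f v" by auto
    then show "i \<in> (\<lambda>(u, v). f u) ` arcs_ends Q" using fE by force
  qed
  then have "linear_quiver ?n = app_iso h (merge_parallel Q)"
    using f by (simp add: linear_quiver_def app_iso_def h_def merge_parallel_def bij_betw_def)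
  ultimately show ?thesis unfolding digraph_iso_def by blast
qed

text \<open>The strong components are the classes of mutual reachability, that is, the nonempty
  fibres of the invariant \<open>g\<close>; counting them means counting its values.\<close>

lemma card_sccs_verts_classified:
  assumes wf: "wf_digraph G" and sym: "symmetric G"
    and cls: "\<And>u v. u \<in> verts G \<Longrightarrow> v \<in> verts G \<Longrightarrow> u \<rightarrow>\<^sup>*\<^bsub>G\<^esub> v \<longleftrightarrow> g u = g v"
  shows "card (pre_digraph.sccs_verts G) = card (g ` verts G)"
proof -
  interpret wf_digraph G by (rule wf)
  define C where "C y = {v \<in> verts G. g v = y}" for y
  have "sccs_verts = C ` g ` verts G"
  proof (intro equalityI subsetI)
    fix S assume S: "S \<in> sccs_verts"
    then obtain u where u: "u \<in> S" by (auto simp: sccs_verts_def)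
    have uV: "u \<in> verts G" using S u by (auto simp: sccs_verts_def elim: reachable_in_vertsE)
    have "S = C (g u)"
      using S u uV cls unfolding sccs_verts_def C_def
      by (auto simp: ) (metis reachable_in_vertsE)+
    then show "S \<in> C ` g ` verts G" using uV by blast
  next
    fix S assume "S \<in> C ` g ` verts G"
    then obtain u where u: "u \<in> verts G" "S = C (g u)" by blast
    then show "S \<in> sccs_verts"
      unfolding sccs_verts_def C_def using cls by (auto elim: reachable_in_vertsE)
  qed
  moreover have "inj_on C (g ` verts G)" by (rule inj_onI) (auto simp: C_def)
  ultimately show ?thesis by (simp add: card_image)
qed

section \<open>The algebra of a quiver and its universal property\<close>

locale word_functions = K?: field K for K (structure) + fixes V :: "'v set"
begin

abbreviation F where "F \<equiv> free_algebra K V"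

text \<open>A word has only finitely many splittings, so the convolution makes sense for arbitrary
  functions on words. Finite support enters only with \<open>conv_in_F\<close>, which keeps the
  associativity proof free of it.\<close>

definition conv where
  "conv f g w = (\<Oplus>i\<in>{..length w}. f (take i w) \<otimes> g (drop i w))"

definition single :: "'a \<Rightarrow> 'v list \<Rightarrow> 'v list \<Rightarrow> 'a" where
  "single c w = (\<lambda>v. if v = w then c else \<zero>)"

lemma F_mult: "f \<otimes>\<^bsub>F\<^esub> g = conv f g"
  by (simp add: free_algebra_def conv_def fun_eq_iff)

lemma F_add: "f \<oplus>\<^bsub>F\<^esub> g = (\<lambda>w. f w \<oplus> g w)"
  by (simp add: free_algebra_def)

lemma F_zero: "\<zero>\<^bsub>F\<^esub> = (\<lambda>w. \<zero>)"
  by (simp add: free_algebra_def)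

lemma F_one: "\<one>\<^bsub>F\<^esub> = single \<one> []"
  by (simp add: free_algebra_def single_def)

lemma in_F: "f \<in> carrier F \<longleftrightarrow>
    (\<forall>w. f w \<in> carrier K) \<and> finite {w. f w \<noteq> \<zero>} \<and> {w. f w \<noteq> \<zero>} \<subseteq> lists V"
  by (simp add: free_algebra_def)

lemma conv_closed [simp]:
  "(\<And>w. f w \<in> carrier K) \<Longrightarrow> (\<And>w. g w \<in> carrier K) \<Longrightarrow> conv f g w \<in> carrier K"
  by (simp add: conv_def)

lemma conv_Nil:
  "(\<And>w. f w \<in> carrier K) \<Longrightarrow> (\<And>w. g w \<in> carrier K) \<Longrightarrow> conv f g [] = f [] \<otimes> g []"
  by (simp add: conv_def)

text \<open>
  Peeling off the first letter turns associativity of the convolution into an induction on words.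
\<close>

lemma conv_Cons:
  assumes "\<And>w. f w \<in> carrier K" "\<And>w. g w \<in> carrier K"
  shows "conv f g (a # w) = f [] \<otimes> g (a # w) \<oplus> conv (\<lambda>v. f (a # v)) g w"
proof -
  have "conv f g (a # w) = (\<Oplus>i\<in>{..Suc (length w)}. f (take i (a # w)) \<otimes> g (drop i (a # w)))"
    by (simp add: conv_def)
  also have "\<dots> = (\<Oplus>i\<in>{..length w}. f (take (Suc i) (a # w)) \<otimes> g (drop (Suc i) (a # w)))
      \<oplus> f (take 0 (a # w)) \<otimes> g (drop 0 (a # w))"
    using assms by (intro K.finsum_Suc2) auto
  also have "\<dots> = f [] \<otimes> g (a # w) \<oplus> conv (\<lambda>v. f (a # v)) g w"
    using assms by (simp add: conv_def K.a_comm)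
  finally show ?thesis .
qed

lemma conv_add_left:
  assumes "\<And>w. f w \<in> carrier K" "\<And>w. f' w \<in> carrier K" "\<And>w. g w \<in> carrier K"
  shows "conv (\<lambda>w. f w \<oplus> f' w) g w = conv f g w \<oplus> conv f' g w"
  using assms by (simp add: conv_def K.l_distr K.finsum_addf)

lemma conv_add_right:
  assumes "\<And>w. f w \<in> carrier K" "\<And>w. g w \<in> carrier K" "\<And>w. g' w \<in> carrier K"
  shows "conv f (\<lambda>w. g w \<oplus> g' w) w = conv f g w \<oplus> conv f g' w"
  using assms by (simp add: conv_def K.r_distr K.finsum_addf)

lemma conv_scale_left:
  assumes "c \<in> carrier K" "\<And>w. f w \<in> carrier K" "\<And>w. g w \<in> carrier K"
  shows "conv (\<lambda>w. c \<otimes> f w) g w = c \<otimes> conv f g w"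
  using assms by (simp add: conv_def K.finsum_rdistr K.m_assoc Pi_def)

lemma conv_zero_left:
  assumes "\<And>w. g w \<in> carrier K"
  shows "conv (\<lambda>w. \<zero>) g w = \<zero>"
  using assms by (simp add: conv_def)

lemma conv_assoc:
  assumes "\<And>w. f w \<in> carrier K" "\<And>w. g w \<in> carrier K" "\<And>w. h w \<in> carrier K"
  shows "conv (conv f g) h w = conv f (conv g h) w"
  using assms
proof (induction w arbitrary: f g h)
  case Nil
  then show ?case by (simp add: conv_Nil K.m_assoc)
next
  case (Cons a w)
  let ?fa = "\<lambda>v. f (a # v)" and ?ga = "\<lambda>v. g (a # v)"
  have "(\<lambda>v. conv f g (a # v)) = (\<lambda>v. f [] \<otimes> ?ga v \<oplus> conv ?fa g v)"
    using Cons.prems by (simp add: conv_Cons)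
  \<comment> \<open>Stripping the first letter from a product gives a constant times the stripped
    second factor, plus the stripped first factor times the second. The induction hypothesis takes
    care of the latter term.\<close>
  then have "conv (\<lambda>v. conv f g (a # v)) h w
      = f [] \<otimes> conv ?ga h w \<oplus> conv (conv ?fa g) h w"
    using Cons.prems by (simp add: conv_add_left conv_scale_left)
  also have "conv (conv ?fa g) h w = conv ?fa (conv g h) w"
    using Cons by simp
  finally show ?case
    using Cons.prems
    by (simp add: conv_Cons conv_Nil K.r_distr K.m_assoc K.a_assoc)
qed

lemma single_closed [simp]: "c \<in> carrier K \<Longrightarrow> single c w v \<in> carrier K"
  by (simp add: single_def)

lemma conv_single_Nil:
  assumes "c \<in> carrier K" "\<And>w. g w \<in> carrier K"
  shows "conv (single c []) g w = c \<otimes> g w"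
proof (cases w)
  case Nil
  then show ?thesis using assms by (simp add: conv_Nil single_def)
next
  case (Cons a v)
  then show ?thesis using assms by (simp add: conv_Cons) (simp add: single_def conv_zero_left)
qed

lemma conv_single_single:
  assumes "c \<in> carrier K" "d \<in> carrier K"
  shows "conv (single c u) (single d v) = single (c \<otimes> d) (u @ v)"
proof
  fix w
  show "conv (single c u) (single d v) w = single (c \<otimes> d) (u @ v) w"
  proof (induction u arbitrary: w)
    case Nil
    then show ?case using assms by (simp add: conv_single_Nil) (simp add: single_def)
  next
    case (Cons a u)
    show ?case
    proof (cases w)
      case Nil
      then show ?thesis using assms by (simp add: conv_Nil) (simp add: single_def)
    next
      case (Cons b z)
      have "(\<lambda>y. single c (a # u) (b # y)) = (if a = b then single c u else (\<lambda>_. \<zero>))"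
        by (auto simp: single_def)
      then show ?thesis using Cons.IH[of z] Cons assms
        by (simp add: conv_Cons conv_zero_left) (simp add: single_def)
    qed
  qed
qed

lemma conv_one_right:
  assumes "\<And>w. f w \<in> carrier K"
  shows "conv f (single \<one> []) w = f w"
  using assms
proof (induction w arbitrary: f)
  case Nil
  then show ?case by (simp add: conv_Nil) (simp add: single_def)
next
  case (Cons a w)
  then show ?case by (simp add: conv_Cons) (simp add: single_def)
qed

lemma single_in_F: "c \<in> carrier K \<Longrightarrow> w \<in> lists V \<Longrightarrow> single c w \<in> carrier F"
  by (auto simp: in_F single_def)

lemma add_in_F:
  assumes "f \<in> carrier F" "g \<in> carrier F" shows "(\<lambda>w. f w \<oplus> g w) \<in> carrier F"
proof -
  have "{w. f w \<oplus> g w \<noteq> \<zero>} \<subseteq> {w. f w \<noteq> \<zero>} \<union> {w. g w \<noteq> \<zero>}" by auto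
  moreover have "finite ({w. f w \<noteq> \<zero>} \<union> {w. g w \<noteq> \<zero>})"
    "{w. f w \<noteq> \<zero>} \<union> {w. g w \<noteq> \<zero>} \<subseteq> lists V"
    using assms by (auto simp only: in_F finite_Un)
  ultimately show ?thesis using assms unfolding in_F by (meson K.a_closed finite_subset subset_trans)
qed

lemma conv_in_F:
  assumes "f \<in> carrier F" "g \<in> carrier F" shows "conv f g \<in> carrier F"
proof -
  let ?S = "(\<lambda>(u, v). u @ v) ` ({w. f w \<noteq> \<zero>} \<times> {w. g w \<noteq> \<zero>})"
  have "w \<in> ?S" if "conv f g w \<noteq> \<zero>" for w
  proof -
    have "\<exists>i\<in>{..length w}. f (take i w) \<otimes> g (drop i w) \<noteq> \<zero>"
      using that K.add.finprod_one_eqI unfolding conv_def by meson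
    then obtain i where "f (take i w) \<noteq> \<zero>" "g (drop i w) \<noteq> \<zero>"
      using assms unfolding in_F by (metis K.l_null K.r_null)
    then show ?thesis by (intro image_eqI[of _ _ "(take i w, drop i w)"]) auto
  qed
  then have "{w. conv f g w \<noteq> \<zero>} \<subseteq> ?S" by blast
  moreover have "finite ?S" using assms by (auto simp: in_F)
  moreover have "?S \<subseteq> lists V"
  proof
    fix w assume "w \<in> ?S"
    then obtain u v where "w = u @ v" "f u \<noteq> \<zero>" "g v \<noteq> \<zero>" by auto
    moreover from this have "u \<in> lists V" "v \<in> lists V" using assms by (auto simp only: in_F)
    ultimately show "w \<in> lists V" by simp
  qed
  ultimately show ?thesis using assms by (auto simp: in_F dest: finite_subset)
qed

lemma ring_F: "ring F"
proof (rule ringI)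
  show "abelian_group F"
  proof (rule abelian_groupI)
    fix f assume f: "f \<in> carrier F"
    then show "\<exists>g\<in>carrier F. g \<oplus>\<^bsub>F\<^esub> f = \<zero>\<^bsub>F\<^esub>"
      by (intro bexI[of _ "\<lambda>w. \<ominus> f w"]) (auto simp: F_add F_zero in_F K.l_neg)
  qed (auto simp: F_add F_zero add_in_F in_F[of "\<lambda>_. \<zero>"], auto simp: in_F K.a_ac)
  show "monoid F"
  proof (rule monoidI)
    show "\<one>\<^bsub>F\<^esub> \<in> carrier F" by (simp add: F_one single_in_F)
  next
    fix f assume "f \<in> carrier F"
    then show "\<one>\<^bsub>F\<^esub> \<otimes>\<^bsub>F\<^esub> f = f" "f \<otimes>\<^bsub>F\<^esub> \<one>\<^bsub>F\<^esub> = f"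
      by (auto simp: F_mult F_one in_F conv_single_Nil conv_one_right)
  next
    fix f g h assume "f \<in> carrier F" "g \<in> carrier F" "h \<in> carrier F"
    then show "f \<otimes>\<^bsub>F\<^esub> g \<otimes>\<^bsub>F\<^esub> h = f \<otimes>\<^bsub>F\<^esub> (g \<otimes>\<^bsub>F\<^esub> h)"
      by (auto simp: F_mult in_F conv_assoc)
  qed (simp add: F_mult conv_in_F)
qed (auto simp: F_mult F_add in_F conv_add_left conv_add_right)

lemma F_induct [consumes 1, case_names single add]:
  assumes f: "f \<in> carrier F"
    and single: "\<And>c w. c \<in> carrier K \<Longrightarrow> w \<in> lists V \<Longrightarrow> P (single c w)"
    and add: "\<And>f g. f \<in> carrier F \<Longrightarrow> g \<in> carrier F \<Longrightarrow> P f \<Longrightarrow> P g \<Longrightarrow> P (f \<oplus>\<^bsub>F\<^esub> g)"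
  shows "P f"
proof -
  have "finite {w. f w \<noteq> \<zero>}" using f by (simp add: in_F)
  then show ?thesis using f
  proof (induction "{w. f w \<noteq> \<zero>}" arbitrary: f rule: finite_induct)
    case empty
    \<comment> \<open>Zero counts as a monomial with coefficient 0, so the induction rule needs no
      case of its own for it.\<close>
    then have "f = single \<zero> []" by (auto simp: single_def)
    then show ?case using single[of \<zero> "[]"] by simp
  next
    case (insert w W)
    let ?g = "f(w := \<zero>)"
    have W: "W = {v. ?g v \<noteq> \<zero>}" using insert(2,4) by auto
    then have g: "?g \<in> carrier F" using insert(1,4,5) by (auto simp: in_F)
    have w: "f w \<in> carrier K" "w \<in> lists V" using insert(4,5) by (auto simp: in_F)
    have "f = single (f w) w \<oplus>\<^bsub>F\<^esub> ?g" using insert(5) by (auto simp: F_add single_def in_F)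
    then show ?case using add[OF single_in_F[OF w] g single[OF w] insert(3)[OF W g]] by simp
  qed
qed

end

section \<open>Evaluation of the free algebra in an algebra over the field\<close>

locale free_algebra_eval = word_functions K V + S?: ring S
  for K (structure) and V :: "'v set" and S :: "('s, 't) ring_scheme" (structure) +
  fixes j x
  assumes j_hom: "j \<in> ring_hom K S"
    and j_central: "\<And>c r. c \<in> carrier K \<Longrightarrow> r \<in> carrier S \<Longrightarrow> j c \<otimes>\<^bsub>S\<^esub> r = r \<otimes>\<^bsub>S\<^esub> j c"
    and x_closed: "\<And>t. t \<in> V \<Longrightarrow> x t \<in> carrier S"
begin

definition word :: "'v list \<Rightarrow> 's" where
  "word w = foldr (\<lambda>t r. x t \<otimes>\<^bsub>S\<^esub> r) w \<one>\<^bsub>S\<^esub>"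

definition eval_hom :: "('v list \<Rightarrow> 'a) \<Rightarrow> 's" where
  "eval_hom f = (\<Oplus>\<^bsub>S\<^esub>w\<in>{w. f w \<noteq> \<zero>}. j (f w) \<otimes>\<^bsub>S\<^esub> word w)"

lemma j_closed [simp]: "c \<in> carrier K \<Longrightarrow> j c \<in> carrier S"
  using j_hom by (rule ring_hom_closed)

lemma j_zero [simp]: "j \<zero> = \<zero>\<^bsub>S\<^esub>"
  using ring_hom_zero[OF j_hom] K.ring_axioms S.ring_axioms by blast

lemma word_closed [simp]: "w \<in> lists V \<Longrightarrow> word w \<in> carrier S"
  by (induction w) (auto simp: word_def x_closed)

lemma word_append: "u \<in> lists V \<Longrightarrow> v \<in> lists V \<Longrightarrow> word (u @ v) = word u \<otimes>\<^bsub>S\<^esub> word v"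
proof (induction u)
  case Nil
  then show ?case using word_closed[of v] by (simp add: word_def)
next
  case (Cons a u)
  then show ?case using word_closed[of v] word_closed[of u] x_closed
    by (simp add: word_def S.m_assoc)
qed

text \<open>The supports of \<open>f\<close>, \<open>g\<close> and their sum differ; passing to a
  common finite index set makes the three evaluations comparable.\<close>

lemma eval_hom_superset:
  assumes "f \<in> carrier F" "finite W" "{w. f w \<noteq> \<zero>} \<subseteq> W" "W \<subseteq> lists V"
  shows "eval_hom f = (\<Oplus>\<^bsub>S\<^esub>w\<in>W. j (f w) \<otimes>\<^bsub>S\<^esub> word w)"
  unfolding eval_hom_def using assms
  by (intro S.add.finprod_mono_neutral_cong_left) (auto simp: in_F subset_iff)

lemma eval_hom_closed: "f \<in> carrier F \<Longrightarrow> eval_hom f \<in> carrier S"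
  unfolding eval_hom_def by (intro S.finsum_closed) (auto simp: in_F subset_iff)

lemma eval_hom_single:
  assumes "c \<in> carrier K" "w \<in> lists V"
  shows "eval_hom (single c w) = j c \<otimes>\<^bsub>S\<^esub> word w"
proof -
  have "eval_hom (single c w) = (\<Oplus>\<^bsub>S\<^esub>v\<in>{w}. j (single c w v) \<otimes>\<^bsub>S\<^esub> word v)"
    using assms by (intro eval_hom_superset single_in_F) (auto simp: single_def)
  then show ?thesis using assms by (simp add: single_def)
qed

lemma eval_hom_add:
  assumes "f \<in> carrier F" "g \<in> carrier F"
  shows "eval_hom (f \<oplus>\<^bsub>F\<^esub> g) = eval_hom f \<oplus>\<^bsub>S\<^esub> eval_hom g"
proof -
  let ?W = "{w. f w \<noteq> \<zero>} \<union> {w. g w \<noteq> \<zero>}"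
  have W: "finite ?W" "?W \<subseteq> lists V" using assms by (auto simp: in_F)
  have "eval_hom (f \<oplus>\<^bsub>F\<^esub> g) = (\<Oplus>\<^bsub>S\<^esub>w\<in>?W. j (f w \<oplus> g w) \<otimes>\<^bsub>S\<^esub> word w)"
    unfolding F_add using assms W
    by (intro eval_hom_superset add_in_F) (auto simp: in_F)
  also have "\<dots> = (\<Oplus>\<^bsub>S\<^esub>w\<in>?W. j (f w) \<otimes>\<^bsub>S\<^esub> word w \<oplus>\<^bsub>S\<^esub> j (g w) \<otimes>\<^bsub>S\<^esub> word w)"
    using assms W ring_hom_add[OF j_hom]
    by (intro S.finsum_cong') (auto simp: S.l_distr in_F subset_iff)
  also have "\<dots> = (\<Oplus>\<^bsub>S\<^esub>w\<in>?W. j (f w) \<otimes>\<^bsub>S\<^esub> word w) \<oplus>\<^bsub>S\<^esub> (\<Oplus>\<^bsub>S\<^esub>w\<in>?W. j (g w) \<otimes>\<^bsub>S\<^esub> word w)"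
    using assms W by (intro S.finsum_addf) (auto simp: in_F subset_iff)
  also have "\<dots> = eval_hom f \<oplus>\<^bsub>S\<^esub> eval_hom g"
    using assms W by (simp add: eval_hom_superset[of f ?W] eval_hom_superset[of g ?W])
  finally show ?thesis .
qed

lemma eval_hom_mult:
  assumes f: "f \<in> carrier F" and g: "g \<in> carrier F"
  shows "eval_hom (f \<otimes>\<^bsub>F\<^esub> g) = eval_hom f \<otimes>\<^bsub>S\<^esub> eval_hom g"
proof -
  interpret F: ring F by (rule ring_F)
  show ?thesis using f
  proof (induction rule: F_induct)
    case (single c u)
    show ?case using g
    proof (induction rule: F_induct)
      case (single d v)
      \<comment> \<open>Centrality of \<open>j\<close> is what lets the scalar \<open>j d\<close>
        pass the word \<open>u\<close>.\<close>
      have "(j c \<otimes>\<^bsub>S\<^esub> j d) \<otimes>\<^bsub>S\<^esub> (word u \<otimes>\<^bsub>S\<^esub> word v) = (j c \<otimes>\<^bsub>S\<^esub> word u) \<otimes>\<^bsub>S\<^esub> (j d \<otimes>\<^bsub>S\<^esub> word v)"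
        using single \<open>c \<in> _\<close> \<open>u \<in> _\<close> j_central[of d "word u"] by (simp add: S.m_assoc) (simp flip: S.m_assoc)
      moreover have "eval_hom (single (c \<otimes> d) (u @ v)) = j (c \<otimes> d) \<otimes>\<^bsub>S\<^esub> word (u @ v)"
        using single \<open>c \<in> _\<close> \<open>u \<in> _\<close> by (intro eval_hom_single) auto
      ultimately show ?case using single \<open>c \<in> _\<close> \<open>u \<in> _\<close> ring_hom_mult[OF j_hom, of c d]
        by (simp add: F_mult conv_single_single eval_hom_single word_append)
    next
      case (add g h)
      then show ?case using single_in_F[OF single]
        by (simp add: F.r_distr eval_hom_add S.r_distr eval_hom_closed)
    qed
  next
    case (add f h)
    then show ?case using g by (simp add: F.l_distr eval_hom_add S.l_distr eval_hom_closed)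
  qed
qed

lemma eval_hom_const: "c \<in> carrier K \<Longrightarrow> eval_hom (single c []) = j c"
  by (simp add: eval_hom_single) (simp add: word_def)

lemma eval_hom_ring_hom: "eval_hom \<in> ring_hom F S"
  using eval_hom_const[of "\<one>"] ring_hom_one[OF j_hom]
  by (intro ring_hom_memI) (auto simp: eval_hom_closed eval_hom_mult eval_hom_add F_one)

lemma eval_hom_gen: "t \<in> V \<Longrightarrow> eval_hom (free_gen K t) = x t"
  using eval_hom_single[of "\<one>" "[t]"] ring_hom_one[OF j_hom] x_closed
  by (simp add: single_def free_gen_def word_def)

end

context word_functions
begin

lemma free_gen_single: "free_gen K t = single \<one> [t]"
  by (simp add: free_gen_def single_def)

lemma free_gen_closed: "t \<in> V \<Longrightarrow> free_gen K t \<in> carrier F"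
  by (simp add: free_gen_single single_in_F)

text \<open>Splitting off letters one at a time reduces a monomial to a constant and generators, and
  finite support reduces every element to monomials.\<close>

lemma F_generated:
  assumes f: "f \<in> carrier F"
    and const: "\<And>c. c \<in> carrier K \<Longrightarrow> P (single c [])"
    and gen: "\<And>t. t \<in> V \<Longrightarrow> P (free_gen K t)"
    and add: "\<And>f g. f \<in> carrier F \<Longrightarrow> g \<in> carrier F \<Longrightarrow> P f \<Longrightarrow> P g \<Longrightarrow> P (f \<oplus>\<^bsub>F\<^esub> g)"
    and mult: "\<And>f g. f \<in> carrier F \<Longrightarrow> g \<in> carrier F \<Longrightarrow> P f \<Longrightarrow> P g \<Longrightarrow> P (f \<otimes>\<^bsub>F\<^esub> g)"
  shows "P f"
  using f
proof (induction rule: F_induct)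
  case (single c w)
  then show ?case
  proof (induction w)
    case Nil
    then show ?case using const by simp
  next
    case (Cons t w)
    have "single c (t # w) = free_gen K t \<otimes>\<^bsub>F\<^esub> single c w"
      using Cons.prems by (simp add: F_mult free_gen_single conv_single_single)
    then show ?case using Cons gen mult[of "free_gen K t" "single c w"] 
      by (auto simp: free_gen_closed single_in_F)
  qed
qed (use add in blast)

lemma single_Nil_central:
  assumes "c \<in> carrier K" "f \<in> carrier F"
  shows "single c [] \<otimes>\<^bsub>F\<^esub> f = f \<otimes>\<^bsub>F\<^esub> single c []"
proof -
  interpret F: ring F by (rule ring_F)
  show ?thesis using assms(2)
  proof (induction rule: F_induct)
    case (single d w)
    then show ?case using assms by (simp add: F_mult conv_single_single K.m_comm)
  qed (use assms single_in_F[of c "[]"] in \<open>simp add: F.l_distr F.r_distr\<close>)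
qed

end

section \<open>The quotient by the relations and its universal property\<close>

locale quiver_algebra = word_functions K "verts Q" for K (structure) and Q :: "('v, 'e) pre_digraph"
begin

abbreviation "I \<equiv> BQ_ideal K Q"
abbreviation "R \<equiv> BQ K Q"
abbreviation "\<iota> \<equiv> BQ_unit K Q"

definition proj where "proj f = I +>\<^bsub>F\<^esub> f"

definition X where "X t = proj (free_gen K t)"

lemma relations_closed: "BQ_relations K Q \<subseteq> carrier F"
proof -
  interpret F: ring F by (rule ring_F)
  show ?thesis by (auto simp: BQ_relations_def Let_def free_gen_closed)
qed

lemma ideal_I: "ideal I F"
  unfolding BQ_ideal_def using ring.genideal_ideal[OF ring_F relations_closed] .

lemma ring_R: "ring R"
  unfolding BQ_def using ideal.quotient_is_ring[OF ideal_I] .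

lemma proj_hom: "proj \<in> ring_hom F R"
  unfolding BQ_def using ideal.rcos_ring_hom[OF ideal_I] by (simp add: proj_def[abs_def])

lemma proj_surj: "r \<in> carrier R \<Longrightarrow> \<exists>f\<in>carrier F. r = proj f"
  by (auto simp: BQ_def FactRing_def A_RCOSETS_def' proj_def)

lemma proj_eq_iff:
  assumes "f \<in> carrier F" "g \<in> carrier F"
  shows "proj f = proj g \<longleftrightarrow> f \<ominus>\<^bsub>F\<^esub> g \<in> I"
proof -
  interpret ideal I F by (rule ideal_I)
  show ?thesis using assms quotient_eq_iff_same_a_r_cos[OF ideal_I] by (simp add: proj_def)
qed

lemma X_closed: "t \<in> verts Q \<Longrightarrow> X t \<in> carrier R"
  unfolding X_def by (rule ring_hom_closed[OF proj_hom free_gen_closed])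

lemma unit_eq: "\<iota> c = proj (single c [])"
  by (simp add: BQ_unit_def proj_def single_def)

lemma unit_hom: "\<iota> \<in> ring_hom K R"
proof (rule ring_hom_memI)
  fix c assume "c \<in> carrier K"
  then show "\<iota> c \<in> carrier R" by (simp add: unit_eq single_in_F ring_hom_closed[OF proj_hom])
next
  fix c d assume *: "c \<in> carrier K" "d \<in> carrier K"
  then show "\<iota> (c \<otimes> d) = \<iota> c \<otimes>\<^bsub>R\<^esub> \<iota> d"
    using ring_hom_mult[OF proj_hom single_in_F[of c "[]"] single_in_F[of d "[]"]]
    by (simp add: unit_eq F_mult conv_single_single)
  have "single (c \<oplus> d) [] = single c [] \<oplus>\<^bsub>F\<^esub> single d []" by (auto simp: single_def F_add)
  then show "\<iota> (c \<oplus> d) = \<iota> c \<oplus>\<^bsub>R\<^esub> \<iota> d"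
    using * ring_hom_add[OF proj_hom single_in_F[of c "[]"] single_in_F[of d "[]"]]
    by (simp add: unit_eq)
next
  show "\<iota> \<one> = \<one>\<^bsub>R\<^esub>" using ring_hom_one[OF proj_hom] by (simp add: unit_eq F_one)
qed

lemma unit_central:
  assumes "c \<in> carrier K" "r \<in> carrier R" shows "\<iota> c \<otimes>\<^bsub>R\<^esub> r = r \<otimes>\<^bsub>R\<^esub> \<iota> c"
proof -
  obtain f where f: "f \<in> carrier F" "r = proj f" using proj_surj assms by blast
  then show ?thesis using single_Nil_central[OF assms(1) f(1)] assms
    by (metis unit_eq single_in_F ring_hom_mult[OF proj_hom] lists.Nil)
qed

text \<open>The induction principle behind all later uniqueness and stability arguments:
  homomorphisms and derivations are compared on the \<open>X t\<close>, and subspaces are tested for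
  stability on them.\<close>

lemma generated:
  assumes r: "r \<in> carrier R"
    and const: "\<And>c. c \<in> carrier K \<Longrightarrow> P (\<iota> c)"
    and gen: "\<And>t. t \<in> verts Q \<Longrightarrow> P (X t)"
    and add: "\<And>r s. r \<in> carrier R \<Longrightarrow> s \<in> carrier R \<Longrightarrow> P r \<Longrightarrow> P s \<Longrightarrow> P (r \<oplus>\<^bsub>R\<^esub> s)"
    and mult: "\<And>r s. r \<in> carrier R \<Longrightarrow> s \<in> carrier R \<Longrightarrow> P r \<Longrightarrow> P s \<Longrightarrow> P (r \<otimes>\<^bsub>R\<^esub> s)"
  shows "P r"
proof -
  obtain f where f: "f \<in> carrier F" "r = proj f" using proj_surj r by blast
  have "P (proj f)" using f(1)
  proof (rule F_generated)
    fix f g assume fg: "f \<in> carrier F" "g \<in> carrier F" "P (proj f)" "P (proj g)"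
    show "P (proj (f \<oplus>\<^bsub>F\<^esub> g))" "P (proj (f \<otimes>\<^bsub>F\<^esub> g))"
      using fg add[of "proj f" "proj g"] mult[of "proj f" "proj g"] ring_hom_closed[OF proj_hom]
        ring_hom_add[OF proj_hom] ring_hom_mult[OF proj_hom] by auto
  qed (use const gen in \<open>auto simp: unit_eq X_def\<close>)
  then show ?thesis using f by simp
qed

lemma relations:
  assumes "s \<in> verts Q" "t \<in> verts Q"
  shows "X s \<otimes>\<^bsub>R\<^esub> X s = X s"
    and "X s \<otimes>\<^bsub>R\<^esub> X t \<otimes>\<^bsub>R\<^esub> X s = X t \<otimes>\<^bsub>R\<^esub> X s \<otimes>\<^bsub>R\<^esub> X t"
    and "\<not> t \<rightarrow>\<^bsub>Q\<^esub> s \<Longrightarrow> X t \<otimes>\<^bsub>R\<^esub> X s \<otimes>\<^bsub>R\<^esub> X t = X s \<otimes>\<^bsub>R\<^esub> X t"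
proof -
  interpret F: ring F by (rule ring_F)
  note hom = ring_hom_mult[OF proj_hom]
  have eq: "proj f = proj g" if "f \<ominus>\<^bsub>F\<^esub> g \<in> BQ_relations K Q" "f \<in> carrier F" "g \<in> carrier F" for f g
    using that F.genideal_self[OF relations_closed] by (subst proj_eq_iff) (auto simp: BQ_ideal_def)
  have g: "free_gen K s \<in> carrier F" "free_gen K t \<in> carrier F" using assms free_gen_closed by auto
  show "X s \<otimes>\<^bsub>R\<^esub> X s = X s"
    unfolding X_def using g assms
    by (simp flip: hom) (rule eq, auto simp: BQ_relations_def Let_def)
  show "X s \<otimes>\<^bsub>R\<^esub> X t \<otimes>\<^bsub>R\<^esub> X s = X t \<otimes>\<^bsub>R\<^esub> X s \<otimes>\<^bsub>R\<^esub> X t"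
    unfolding X_def using g assms
    by (simp flip: hom) (rule eq, auto simp: BQ_relations_def Let_def)
  show "X t \<otimes>\<^bsub>R\<^esub> X s \<otimes>\<^bsub>R\<^esub> X t = X s \<otimes>\<^bsub>R\<^esub> X t" if "\<not> t \<rightarrow>\<^bsub>Q\<^esub> s"
    unfolding X_def using g assms that
    by (simp flip: hom) (rule eq, auto simp: BQ_relations_def Let_def)
qed

text \<open>Evaluation on the free algebra has an ideal as kernel. The assumptions on
  \<open>x\<close> put the relations into it, hence all of \<open>I\<close>, and evaluation factors
  through the quotient. The target may be noncommutative, since triangular matrices will be one of
  the targets.\<close>

lemma universal:
  fixes S :: "('s, 't) ring_scheme"
  assumes S: "ring S" and j: "j \<in> ring_hom K S"
    and central: "\<And>c r. c \<in> carrier K \<Longrightarrow> r \<in> carrier S \<Longrightarrow> j c \<otimes>\<^bsub>S\<^esub> r = r \<otimes>\<^bsub>S\<^esub> j c"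
    and x: "\<And>t. t \<in> verts Q \<Longrightarrow> x t \<in> carrier S"
    and idem: "\<And>s. s \<in> verts Q \<Longrightarrow> x s \<otimes>\<^bsub>S\<^esub> x s = x s"
    and braid: "\<And>s t. s \<in> verts Q \<Longrightarrow> t \<in> verts Q \<Longrightarrow>
       x s \<otimes>\<^bsub>S\<^esub> x t \<otimes>\<^bsub>S\<^esub> x s = x t \<otimes>\<^bsub>S\<^esub> x s \<otimes>\<^bsub>S\<^esub> x t"
    and absorb: "\<And>s t. s \<in> verts Q \<Longrightarrow> t \<in> verts Q \<Longrightarrow> \<not> t \<rightarrow>\<^bsub>Q\<^esub> s \<Longrightarrow>
       x t \<otimes>\<^bsub>S\<^esub> x s \<otimes>\<^bsub>S\<^esub> x t = x s \<otimes>\<^bsub>S\<^esub> x t"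
  obtains \<rho> where "\<rho> \<in> ring_hom R S" "\<And>c. c \<in> carrier K \<Longrightarrow> \<rho> (\<iota> c) = j c"
    "\<And>t. t \<in> verts Q \<Longrightarrow> \<rho> (X t) = x t"
proof -
  interpret S: ring S by (rule S)
  interpret F: ring F by (rule ring_F)
  interpret ev: free_algebra_eval K "verts Q" S j x
    proof (intro free_algebra_eval.intro free_algebra_eval_axioms.intro)
    show "word_functions K" by unfold_locales
  qed (rule S, rule j, erule (1) central, erule x)
  let ?e = ev.eval_hom
  interpret h: ring_hom_ring F S ?e
    using ring_F S ev.eval_hom_ring_hom by (rule ring_hom_ringI2)
  have diff: "f \<ominus>\<^bsub>F\<^esub> g \<in> a_kernel F S ?e \<longleftrightarrow> ?e f = ?e g"
    if fg: "f \<in> carrier F" "g \<in> carrier F" for f g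
  proof -
    have "?e (f \<ominus>\<^bsub>F\<^esub> g) = ?e f \<oplus>\<^bsub>S\<^esub> \<ominus>\<^bsub>S\<^esub> ?e g"
      using h.hom_add[OF fg(1) F.a_inv_closed[OF fg(2)]] h.hom_a_inv[OF fg(2)]
      by (simp only: a_minus_def)
    moreover have "?e f \<oplus>\<^bsub>S\<^esub> \<ominus>\<^bsub>S\<^esub> ?e g = \<zero>\<^bsub>S\<^esub> \<longleftrightarrow> ?e f = ?e g"
      using h.hom_closed[OF fg(1)] h.hom_closed[OF fg(2)]
      by (metis S.a_inv_closed S.minus_equality S.minus_minus S.r_neg)
    ultimately show ?thesis
      using F.minus_closed[OF fg] unfolding a_kernel_def' by simp
  qed
  note e_simps = free_gen_closed ev.eval_hom_gen
  have "BQ_relations K Q \<subseteq> a_kernel F S ?e"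
  proof
    fix z assume "z \<in> BQ_relations K Q"
    then show "z \<in> a_kernel F S ?e"
      unfolding BQ_relations_def Let_def
    proof (elim UnE CollectE exE conjE)
      fix s assume "s \<in> verts Q" "z = free_gen K s \<otimes>\<^bsub>F\<^esub> free_gen K s \<ominus>\<^bsub>F\<^esub> free_gen K s"
      then show ?thesis using idem[of s] by (simp add: e_simps diff)
    next
      fix s t assume "s \<in> verts Q" "t \<in> verts Q"
        "z = free_gen K s \<otimes>\<^bsub>F\<^esub> free_gen K t \<otimes>\<^bsub>F\<^esub> free_gen K s
          \<ominus>\<^bsub>F\<^esub> free_gen K t \<otimes>\<^bsub>F\<^esub> free_gen K s \<otimes>\<^bsub>F\<^esub> free_gen K t"
      then show ?thesis using braid[of s t] by (simp add: e_simps diff)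
    next
      fix s t assume "s \<in> verts Q" "t \<in> verts Q" "\<not> t \<rightarrow>\<^bsub>Q\<^esub> s"
        "z = free_gen K t \<otimes>\<^bsub>F\<^esub> free_gen K s \<otimes>\<^bsub>F\<^esub> free_gen K t
          \<ominus>\<^bsub>F\<^esub> free_gen K s \<otimes>\<^bsub>F\<^esub> free_gen K t"
      then show ?thesis using absorb[of s t] by (simp add: e_simps diff)
    qed
  qed
  then have "I \<subseteq> a_kernel F S ?e"
    unfolding BQ_ideal_def using F.genideal_minimal[OF h.kernel_is_ideal] by blast
  then have e_eq: "?e f = ?e g" if "f \<in> carrier F" "g \<in> carrier F" "proj f = proj g" for f g
    using \<open>I \<subseteq> _\<close> iffD1[OF proj_eq_iff[OF that(1,2)] that(3)] diff[OF that(1,2)] by blast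
  \<comment> \<open>An arbitrary representative of the coset is evaluated; \<open>e_eq\<close> makes
    the result independent of the choice.\<close>
  define \<rho> where "\<rho> r = ?e (SOME f. f \<in> carrier F \<and> r = proj f)" for r
  have rho: "\<rho> (proj f) = ?e f" if "f \<in> carrier F" for f
  proof -
    have "f \<in> carrier F \<and> proj f = proj f" using that by blast
    from someI[of "\<lambda>g. g \<in> carrier F \<and> proj f = proj g", OF this]
    show ?thesis unfolding \<rho>_def by (elim conjE) (rule e_eq[OF _ that], assumption, erule sym)
  qed
  have "\<rho> \<in> ring_hom R S"
  proof (rule ring_hom_memI)
    fix r assume "r \<in> carrier R"
    then obtain f where "f \<in> carrier F" "r = proj f" using proj_surj by blast
    then show "\<rho> r \<in> carrier S" using rho[of f] ev.eval_hom_closed[of f] by simp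
  next
    fix r s assume "r \<in> carrier R" "s \<in> carrier R"
    then obtain f g where fg: "f \<in> carrier F" "g \<in> carrier F" "r = proj f" "s = proj g"
      using proj_surj by meson
    then show "\<rho> (r \<otimes>\<^bsub>R\<^esub> s) = \<rho> r \<otimes>\<^bsub>S\<^esub> \<rho> s" "\<rho> (r \<oplus>\<^bsub>R\<^esub> s) = \<rho> r \<oplus>\<^bsub>S\<^esub> \<rho> s"
      using rho[OF fg(1)] rho[OF fg(2)] rho[OF F.m_closed[OF fg(1,2)]] rho[OF F.a_closed[OF fg(1,2)]]
        ring_hom_mult[OF proj_hom fg(1,2)] ring_hom_add[OF proj_hom fg(1,2)]
        h.hom_mult[OF fg(1,2)] h.hom_add[OF fg(1,2)] by metis+
  next
    show "\<rho> \<one>\<^bsub>R\<^esub> = \<one>\<^bsub>S\<^esub>" using ring_hom_one[OF proj_hom] rho[of "\<one>\<^bsub>F\<^esub>"] by simp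
  qed
  moreover have "\<rho> (\<iota> c) = j c" if "c \<in> carrier K" for c
    using that rho[of "single c []"] by (simp add: unit_eq single_in_F ev.eval_hom_const)
  moreover have "\<rho> (X t) = x t" if "t \<in> verts Q" for t
    using that rho[of "free_gen K t"] by (simp add: X_def free_gen_closed ev.eval_hom_gen)
  ultimately show ?thesis using that by blast
qed

end

section \<open>Left modules and quotients of vector spaces\<close>

context left_module
begin

lemma smult_l_null: "x \<in> carrier M \<Longrightarrow> \<zero> \<odot>\<^bsub>M\<^esub> x = \<zero>\<^bsub>M\<^esub>"
  using smult_l_distr[of \<zero> \<zero> x] smult_closed[of \<zero> x] by (metis M.add.r_cancel_one' R.l_zero R.zero_closed)

lemma smult_r_null: "a \<in> carrier R \<Longrightarrow> a \<odot>\<^bsub>M\<^esub> \<zero>\<^bsub>M\<^esub> = \<zero>\<^bsub>M\<^esub>"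
  using smult_r_distr[of a "\<zero>\<^bsub>M\<^esub>" "\<zero>\<^bsub>M\<^esub>"] smult_closed[of a "\<zero>\<^bsub>M\<^esub>"]
  by (metis M.add.r_cancel_one' M.l_zero M.zero_closed)

lemma smult_l_minus:
  "a \<in> carrier R \<Longrightarrow> x \<in> carrier M \<Longrightarrow> (\<ominus> a) \<odot>\<^bsub>M\<^esub> x = \<ominus>\<^bsub>M\<^esub> (a \<odot>\<^bsub>M\<^esub> x)"
  using smult_l_distr[of "\<ominus> a" a x] smult_closed smult_l_null
  by (metis M.minus_equality R.add.inv_closed R.l_neg)

lemma finsum_smult_ldistr:
  assumes "finite A" "a \<in> carrier R" "f \<in> A \<rightarrow> carrier M"
  shows "a \<odot>\<^bsub>M\<^esub> (\<Oplus>\<^bsub>M\<^esub>i\<in>A. f i) = (\<Oplus>\<^bsub>M\<^esub>i\<in>A. a \<odot>\<^bsub>M\<^esub> f i)"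
  using assms(1,3)
proof (induction A rule: finite_induct)
  case (insert x A)
  then show ?case using assms(2)
    by (simp add: Pi_def smult_r_distr smult_closed)
qed (simp add: smult_r_null assms)

lemma finsum_smult_rdistr:
  assumes "finite A" "x \<in> carrier M" "f \<in> A \<rightarrow> carrier R"
  shows "(\<Oplus>i\<in>A. f i) \<odot>\<^bsub>M\<^esub> x = (\<Oplus>\<^bsub>M\<^esub>i\<in>A. f i \<odot>\<^bsub>M\<^esub> x)"
  using assms(1,3)
proof (induction A rule: finite_induct)
  case (insert y A)
  then show ?case using assms(2)
    by (simp add: Pi_def smult_l_distr smult_closed)
qed (simp add: smult_l_null assms)

end

lemma left_module_moduleI:
  assumes "ring R" and "abelian_group M"
    and "\<And>a x. a \<in> carrier R \<Longrightarrow> x \<in> carrier M \<Longrightarrow> a \<odot>\<^bsub>M\<^esub> x \<in> carrier M"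
    and "\<And>a b x. a \<in> carrier R \<Longrightarrow> b \<in> carrier R \<Longrightarrow> x \<in> carrier M \<Longrightarrow>
      (a \<oplus>\<^bsub>R\<^esub> b) \<odot>\<^bsub>M\<^esub> x = a \<odot>\<^bsub>M\<^esub> x \<oplus>\<^bsub>M\<^esub> b \<odot>\<^bsub>M\<^esub> x"
    and "\<And>a x y. a \<in> carrier R \<Longrightarrow> x \<in> carrier M \<Longrightarrow> y \<in> carrier M \<Longrightarrow>
      a \<odot>\<^bsub>M\<^esub> (x \<oplus>\<^bsub>M\<^esub> y) = a \<odot>\<^bsub>M\<^esub> x \<oplus>\<^bsub>M\<^esub> a \<odot>\<^bsub>M\<^esub> y"
    and "\<And>a b x. a \<in> carrier R \<Longrightarrow> b \<in> carrier R \<Longrightarrow> x \<in> carrier M \<Longrightarrow>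
      (a \<otimes>\<^bsub>R\<^esub> b) \<odot>\<^bsub>M\<^esub> x = a \<odot>\<^bsub>M\<^esub> (b \<odot>\<^bsub>M\<^esub> x)"
    and "\<And>x. x \<in> carrier M \<Longrightarrow> \<one>\<^bsub>R\<^esub> \<odot>\<^bsub>M\<^esub> x = x"
  shows "left_module R M"
  using assms by (intro left_module.intro left_module_axioms.intro) auto

lemma module_homI:
  assumes "\<And>x. x \<in> carrier M \<Longrightarrow> f x \<in> carrier N"
    and "\<And>x y. x \<in> carrier M \<Longrightarrow> y \<in> carrier M \<Longrightarrow> f (x \<oplus>\<^bsub>M\<^esub> y) = f x \<oplus>\<^bsub>N\<^esub> f y"
    and "\<And>r x. r \<in> carrier R \<Longrightarrow> x \<in> carrier M \<Longrightarrow> f (r \<odot>\<^bsub>M\<^esub> x) = r \<odot>\<^bsub>N\<^esub> f x"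
  shows "f \<in> module_hom R M N"
  using assms by (auto simp: module_hom_def)

lemma module_hom_mem: "f \<in> module_hom R M N \<Longrightarrow> x \<in> carrier M \<Longrightarrow> f x \<in> carrier N"
  by (auto simp: module_hom_def)

section \<open>Free modules, their linear maps and the syzygy\<close>

lemma free_carrier:
  "f \<in> carrier (free_module R S) \<longleftrightarrow>
    (\<forall>s. f s \<in> carrier R) \<and> finite {s. f s \<noteq> \<zero>\<^bsub>R\<^esub>} \<and> {s. f s \<noteq> \<zero>\<^bsub>R\<^esub>} \<subseteq> S"
  and free_zero: "\<zero>\<^bsub>free_module R S\<^esub> = (\<lambda>s. \<zero>\<^bsub>R\<^esub>)"
  and free_add: "f \<oplus>\<^bsub>free_module R S\<^esub> g = (\<lambda>s. f s \<oplus>\<^bsub>R\<^esub> g s)"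
  and free_smult: "a \<odot>\<^bsub>free_module R S\<^esub> f = (\<lambda>s. a \<otimes>\<^bsub>R\<^esub> f s)"
  by (simp_all add: free_module_def)

context ring
begin

lemma free_add_closed:
  assumes "f \<in> carrier (free_module R S)" "g \<in> carrier (free_module R S)"
  shows "(\<lambda>s. f s \<oplus> g s) \<in> carrier (free_module R S)"
proof -
  have "{s. f s \<oplus> g s \<noteq> \<zero>} \<subseteq> {s. f s \<noteq> \<zero>} \<union> {s. g s \<noteq> \<zero>}" by auto
  moreover have "finite ({s. f s \<noteq> \<zero>} \<union> {s. g s \<noteq> \<zero>})" "{s. f s \<noteq> \<zero>} \<union> {s. g s \<noteq> \<zero>} \<subseteq> S"
    using assms by (auto simp only: free_carrier finite_Un)
  ultimately show ?thesis using assms unfolding free_carrier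
    by (meson a_closed finite_subset subset_trans)
qed

lemma free_smult_closed:
  assumes "a \<in> carrier R" "f \<in> carrier (free_module R S)"
  shows "(\<lambda>s. a \<otimes> f s) \<in> carrier (free_module R S)"
proof -
  have "{s. a \<otimes> f s \<noteq> \<zero>} \<subseteq> {s. f s \<noteq> \<zero>}" using assms(1) by auto
  then show ?thesis using assms unfolding free_carrier
    by (meson m_closed finite_subset subset_trans)
qed

lemma left_module_free: "left_module R (free_module R S)"
proof (rule left_module_moduleI)
  show "abelian_group (free_module R S)"
  proof (rule abelian_groupI)
    fix f assume f: "f \<in> carrier (free_module R S)"
    have "{s. \<ominus> f s \<noteq> \<zero>} = {s. f s \<noteq> \<zero>}"
      using f by (auto simp: free_carrier)
    then show "\<exists>g\<in>carrier (free_module R S). g \<oplus>\<^bsub>free_module R S\<^esub> f = \<zero>\<^bsub>free_module R S\<^esub>"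
      using f by (intro bexI[of _ "\<lambda>s. \<ominus> f s"]) (auto simp: free_carrier free_add free_zero l_neg)
  qed (auto simp: free_add free_add_closed free_zero, auto simp: free_carrier a_ac)
next
  fix a b f assume "a \<in> carrier R" "b \<in> carrier R" "f \<in> carrier (free_module R S)"
  then show "(a \<otimes> b) \<odot>\<^bsub>free_module R S\<^esub> f = a \<odot>\<^bsub>free_module R S\<^esub> (b \<odot>\<^bsub>free_module R S\<^esub> f)"
    by (auto simp: free_smult free_carrier m_assoc)
qed (use ring_axioms in \<open>auto simp: free_add free_smult free_smult_closed\<close>,
     auto simp: free_carrier l_distr r_distr)

definition basis_vector :: "'s \<Rightarrow> 's \<Rightarrow> 'a" where
  "basis_vector s = (\<lambda>t. if t = s then \<one> else \<zero>)"

lemma basis_vector_closed: "s \<in> S \<Longrightarrow> basis_vector s \<in> carrier (free_module R S)"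
  by (auto simp: basis_vector_def free_carrier)

text \<open>The linear extension of \<open>g\<close> from the basis. With \<open>g\<close> the
  identity it is \<open>canonical_map\<close>; with values in \<open>regular_module\<close> it
  yields the retraction \<gamma>.\<close>

definition free_lift :: "('a, 'm, 'y) module_scheme \<Rightarrow> ('s \<Rightarrow> 'm) \<Rightarrow> ('s \<Rightarrow> 'a) \<Rightarrow> 'm" where
  "free_lift N g f = (\<Oplus>\<^bsub>N\<^esub>s\<in>{s. f s \<noteq> \<zero>}. f s \<odot>\<^bsub>N\<^esub> g s)"

lemma free_lift_superset:
  assumes "left_module R N" and g: "g \<in> S \<rightarrow> carrier N"
    and f: "f \<in> carrier (free_module R S)" and T: "finite T" "{s. f s \<noteq> \<zero>} \<subseteq> T" "T \<subseteq> S"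
  shows "free_lift N g f = (\<Oplus>\<^bsub>N\<^esub>s\<in>T. f s \<odot>\<^bsub>N\<^esub> g s)"
proof -
  interpret N: left_module R N by fact
  have gT: "g s \<in> carrier N" if "s \<in> T" for s using that g T by auto
  show ?thesis unfolding free_lift_def
    using gT f T by (intro N.add.finprod_mono_neutral_cong_left)
      (auto simp: free_carrier N.smult_l_null intro!: N.smult_closed)
qed

lemma free_lift_hom:
  assumes N: "left_module R N" and g: "g \<in> S \<rightarrow> carrier N"
  shows "free_lift N g \<in> module_hom R (free_module R S) N"
proof (rule module_homI)
  interpret N: left_module R N by fact
  have cl: "f s \<odot>\<^bsub>N\<^esub> g s \<in> carrier N" if "f \<in> carrier (free_module R S)" "s \<in> S" for f s
    using that g by (intro N.smult_closed) (auto simp: free_carrier)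
  {
    fix f assume f: "f \<in> carrier (free_module R S)"
    then show "free_lift N g f \<in> carrier N"
      unfolding free_lift_def by (intro N.finsum_closed) (use cl in \<open>auto simp: free_carrier subset_iff\<close>)
    fix r assume r: "r \<in> carrier R"
    let ?T = "{s. f s \<noteq> \<zero>}"
    have T: "finite ?T" "?T \<subseteq> S" using f by (auto simp: free_carrier)
    have "free_lift N g (\<lambda>s. r \<otimes> f s) = (\<Oplus>\<^bsub>N\<^esub>s\<in>?T. (r \<otimes> f s) \<odot>\<^bsub>N\<^esub> g s)"
      using r T by (intro free_lift_superset[OF N g free_smult_closed[OF r f]]) auto
    also have "\<dots> = (\<Oplus>\<^bsub>N\<^esub>s\<in>?T. r \<odot>\<^bsub>N\<^esub> (f s \<odot>\<^bsub>N\<^esub> g s))"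
    proof (rule N.finsum_cong')
      show "(\<lambda>s. r \<odot>\<^bsub>N\<^esub> (f s \<odot>\<^bsub>N\<^esub> g s)) \<in> ?T \<rightarrow> carrier N"
        using T by (intro Pi_I N.smult_closed[OF r] cl[OF f]) blast
      fix s assume "s \<in> ?T"
      then show "(r \<otimes> f s) \<odot>\<^bsub>N\<^esub> g s = r \<odot>\<^bsub>N\<^esub> (f s \<odot>\<^bsub>N\<^esub> g s)"
        using f g r T by (intro N.smult_assoc) (auto simp: free_carrier)
    qed simp
    also have "\<dots> = r \<odot>\<^bsub>N\<^esub> free_lift N g f"
      unfolding free_lift_def by (rule N.finsum_smult_ldistr[symmetric]) (use cl[OF f] T r in blast)+
    finally show "free_lift N g (r \<odot>\<^bsub>free_module R S\<^esub> f) = r \<odot>\<^bsub>N\<^esub> free_lift N g f"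
      by (simp add: free_smult)
  next
    fix f h assume fh: "f \<in> carrier (free_module R S)" "h \<in> carrier (free_module R S)"
    let ?T = "{s. f s \<noteq> \<zero>} \<union> {s. h s \<noteq> \<zero>}"
    have T: "finite ?T" "?T \<subseteq> S" using fh by (auto simp: free_carrier)
    have "free_lift N g (\<lambda>s. f s \<oplus> h s) = (\<Oplus>\<^bsub>N\<^esub>s\<in>?T. (f s \<oplus> h s) \<odot>\<^bsub>N\<^esub> g s)"
      using T by (intro free_lift_superset[OF N g free_add_closed[OF fh]]) auto
    also have "\<dots> = (\<Oplus>\<^bsub>N\<^esub>s\<in>?T. f s \<odot>\<^bsub>N\<^esub> g s \<oplus>\<^bsub>N\<^esub> h s \<odot>\<^bsub>N\<^esub> g s)"
    proof (rule N.finsum_cong')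
      show "(\<lambda>s. f s \<odot>\<^bsub>N\<^esub> g s \<oplus>\<^bsub>N\<^esub> h s \<odot>\<^bsub>N\<^esub> g s) \<in> ?T \<rightarrow> carrier N"
        using cl[OF fh(1)] cl[OF fh(2)] T by (intro Pi_I N.a_closed) auto
      fix s assume "s \<in> ?T"
      then show "(f s \<oplus> h s) \<odot>\<^bsub>N\<^esub> g s = f s \<odot>\<^bsub>N\<^esub> g s \<oplus>\<^bsub>N\<^esub> h s \<odot>\<^bsub>N\<^esub> g s"
        using fh g T by (intro N.smult_l_distr) (auto simp: free_carrier)
    qed simp
    also have "\<dots> = (\<Oplus>\<^bsub>N\<^esub>s\<in>?T. f s \<odot>\<^bsub>N\<^esub> g s) \<oplus>\<^bsub>N\<^esub> (\<Oplus>\<^bsub>N\<^esub>s\<in>?T. h s \<odot>\<^bsub>N\<^esub> g s)"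
      using cl[OF fh(1)] cl[OF fh(2)] T by (intro N.finsum_addf) auto
    also have "(\<Oplus>\<^bsub>N\<^esub>s\<in>?T. f s \<odot>\<^bsub>N\<^esub> g s) = free_lift N g f"
      by (rule free_lift_superset[OF N g fh(1) T(1) _ T(2), symmetric]) blast
    also have "(\<Oplus>\<^bsub>N\<^esub>s\<in>?T. h s \<odot>\<^bsub>N\<^esub> g s) = free_lift N g h"
      by (rule free_lift_superset[OF N g fh(2) T(1) _ T(2), symmetric]) blast
    finally show "free_lift N g (f \<oplus>\<^bsub>free_module R S\<^esub> h) = free_lift N g f \<oplus>\<^bsub>N\<^esub> free_lift N g h"
      by (simp add: free_add)
  }
qed

lemma free_lift_basis_vector:
  assumes N: "left_module R N" and g: "g \<in> S \<rightarrow> carrier N" and s: "s \<in> S"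
  shows "free_lift N g (basis_vector s) = g s"
proof -
  interpret N: left_module R N by fact
  have "free_lift N g (basis_vector s) = (\<Oplus>\<^bsub>N\<^esub>t\<in>{s}. basis_vector s t \<odot>\<^bsub>N\<^esub> g t)"
    using s by (intro free_lift_superset[OF N g basis_vector_closed[OF s]])
      (auto simp: basis_vector_def)
  then show ?thesis using s g by (auto simp: basis_vector_def N.smult_one Pi_iff)
qed

definition regular_module :: "('a, 'a) module" where
  "regular_module = \<lparr>carrier = carrier R, monoid.mult = monoid.mult R, one = \<one>, zero = \<zero>, add = add R,
     smult = monoid.mult R\<rparr>"

lemma regular_simps:
  "carrier regular_module = carrier R" "\<zero>\<^bsub>regular_module\<^esub> = \<zero>"
  "x \<oplus>\<^bsub>regular_module\<^esub> y = x \<oplus> y" "x \<odot>\<^bsub>regular_module\<^esub> y = x \<otimes> y"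
  by (simp_all add: regular_module_def)

lemma left_module_regular: "left_module R regular_module"
proof (rule left_module_moduleI)
  show "abelian_group regular_module"
    by (rule abelian_groupI) (auto simp: regular_simps a_ac intro: add.l_inv_ex)
qed (use ring_axioms in \<open>auto simp: regular_simps l_distr r_distr m_assoc\<close>)

lemma finsum_regular: "finsum regular_module f A = finsum R f A"
  by (simp add: finsum_def finprod_def regular_module_def)

end

text \<open>The syzygy is the kernel of a linear map and keeps the operations of the free module.
  Negatives are multiples by the negative of one, so closure under scaling already provides
  them.\<close>

lemma (in left_module) left_module_syzygy: "left_module R (syzygy R M)"
proof -
  let ?P = "free_module R (carrier M)" and ?Z = "syzygy R M"
  interpret P: left_module R ?P by (rule left_module_free)
  have can: "canonical_map R M = free_lift M (\<lambda>x. x)"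
    by (simp add: fun_eq_iff canonical_map_def free_lift_def)
  have hom: "canonical_map R M \<in> module_hom R ?P M"
    unfolding can by (rule free_lift_hom) (use left_module_axioms in auto)
  have Z: "carrier ?Z = {f \<in> carrier ?P. canonical_map R M f = \<zero>\<^bsub>M\<^esub>}"
    and ops: "\<zero>\<^bsub>?Z\<^esub> = \<zero>\<^bsub>?P\<^esub>" "add ?Z = add ?P" "smult ?Z = smult ?P"
    by (simp_all add: syzygy_def)
  have z: "canonical_map R M \<zero>\<^bsub>?P\<^esub> = \<zero>\<^bsub>M\<^esub>"
    by (simp add: canonical_map_def free_zero)
  have sm: "r \<odot>\<^bsub>?P\<^esub> f \<in> carrier ?Z" if "r \<in> carrier R" "f \<in> carrier ?Z" for r f
    using that module_hom_smult[OF hom] by (auto simp: Z P.smult_closed smult_r_null)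
  show ?thesis
  proof (rule left_module_moduleI)
    show "abelian_group ?Z"
    proof (rule abelian_groupI)
      fix f assume f: "f \<in> carrier ?Z"
      then have "(\<ominus> \<one>) \<odot>\<^bsub>?P\<^esub> f \<in> carrier ?Z" using sm by simp
      moreover have "(\<ominus> \<one>) \<odot>\<^bsub>?P\<^esub> f = \<ominus>\<^bsub>?P\<^esub> f"
        using f P.smult_l_minus[of \<one> f] P.smult_one by (simp add: Z)
      ultimately show "\<exists>g\<in>carrier ?Z. g \<oplus>\<^bsub>?Z\<^esub> f = \<zero>\<^bsub>?Z\<^esub>"
        using f by (intro bexI[of _ "\<ominus>\<^bsub>?P\<^esub> f"]) (auto simp: ops Z P.M.l_neg)
    next
      fix f g assume "f \<in> carrier ?Z" "g \<in> carrier ?Z"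
      then show "f \<oplus>\<^bsub>?Z\<^esub> g \<in> carrier ?Z"
        using module_hom_add[OF hom] by (auto simp: Z ops)
    qed (auto simp: ops Z z P.M.a_ac)
  qed (use R.ring_axioms sm in \<open>auto simp: ops Z P.smult_l_distr P.smult_r_distr P.smult_assoc P.smult_one\<close>)
qed

text \<open>Dimension 0 has the expected meaning only once the space is known to be finite
  dimensional, and a single generator is the cheapest way to know this.\<close>

lemma dim_eq_0_iff_of_generator:
  assumes "vectorspace K E" and v: "v \<in> carrier E"
    and gen: "\<And>x. x \<in> carrier E \<Longrightarrow> \<exists>c\<in>carrier K. x = c \<odot>\<^bsub>E\<^esub> v"
  shows "vectorspace.dim K E = 0 \<longleftrightarrow> carrier E = {\<zero>\<^bsub>E\<^esub>}"
proof -
  interpret vectorspace K E by fact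
  have span_empty: "span {} = {\<zero>\<^bsub>E\<^esub>}"
    by (subst finite_span) (auto simp: lincomb_def)
  show ?thesis
  proof
    assume "carrier E = {\<zero>\<^bsub>E\<^esub>}"
    then show "dim = 0" using gen_ge_dim[of "{}"] span_empty by simp
  next
    assume dim: "dim = 0"
    have "x \<in> span {v}" if x: "x \<in> carrier E" for x
    proof -
      obtain c where c: "c \<in> carrier K" "x = c \<odot>\<^bsub>E\<^esub> v" using gen x by blast
      then have "x = lincomb (\<lambda>_. c) {v}" using v by (simp add: lincomb_def)
      then show ?thesis using c v by (subst finite_span) auto
    qed
    then have "span {v} = carrier E" using v span_is_subset2[of "{v}"] by blast
    then have "fin_dim" unfolding fin_dim_def using v by (intro exI[of _ "{v}"]) auto
    then obtain B where "finite B" "basis B" using finite_basis_exists by blast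
    then show "carrier E = {\<zero>\<^bsub>E\<^esub>}"
      using dim dim_basis[of B] span_empty by (auto simp: basis_def)
  qed
qed

text \<open>\<open>quotient_module\<close> scales a coset by a union over all its elements. As
  \<open>W\<close> is stable under scaling, all members of the union are the same coset.\<close>

lemma quotient_coset_smult:
  assumes "module K V" and W: "Module.submodule W K V" and c: "c \<in> carrier K" and x: "x \<in> carrier V"
  shows "c \<odot>\<^bsub>quotient_module V W\<^esub> (W +>\<^bsub>V\<^esub> x) = W +>\<^bsub>V\<^esub> (c \<odot>\<^bsub>V\<^esub> x)"
proof -
  interpret module K V by fact
  interpret W: Module.submodule W K V by fact
  interpret abelian_subgroup W V
    by (intro abelian_subgroupI3 additive_subgroupI W.subgroup_axioms M.abelian_group_axioms)
  have "W +>\<^bsub>V\<^esub> (c \<odot>\<^bsub>V\<^esub> y) = W +>\<^bsub>V\<^esub> (c \<odot>\<^bsub>V\<^esub> x)" if y: "y \<in> W +>\<^bsub>V\<^esub> x" for y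
  proof -
    obtain w where w: "w \<in> W" "y = w \<oplus>\<^bsub>V\<^esub> x" using y by (auto simp: a_r_coset_def')
    then have wV: "w \<in> carrier V" using a_subset by blast
    have "c \<odot>\<^bsub>V\<^esub> y = c \<odot>\<^bsub>V\<^esub> w \<oplus>\<^bsub>V\<^esub> c \<odot>\<^bsub>V\<^esub> x" using w wV c x by (simp add: smult_r_distr)
    then have "c \<odot>\<^bsub>V\<^esub> y \<in> W +>\<^bsub>V\<^esub> (c \<odot>\<^bsub>V\<^esub> x)"
      using w c W.smult_closed by (auto simp: a_r_coset_def')
    then show ?thesis using M.a_repr_independence[OF _ _ W.subgroup_axioms] c x by auto
  qed
  moreover have "W +>\<^bsub>V\<^esub> x \<noteq> {}" using a_rcos_self[OF x] by blast
  ultimately show ?thesis by (auto simp: quotient_module_def)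
qed

lemma quotient_vectorspace:
  assumes V: "vectorspace K V" and W: "Module.submodule W K V"
  shows "vectorspace K (quotient_module V W)"
proof -
  interpret vectorspace K V by fact
  interpret W: Module.submodule W K V by fact
  interpret abelian_subgroup W V
    by (intro abelian_subgroupI3 additive_subgroupI W.subgroup_axioms M.abelian_group_axioms)
  let ?E = "quotient_module V W"
  have ops: "carrier ?E = a_rcosets\<^bsub>V\<^esub> W" "\<zero>\<^bsub>?E\<^esub> = W" "add ?E = set_add V"
    by (simp_all add: quotient_module_def)
  have rep: "\<exists>x\<in>carrier V. X = W +>\<^bsub>V\<^esub> x" if "X \<in> carrier ?E" for X
    using that by (auto simp: ops A_RCOSETS_def')
  note sm = quotient_coset_smult[OF module_axioms W]
  have cl: "W +>\<^bsub>V\<^esub> x \<in> carrier ?E" if "x \<in> carrier V" for x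
    using that by (auto simp: ops A_RCOSETS_def')
  have add: "(W +>\<^bsub>V\<^esub> x) \<oplus>\<^bsub>?E\<^esub> (W +>\<^bsub>V\<^esub> y) = W +>\<^bsub>V\<^esub> (x \<oplus>\<^bsub>V\<^esub> y)"
    if "x \<in> carrier V" "y \<in> carrier V" for x y
    using a_rcos_sum[OF that] by (simp add: ops)
  have zero: "W = W +>\<^bsub>V\<^esub> \<zero>\<^bsub>V\<^esub>" using M.a_coset_add_zero[OF a_subset] by simp
  have "abelian_group ?E"
  proof (rule abelian_groupI)
    fix X Y assume XY: "X \<in> carrier ?E" "Y \<in> carrier ?E"
    show "X \<oplus>\<^bsub>?E\<^esub> Y \<in> carrier ?E" "X \<oplus>\<^bsub>?E\<^esub> Y = Y \<oplus>\<^bsub>?E\<^esub> X"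
      using rep[OF XY(1)] rep[OF XY(2)] by (auto simp: add cl M.a_comm)
    fix Z assume "Z \<in> carrier ?E"
    then show "X \<oplus>\<^bsub>?E\<^esub> Y \<oplus>\<^bsub>?E\<^esub> Z = X \<oplus>\<^bsub>?E\<^esub> (Y \<oplus>\<^bsub>?E\<^esub> Z)"
      using rep[OF XY(1)] rep[OF XY(2)] rep[of Z] by (auto simp: add M.a_assoc)
  next
    fix X assume "X \<in> carrier ?E"
    then obtain x where x: "x \<in> carrier V" "X = W +>\<^bsub>V\<^esub> x" using rep by blast
    show "\<zero>\<^bsub>?E\<^esub> \<oplus>\<^bsub>?E\<^esub> X = X"
      using add[OF M.zero_closed x(1)] x zero ops(2) by simp
    show "\<exists>Y\<in>carrier ?E. Y \<oplus>\<^bsub>?E\<^esub> X = \<zero>\<^bsub>?E\<^esub>"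
      using add[OF M.a_inv_closed[OF x(1)] x(1)] x zero ops(2) cl[OF M.a_inv_closed[OF x(1)]]
      by (auto simp: M.l_neg)
  qed (use cl[OF M.zero_closed] zero ops(2) in simp)
  have "module K ?E"
  proof (rule moduleI)
    fix a X assume "a \<in> carrier K" "X \<in> carrier ?E"
    then show "a \<odot>\<^bsub>?E\<^esub> X \<in> carrier ?E" using rep[of X] by (auto simp: sm cl)
  next
    fix a b X assume "a \<in> carrier K" "b \<in> carrier K" "X \<in> carrier ?E"
    then show "(a \<oplus>\<^bsub>K\<^esub> b) \<odot>\<^bsub>?E\<^esub> X = a \<odot>\<^bsub>?E\<^esub> X \<oplus>\<^bsub>?E\<^esub> b \<odot>\<^bsub>?E\<^esub> X"
      "(a \<otimes>\<^bsub>K\<^esub> b) \<odot>\<^bsub>?E\<^esub> X = a \<odot>\<^bsub>?E\<^esub> (b \<odot>\<^bsub>?E\<^esub> X)"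
      using rep[of X] by (auto simp: sm add smult_l_distr smult_assoc1)
  next
    fix a X Y assume "a \<in> carrier K" "X \<in> carrier ?E" "Y \<in> carrier ?E"
    then show "a \<odot>\<^bsub>?E\<^esub> (X \<oplus>\<^bsub>?E\<^esub> Y) = a \<odot>\<^bsub>?E\<^esub> X \<oplus>\<^bsub>?E\<^esub> a \<odot>\<^bsub>?E\<^esub> Y"
      using rep[of X] rep[of Y] by (auto simp: sm add smult_r_distr)
  next
    fix X assume "X \<in> carrier ?E"
    then show "\<one>\<^bsub>K\<^esub> \<odot>\<^bsub>?E\<^esub> X = X" using rep[of X] by (auto simp: sm)
  qed (use \<open>abelian_group ?E\<close> R.is_cring in auto)
  then show ?thesis using field_axioms by (simp add: vectorspace_def)
qed

text \<open>The assumption \<open>gen\<close> says that \<open>V\<close> is \<open>W\<close> plus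
  the line of \<open>v\<close>, so the class of \<open>v\<close> generates the quotient and the
  dimension test for one generator applies.\<close>

lemma dim_quotient_pos_iff:
  assumes V: "vectorspace K V" and W: "Module.submodule W K V" and v: "v \<in> carrier V"
    and gen: "\<And>x. x \<in> carrier V \<Longrightarrow> \<exists>c\<in>carrier K. x \<ominus>\<^bsub>V\<^esub> c \<odot>\<^bsub>V\<^esub> v \<in> W"
  shows "0 < vectorspace.dim K (quotient_module V W) \<longleftrightarrow> \<not> carrier V \<subseteq> W"
proof -
  interpret vectorspace K V by fact
  interpret W: Module.submodule W K V by fact
  interpret abelian_subgroup W V
    by (intro abelian_subgroupI3 additive_subgroupI W.subgroup_axioms M.abelian_group_axioms)
  let ?E = "quotient_module V W"
  have E: "carrier ?E = (\<lambda>x. W +>\<^bsub>V\<^esub> x) ` carrier V" "\<zero>\<^bsub>?E\<^esub> = W"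
    by (auto simp: quotient_module_def A_RCOSETS_def')
  have "\<exists>c\<in>carrier K. X = c \<odot>\<^bsub>?E\<^esub> (W +>\<^bsub>V\<^esub> v)" if "X \<in> carrier ?E" for X
  proof -
    obtain x where x: "x \<in> carrier V" "X = W +>\<^bsub>V\<^esub> x" using \<open>X \<in> carrier ?E\<close> E by blast
    obtain c where c: "c \<in> carrier K" "x \<ominus>\<^bsub>V\<^esub> c \<odot>\<^bsub>V\<^esub> v \<in> W" using gen x by blast
    have "x = (x \<ominus>\<^bsub>V\<^esub> c \<odot>\<^bsub>V\<^esub> v) \<oplus>\<^bsub>V\<^esub> c \<odot>\<^bsub>V\<^esub> v"
      using x c v by (simp add: M.minus_eq M.a_assoc M.l_neg)
    then have "x \<in> W +>\<^bsub>V\<^esub> (c \<odot>\<^bsub>V\<^esub> v)" using c by (auto simp: a_r_coset_def')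
    then have "X = W +>\<^bsub>V\<^esub> (c \<odot>\<^bsub>V\<^esub> v)"
      using x c v M.a_repr_independence[OF _ _ W.subgroup_axioms] by auto
    then show ?thesis using c v quotient_coset_smult[OF module_axioms W] by auto
  qed
  then have "vectorspace.dim K ?E = 0 \<longleftrightarrow> carrier ?E = {W}"
    using dim_eq_0_iff_of_generator[OF quotient_vectorspace[OF V W], of "W +>\<^bsub>V\<^esub> v"] v E by auto
  also have "\<dots> \<longleftrightarrow> carrier V \<subseteq> W"
  proof
    assume "carrier ?E = {W}"
    then show "carrier V \<subseteq> W" using a_rcos_self E by (auto)
  next
    assume "carrier V \<subseteq> W"
    then show "carrier ?E = {W}" using E a_rcos_const v by (auto intro!: image_eqI)
  qed
  finally show ?thesis by (metis not_gr_zero)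
qed

section \<open>One-dimensional modules and their extensions\<close>

locale central_algebra = K?: field K + R?: ring R
  for K :: "('k, 'w) ring_scheme" (structure) and R :: "('r, 'x) ring_scheme" (structure) +
  fixes \<iota> :: "'k \<Rightarrow> 'r"
  assumes \<iota>_hom: "\<iota> \<in> ring_hom K R"
    and \<iota>_central: "\<And>c r. c \<in> carrier K \<Longrightarrow> r \<in> carrier R \<Longrightarrow> \<iota> c \<otimes>\<^bsub>R\<^esub> r = r \<otimes>\<^bsub>R\<^esub> \<iota> c"
begin

lemma \<iota>_closed [simp]: "c \<in> carrier K \<Longrightarrow> \<iota> c \<in> carrier R"
  using \<iota>_hom by (rule ring_hom_closed)

lemmas \<iota>_add = ring_hom_add[OF \<iota>_hom]
lemmas \<iota>_mult = ring_hom_mult[OF \<iota>_hom]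
lemmas \<iota>_one = ring_hom_one[OF \<iota>_hom]

lemma \<iota>_zero: "\<iota> \<zero> = \<zero>\<^bsub>R\<^esub>"
  using ring_hom_zero[OF \<iota>_hom K.ring_axioms R.ring_axioms] .

lemma scalar_commute:
  assumes "left_module R M" "c \<in> carrier K" "r \<in> carrier R" "x \<in> carrier M"
  shows "\<iota> c \<odot>\<^bsub>M\<^esub> (r \<odot>\<^bsub>M\<^esub> x) = r \<odot>\<^bsub>M\<^esub> (\<iota> c \<odot>\<^bsub>M\<^esub> x)"
proof -
  interpret M: left_module R M by fact
  show ?thesis using M.smult_assoc[of "\<iota> c" r x] M.smult_assoc[of r "\<iota> c" x] \<iota>_central assms by simp
qed

text \<open>Scaling a homomorphism by \<open>\<iota> c\<close> keeps it linear over the ring because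
  \<open>\<iota> c\<close> is central; the closure proof rests on
  \<open>scalar_commute\<close>.\<close>

lemma hom_space_vectorspace:
  assumes M: "left_module R M" and N: "left_module R N"
  shows "vectorspace K (hom_space R \<iota> M N)"
proof -
  interpret M: left_module R M by fact
  interpret N: left_module R N by fact
  let ?H = "hom_space R \<iota> M N"
  have H: "f \<in> carrier ?H \<longleftrightarrow> f \<in> module_hom R M N \<and> f \<in> extensional (carrier M)" for f
    by (simp add: hom_space_def)
  have ops: "\<zero>\<^bsub>?H\<^esub> = (\<lambda>x\<in>carrier M. \<zero>\<^bsub>N\<^esub>)"
    "f \<oplus>\<^bsub>?H\<^esub> g = (\<lambda>x\<in>carrier M. f x \<oplus>\<^bsub>N\<^esub> g x)"
    "c \<odot>\<^bsub>?H\<^esub> f = (\<lambda>x\<in>carrier M. \<iota> c \<odot>\<^bsub>N\<^esub> f x)" for f g c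
    by (simp_all add: hom_space_def)
  have cl: "f x \<in> carrier N" if "f \<in> carrier ?H" "x \<in> carrier M" for f x
    using that by (auto simp: H module_hom_def)
  have ext: "f = g" if "f \<in> extensional (carrier M)" "g \<in> extensional (carrier M)"
    "\<And>x. x \<in> carrier M \<Longrightarrow> f x = g x" for f g using that by (rule extensionalityI)
  have homI: "restrict f (carrier M) \<in> carrier ?H"
    if "\<And>x. x \<in> carrier M \<Longrightarrow> f x \<in> carrier N"
      "\<And>x y. x \<in> carrier M \<Longrightarrow> y \<in> carrier M \<Longrightarrow> f (x \<oplus>\<^bsub>M\<^esub> y) = f x \<oplus>\<^bsub>N\<^esub> f y"
      "\<And>r x. r \<in> carrier R \<Longrightarrow> x \<in> carrier M \<Longrightarrow> f (r \<odot>\<^bsub>M\<^esub> x) = r \<odot>\<^bsub>N\<^esub> f x" for f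
    unfolding H by (intro conjI restrict_extensional module_homI) (simp_all add: that M.smult_closed)
  note hadd = module_hom_add[of _ R M N] and hsm = module_hom_smult[of _ R M N]
  have add_cl: "f \<oplus>\<^bsub>?H\<^esub> g \<in> carrier ?H" if "f \<in> carrier ?H" "g \<in> carrier ?H" for f g
    unfolding ops using that
    by (intro homI) (auto simp: cl N.smult_r_distr N.M.a_ac H hadd hsm module_hom_mem[of _ R M N])
  have smult_cl: "c \<odot>\<^bsub>?H\<^esub> f \<in> carrier ?H" if "c \<in> carrier K" "f \<in> carrier ?H" for f c
  proof -
    have f: "f \<in> module_hom R M N" using that by (simp add: H)
    show ?thesis unfolding ops
    proof (rule homI)
      fix x assume x: "x \<in> carrier M"
      show "\<iota> c \<odot>\<^bsub>N\<^esub> f x \<in> carrier N" using that cl[OF that(2) x] by (simp add: N.smult_closed)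
      fix r assume "r \<in> carrier R"
      then show "\<iota> c \<odot>\<^bsub>N\<^esub> f (r \<odot>\<^bsub>M\<^esub> x) = r \<odot>\<^bsub>N\<^esub> (\<iota> c \<odot>\<^bsub>N\<^esub> f x)"
        using that x cl[OF that(2) x] by (simp add: hsm[OF f] scalar_commute[OF N])
    next
      fix x y assume "x \<in> carrier M" "y \<in> carrier M"
      then show "\<iota> c \<odot>\<^bsub>N\<^esub> f (x \<oplus>\<^bsub>M\<^esub> y) = \<iota> c \<odot>\<^bsub>N\<^esub> f x \<oplus>\<^bsub>N\<^esub> \<iota> c \<odot>\<^bsub>N\<^esub> f y"
        using that cl[OF that(2)] by (simp add: hadd[OF f] N.smult_r_distr)
    qed
  qed
  have zero_cl: "\<zero>\<^bsub>?H\<^esub> \<in> carrier ?H"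
    unfolding ops by (intro homI) (auto simp: N.smult_r_null)
  have "module K ?H"
  proof (rule moduleI)
    show "abelian_group ?H"
    proof (rule abelian_groupI)
      fix f assume f: "f \<in> carrier ?H"
      show "\<zero>\<^bsub>?H\<^esub> \<oplus>\<^bsub>?H\<^esub> f = f"
        using f cl[OF f] by (intro ext) (auto simp: ops H)
      \<comment> \<open>The additive inverse is taken to be the multiple by the negative of one,
        whose membership is already settled.\<close>
      have m1: "\<ominus> \<one> \<in> carrier K" by simp
      have "\<iota> (\<ominus> \<one>) \<oplus>\<^bsub>R\<^esub> \<one>\<^bsub>R\<^esub> = \<zero>\<^bsub>R\<^esub>"
        using \<iota>_add[OF m1 K.one_closed] \<iota>_one \<iota>_zero by (simp add: K.l_neg)
      then have "\<iota> (\<ominus> \<one>) \<odot>\<^bsub>N\<^esub> f x \<oplus>\<^bsub>N\<^esub> f x = \<zero>\<^bsub>N\<^esub>" if "x \<in> carrier M" for x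
        using N.smult_l_distr[of "\<iota> (\<ominus> \<one>)" "\<one>\<^bsub>R\<^esub>" "f x"] cl[OF f that]
          N.smult_one[of "f x"] N.smult_l_null[of "f x"] \<iota>_closed[OF m1] by simp
      then have "(\<ominus> \<one>) \<odot>\<^bsub>?H\<^esub> f \<oplus>\<^bsub>?H\<^esub> f = \<zero>\<^bsub>?H\<^esub>"
        unfolding ops by (intro restrict_ext) simp
      then show "\<exists>g\<in>carrier ?H. g \<oplus>\<^bsub>?H\<^esub> f = \<zero>\<^bsub>?H\<^esub>" using smult_cl[OF m1 f] by blast
    next
      fix f g assume fg: "f \<in> carrier ?H" "g \<in> carrier ?H"
      show "f \<oplus>\<^bsub>?H\<^esub> g = g \<oplus>\<^bsub>?H\<^esub> f"
        unfolding ops using fg cl by (intro restrict_ext) (simp add: N.M.a_comm)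
      fix h assume h: "h \<in> carrier ?H"
      show "f \<oplus>\<^bsub>?H\<^esub> g \<oplus>\<^bsub>?H\<^esub> h = f \<oplus>\<^bsub>?H\<^esub> (g \<oplus>\<^bsub>?H\<^esub> h)"
        unfolding ops using fg h cl by (intro restrict_ext) (simp add: N.M.a_assoc)
    qed (use add_cl zero_cl in auto)
  next
    fix c d f assume *: "c \<in> carrier K" "d \<in> carrier K" "f \<in> carrier ?H"
    show "(c \<oplus> d) \<odot>\<^bsub>?H\<^esub> f = c \<odot>\<^bsub>?H\<^esub> f \<oplus>\<^bsub>?H\<^esub> d \<odot>\<^bsub>?H\<^esub> f"
      unfolding ops using * cl by (intro restrict_ext) (simp add: \<iota>_add N.smult_l_distr)
    show "(c \<otimes> d) \<odot>\<^bsub>?H\<^esub> f = c \<odot>\<^bsub>?H\<^esub> (d \<odot>\<^bsub>?H\<^esub> f)"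
      unfolding ops using * cl by (intro restrict_ext) (simp add: \<iota>_mult N.smult_assoc)
  next
    fix c f g assume *: "c \<in> carrier K" "f \<in> carrier ?H" "g \<in> carrier ?H"
    show "c \<odot>\<^bsub>?H\<^esub> (f \<oplus>\<^bsub>?H\<^esub> g) = c \<odot>\<^bsub>?H\<^esub> f \<oplus>\<^bsub>?H\<^esub> c \<odot>\<^bsub>?H\<^esub> g"
      unfolding ops using * cl by (intro restrict_ext) (simp add: N.smult_r_distr)
  next
    fix f assume f: "f \<in> carrier ?H"
    show "\<one> \<odot>\<^bsub>?H\<^esub> f = f"
      using f cl[OF f] by (intro ext) (auto simp: ops H \<iota>_one N.smult_one)
  qed (use smult_cl K.is_cring in auto)
  then show ?thesis using K.field_axioms by (simp add: vectorspace_def)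
qed

end

text \<open>A one-dimensional module with a chosen basis vector \<open>m\<^sub>0\<close>, on which
  the ring acts through the character \<chi>. The mutually inverse maps \<open>vec\<close> and
  \<open>coord\<close> turn every computation in the module into one in \<open>K\<close>.\<close>

locale character_module = central_algebra K R \<iota> + M?: left_module R M
  for K :: "('k, 'w) ring_scheme" (structure) and R :: "('r, 'x) ring_scheme" (structure)
    and \<iota> :: "'k \<Rightarrow> 'r" and M :: "('r, 'm, 'y) module_scheme" (structure) +
  fixes \<chi> :: "'r \<Rightarrow> 'k" and m\<^sub>0 :: 'm
  assumes \<chi>_hom: "\<chi> \<in> ring_hom R K"
    and \<chi>_\<iota>: "\<And>c. c \<in> carrier K \<Longrightarrow> \<chi> (\<iota> c) = c"
    and m0_closed: "m\<^sub>0 \<in> carrier M" and m0_nonzero: "m\<^sub>0 \<noteq> \<zero>\<^bsub>M\<^esub>"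
    and line: "\<And>m. m \<in> carrier M \<Longrightarrow> \<exists>c\<in>carrier K. m = \<iota> c \<odot>\<^bsub>M\<^esub> m\<^sub>0"
    and acts: "\<And>r. r \<in> carrier R \<Longrightarrow> r \<odot>\<^bsub>M\<^esub> m\<^sub>0 = \<iota> (\<chi> r) \<odot>\<^bsub>M\<^esub> m\<^sub>0"
begin

definition vec :: "'k \<Rightarrow> 'm" where "vec c = \<iota> c \<odot>\<^bsub>M\<^esub> m\<^sub>0"

definition coord :: "'m \<Rightarrow> 'k" where "coord m = (THE c. c \<in> carrier K \<and> m = vec c)"

lemma \<chi>_closed: "r \<in> carrier R \<Longrightarrow> \<chi> r \<in> carrier K"
  using \<chi>_hom by (rule ring_hom_closed)

lemmas \<chi>_add = ring_hom_add[OF \<chi>_hom]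
lemmas \<chi>_mult = ring_hom_mult[OF \<chi>_hom]

lemma vec_closed: "c \<in> carrier K \<Longrightarrow> vec c \<in> carrier M"
  by (simp add: vec_def M.smult_closed m0_closed)

lemma vec_add: "c \<in> carrier K \<Longrightarrow> d \<in> carrier K \<Longrightarrow> vec (c \<oplus> d) = vec c \<oplus>\<^bsub>M\<^esub> vec d"
  by (simp add: vec_def \<iota>_add M.smult_l_distr m0_closed)

lemma vec_zero: "vec \<zero> = \<zero>\<^bsub>M\<^esub>"
  by (simp add: vec_def \<iota>_zero M.smult_l_null m0_closed)

lemma vec_one: "vec \<one> = m\<^sub>0"
  by (simp add: vec_def \<iota>_one M.smult_one m0_closed)

lemma smult_vec:
  assumes "r \<in> carrier R" "c \<in> carrier K" shows "r \<odot>\<^bsub>M\<^esub> vec c = vec (\<chi> r \<otimes> c)"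
proof -
  have "r \<odot>\<^bsub>M\<^esub> vec c = \<iota> c \<odot>\<^bsub>M\<^esub> (r \<odot>\<^bsub>M\<^esub> m\<^sub>0)"
    unfolding vec_def using scalar_commute[OF M.left_module_axioms assms(2,1) m0_closed] by simp
  also have "\<dots> = \<iota> c \<odot>\<^bsub>M\<^esub> (\<iota> (\<chi> r) \<odot>\<^bsub>M\<^esub> m\<^sub>0)" using acts[OF assms(1)] by simp
  also have "\<dots> = vec (c \<otimes> \<chi> r)"
    unfolding vec_def using M.smult_assoc[of "\<iota> c" "\<iota> (\<chi> r)" "m\<^sub>0"] assms m0_closed
    by (simp add: \<iota>_mult \<chi>_closed)
  finally show ?thesis using assms by (simp add: K.m_comm \<chi>_closed)
qed

text \<open>A nonzero coordinate is invertible, and its inverse would carry the zero vector to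
  \<open>m\<^sub>0\<close>.\<close>

lemma vec_eq_zero:
  assumes c: "c \<in> carrier K" and "vec c = \<zero>\<^bsub>M\<^esub>" shows "c = \<zero>"
proof (rule ccontr)
  assume "c \<noteq> \<zero>"
  then have u: "c \<in> Units K" using c by (simp add: K.field_Units)
  let ?d = "inv c"
  have d: "?d \<in> carrier K" using u by simp
  have "m\<^sub>0 = vec (?d \<otimes> c)" using u by (simp add: vec_one)
  also have "\<dots> = \<iota> ?d \<odot>\<^bsub>M\<^esub> vec c" using smult_vec[of "\<iota> ?d" c] c d by (simp add: \<chi>_\<iota>)
  also have "\<dots> = \<zero>\<^bsub>M\<^esub>" using assms d by (simp add: M.smult_r_null)
  finally show False using m0_nonzero by simp
qed

lemma vec_inj:
  assumes "c \<in> carrier K" "d \<in> carrier K" "vec c = vec d" shows "c = d"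
proof -
  have "vec (c \<ominus> d) \<oplus>\<^bsub>M\<^esub> vec d = vec c"
    using assms vec_add[of "c \<ominus> d" d] by (simp add: K.minus_eq K.a_assoc K.l_neg)
  then have "vec (c \<ominus> d) = \<zero>\<^bsub>M\<^esub>"
    using assms vec_closed[of "c \<ominus> d"] vec_closed[of d] by simp
  then have "c \<ominus> d = \<zero>" using vec_eq_zero assms by simp
  then show ?thesis using assms by simp
qed

lemma coord_unique: "c \<in> carrier K \<Longrightarrow> coord (vec c) = c"
  unfolding coord_def using vec_inj by blast

lemma coord_closed: "m \<in> carrier M \<Longrightarrow> coord m \<in> carrier K"
  and vec_coord: "m \<in> carrier M \<Longrightarrow> vec (coord m) = m"
  using line[of m] coord_unique by (auto simp flip: vec_def)

lemma coord_add:
  assumes "m \<in> carrier M" "m' \<in> carrier M"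
  shows "coord (m \<oplus>\<^bsub>M\<^esub> m') = coord m \<oplus> coord m'"
  using assms coord_unique[of "coord m \<oplus> coord m'"]
  by (simp add: vec_add coord_closed vec_coord)

lemma coord_smult:
  assumes "r \<in> carrier R" "m \<in> carrier M"
  shows "coord (r \<odot>\<^bsub>M\<^esub> m) = \<chi> r \<otimes> coord m"
  using assms smult_vec[of r "coord m"] coord_unique[of "\<chi> r \<otimes> coord m"]
  by (simp add: coord_closed vec_coord \<chi>_closed)

lemma coord_zero: "coord \<zero>\<^bsub>M\<^esub> = \<zero>"
  using coord_unique[of "\<zero>"] by (simp add: vec_zero)

lemma coord_m0: "coord m\<^sub>0 = \<one>"
  using coord_unique[of "\<one>"] by (simp add: vec_one)

end

section \<open>Ext of one-dimensional modules: derivations modulo inner derivations\<close>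

locale character_module_pair = central_algebra K R \<iota>
    + M: character_module K R \<iota> M \<alpha> m\<^sub>0 + N: character_module K R \<iota> N \<beta> n\<^sub>0
  for K :: "('k, 'w) ring_scheme" (structure) and R :: "('r, 'x) ring_scheme" (structure)
    and \<iota> :: "'k \<Rightarrow> 'r" and M :: "('r, 'm, 'y) module_scheme" and \<alpha> :: "'r \<Rightarrow> 'k" and m\<^sub>0 :: 'm
    and N :: "('r, 'n, 'z) module_scheme" and \<beta> :: "'r \<Rightarrow> 'k" and n\<^sub>0 :: 'n
begin

text \<open>
  The condition on \<open>D (\<iota> c)\<close> expresses \<open>K\<close>-linearity; it does not follow from the Leibniz rule.
\<close>

definition derivation :: "('r \<Rightarrow> 'k) \<Rightarrow> bool" where
  "derivation D \<longleftrightarrow> D \<in> carrier R \<rightarrow> carrier K \<and> (\<forall>c\<in>carrier K. D (\<iota> c) = \<zero>) \<and>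
     (\<forall>r\<in>carrier R. \<forall>s\<in>carrier R. D (r \<oplus>\<^bsub>R\<^esub> s) = D r \<oplus> D s \<and>
        D (r \<otimes>\<^bsub>R\<^esub> s) = \<beta> r \<otimes> D s \<oplus> D r \<otimes> \<alpha> s)"

text \<open>Commutators with a constant in the bimodule \<open>K\<close>, where the ring acts
  through \<beta> on the left and through \<alpha> on the right; their sign is absorbed into
  \<open>c\<close>.\<close>

definition inner :: "('r \<Rightarrow> 'k) \<Rightarrow> bool" where
  "inner D \<longleftrightarrow> (\<exists>c\<in>carrier K. \<forall>r\<in>carrier R. D r = c \<otimes> (\<alpha> r \<ominus> \<beta> r))"

abbreviation P where "P \<equiv> free_module R (carrier M)"
abbreviation Z where "Z \<equiv> syzygy R M"

sublocale P: left_module R P by (rule R.left_module_free)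
sublocale Z: left_module R Z by (rule M.left_module_syzygy)

text \<open>
  \<open>e r\<close> is \<open>r\<close> times the basis vector of the generator \<open>m\<^sub>0\<close>, and \<open>\<gamma>\<close> retracts the free module onto
  these multiples, compatibly with the maps to \<open>M\<close>.
\<close>

definition e :: "'r \<Rightarrow> 'm \<Rightarrow> 'r" where "e r = r \<odot>\<^bsub>P\<^esub> R.basis_vector m\<^sub>0"

definition \<gamma> :: "('m \<Rightarrow> 'r) \<Rightarrow> 'r" where
  "\<gamma> = R.free_lift R.regular_module (\<lambda>m. \<iota> (M.coord m))"

lemma Z_ops: "\<zero>\<^bsub>Z\<^esub> = \<zero>\<^bsub>P\<^esub>" "add Z = add P" "smult Z = smult P"
  by (simp_all add: syzygy_def)

lemma \<gamma>_hom: "\<gamma> \<in> module_hom R P R.regular_module"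
  unfolding \<gamma>_def by (rule R.free_lift_hom[OF R.left_module_regular])
    (auto simp: R.regular_simps M.coord_closed)

lemma \<gamma>_closed: "f \<in> carrier P \<Longrightarrow> \<gamma> f \<in> carrier R"
  using module_hom_mem[OF \<gamma>_hom] by (simp add: R.regular_simps)

lemma \<gamma>_add: "f \<in> carrier P \<Longrightarrow> g \<in> carrier P \<Longrightarrow> \<gamma> (f \<oplus>\<^bsub>P\<^esub> g) = \<gamma> f \<oplus>\<^bsub>R\<^esub> \<gamma> g"
  using module_hom_add[OF \<gamma>_hom] by (simp add: R.regular_simps)

lemma \<gamma>_smult: "r \<in> carrier R \<Longrightarrow> f \<in> carrier P \<Longrightarrow> \<gamma> (r \<odot>\<^bsub>P\<^esub> f) = r \<otimes>\<^bsub>R\<^esub> \<gamma> f"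
  using module_hom_smult[OF \<gamma>_hom] by (simp add: R.regular_simps)

lemma basis_closed: "R.basis_vector m\<^sub>0 \<in> carrier P"
  using R.basis_vector_closed[OF M.m0_closed] .

lemma e_closed: "r \<in> carrier R \<Longrightarrow> e r \<in> carrier P"
  unfolding e_def by (rule P.smult_closed[OF _ basis_closed])

lemma e_add: "r \<in> carrier R \<Longrightarrow> s \<in> carrier R \<Longrightarrow> e (r \<oplus>\<^bsub>R\<^esub> s) = e r \<oplus>\<^bsub>P\<^esub> e s"
  unfolding e_def by (rule P.smult_l_distr[OF _ _ basis_closed])

lemma e_mult: "r \<in> carrier R \<Longrightarrow> s \<in> carrier R \<Longrightarrow> e (r \<otimes>\<^bsub>R\<^esub> s) = r \<odot>\<^bsub>P\<^esub> e s"
  unfolding e_def by (rule P.smult_assoc[OF _ _ basis_closed])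

lemma \<gamma>_e: assumes "r \<in> carrier R" shows "\<gamma> (e r) = r"
proof -
  have "\<gamma> (R.basis_vector m\<^sub>0) = \<iota> (M.coord m\<^sub>0)"
    unfolding \<gamma>_def
    by (rule R.free_lift_basis_vector[OF R.left_module_regular _ M.m0_closed])
      (auto simp: R.regular_simps M.coord_closed)
  also have "\<dots> = \<one>\<^bsub>R\<^esub>" by (simp add: M.coord_m0 \<iota>_one)
  finally show ?thesis unfolding e_def using assms \<gamma>_smult[OF assms basis_closed] by simp
qed

text \<open>Each \<open>s\<close> in \<open>M\<close> is its coordinate times
  \<open>m\<^sub>0\<close>, so \<open>m\<^sub>0\<close> can be factored out of the sum, and what
  remains is \<gamma>. Membership in the syzygy thus depends on \<open>\<gamma> f\<close>
  alone.\<close>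

lemma canonical_map_eq:
  assumes f: "f \<in> carrier P" shows "canonical_map R M f = \<gamma> f \<odot>\<^bsub>M\<^esub> m\<^sub>0"
proof -
  let ?T = "{s. f s \<noteq> \<zero>\<^bsub>R\<^esub>}"
  have T: "finite ?T" "?T \<subseteq> carrier M" and fR: "\<And>s. f s \<in> carrier R"
    using f by (auto simp: free_carrier)
  have "canonical_map R M f = (\<Oplus>\<^bsub>M\<^esub>s\<in>?T. (f s \<otimes>\<^bsub>R\<^esub> \<iota> (M.coord s)) \<odot>\<^bsub>M\<^esub> m\<^sub>0)"
    unfolding canonical_map_def
  proof (rule M.finsum_cong')
    show "(\<lambda>s. (f s \<otimes>\<^bsub>R\<^esub> \<iota> (M.coord s)) \<odot>\<^bsub>M\<^esub> m\<^sub>0) \<in> ?T \<rightarrow> carrier M"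
      using T fR by (intro Pi_I M.smult_closed M.m0_closed R.m_closed \<iota>_closed M.coord_closed) auto
    fix s assume "s \<in> ?T"
    then have s: "s \<in> carrier M" using T by blast
    have "f s \<odot>\<^bsub>M\<^esub> s = f s \<odot>\<^bsub>M\<^esub> (\<iota> (M.coord s) \<odot>\<^bsub>M\<^esub> m\<^sub>0)"
      using M.vec_coord[OF s] by (simp add: M.vec_def)
    also have "\<dots> = (f s \<otimes>\<^bsub>R\<^esub> \<iota> (M.coord s)) \<odot>\<^bsub>M\<^esub> m\<^sub>0"
      using M.smult_assoc[OF fR \<iota>_closed[OF M.coord_closed[OF s]] M.m0_closed] by simp
    finally show "f s \<odot>\<^bsub>M\<^esub> s = (f s \<otimes>\<^bsub>R\<^esub> \<iota> (M.coord s)) \<odot>\<^bsub>M\<^esub> m\<^sub>0" .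
  qed simp
  also have "\<dots> = (\<Oplus>\<^bsub>R\<^esub>s\<in>?T. f s \<otimes>\<^bsub>R\<^esub> \<iota> (M.coord s)) \<odot>\<^bsub>M\<^esub> m\<^sub>0"
    using T fR by (intro M.finsum_smult_rdistr[symmetric] M.m0_closed Pi_I R.m_closed \<iota>_closed M.coord_closed) auto
  also have "(\<Oplus>\<^bsub>R\<^esub>s\<in>?T. f s \<otimes>\<^bsub>R\<^esub> \<iota> (M.coord s)) = \<gamma> f"
    unfolding \<gamma>_def R.free_lift_def by (simp add: R.regular_simps R.finsum_regular)
  finally show ?thesis .
qed

lemma Z_iff: "f \<in> carrier Z \<longleftrightarrow> f \<in> carrier P \<and> \<alpha> (\<gamma> f) = \<zero>"
proof -
  have "canonical_map R M f = \<zero>\<^bsub>M\<^esub> \<longleftrightarrow> \<alpha> (\<gamma> f) = \<zero>" if f: "f \<in> carrier P"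
  proof -
    have "canonical_map R M f = M.vec (\<alpha> (\<gamma> f))"
      using canonical_map_eq[OF f] M.acts[OF \<gamma>_closed[OF f]] by (simp add: M.vec_def)
    moreover have "M.vec (\<alpha> (\<gamma> f)) = \<zero>\<^bsub>M\<^esub> \<longleftrightarrow> \<alpha> (\<gamma> f) = \<zero>"
      using M.vec_eq_zero[OF M.\<chi>_closed[OF \<gamma>_closed[OF f]]] M.vec_zero by metis
    ultimately show ?thesis by simp
  qed
  moreover have "f \<in> carrier Z \<longleftrightarrow> f \<in> carrier P \<and> canonical_map R M f = \<zero>\<^bsub>M\<^esub>"
    by (simp add: syzygy_def)
  ultimately show ?thesis by blast
qed

lemma Z_subset: "f \<in> carrier Z \<Longrightarrow> f \<in> carrier P"
  by (simp add: Z_iff)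

text \<open>The projection of the ring onto the left ideal ker \<alpha> along the scalars.\<close>

definition aug :: "'r \<Rightarrow> 'r" where "aug r = r \<ominus>\<^bsub>R\<^esub> \<iota> (\<alpha> r)"

lemma aug_closed: "r \<in> carrier R \<Longrightarrow> aug r \<in> carrier R"
  unfolding aug_def by (intro R.minus_closed \<iota>_closed M.\<chi>_closed)

lemma \<alpha>_minus: "r \<in> carrier R \<Longrightarrow> s \<in> carrier R \<Longrightarrow> \<alpha> (r \<ominus>\<^bsub>R\<^esub> s) = \<alpha> r \<ominus> \<alpha> s"
  and \<beta>_minus: "r \<in> carrier R \<Longrightarrow> s \<in> carrier R \<Longrightarrow> \<beta> (r \<ominus>\<^bsub>R\<^esub> s) = \<beta> r \<ominus> \<beta> s"
proof -
  interpret a: ring_hom_ring R K \<alpha> by (rule ring_hom_ringI2[OF R.ring_axioms K.ring_axioms M.\<chi>_hom])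
  interpret b: ring_hom_ring R K \<beta> by (rule ring_hom_ringI2[OF R.ring_axioms K.ring_axioms N.\<chi>_hom])
  show "\<alpha> (r \<ominus>\<^bsub>R\<^esub> s) = \<alpha> r \<ominus> \<alpha> s" "\<beta> (r \<ominus>\<^bsub>R\<^esub> s) = \<beta> r \<ominus> \<beta> s"
    if "r \<in> carrier R" "s \<in> carrier R" using that by (simp_all add: a_minus_def)
qed

lemma \<alpha>_aug: "r \<in> carrier R \<Longrightarrow> \<alpha> (aug r) = \<zero>"
  unfolding aug_def by (simp add: \<alpha>_minus M.\<chi>_closed M.\<chi>_\<iota> K.minus_eq K.r_neg)

lemma \<beta>_aug: "r \<in> carrier R \<Longrightarrow> \<beta> (aug r) = \<beta> r \<ominus> \<alpha> r"
  unfolding aug_def by (simp add: \<beta>_minus M.\<chi>_closed N.\<chi>_\<iota>)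

lemma e_aug_in_Z: "r \<in> carrier R \<Longrightarrow> e (aug r) \<in> carrier Z"
  by (simp add: Z_iff e_closed aug_closed \<gamma>_e \<alpha>_aug)

text \<open>A map on the syzygy is restricted to the copy of ker \<alpha> given by \<open>e\<close>
  and read in coordinates. Precomposing with \<open>aug\<close> extends it to the whole ring by zero
  on the scalars.\<close>

definition cocycle :: "(('m \<Rightarrow> 'r) \<Rightarrow> 'n) \<Rightarrow> 'r \<Rightarrow> 'k" where
  "cocycle \<phi> r = N.coord (\<phi> (e (aug r)))"

lemma aug_add:
  assumes "r \<in> carrier R" "s \<in> carrier R" shows "aug (r \<oplus>\<^bsub>R\<^esub> s) = aug r \<oplus>\<^bsub>R\<^esub> aug s"
proof -
  have *: "\<iota> (\<alpha> r) \<in> carrier R" "\<iota> (\<alpha> s) \<in> carrier R" using assms M.\<chi>_closed by auto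
  have "\<iota> (\<alpha> (r \<oplus>\<^bsub>R\<^esub> s)) = \<iota> (\<alpha> r) \<oplus>\<^bsub>R\<^esub> \<iota> (\<alpha> s)"
    using assms by (simp add: M.\<chi>_add \<iota>_add M.\<chi>_closed)
  then show ?thesis unfolding aug_def using assms *
    by (simp add: R.minus_eq R.minus_add R.a_ac)
qed

text \<open>This identity is the source of the Leibniz rule: under a homomorphism into
  \<open>N\<close>, the factor \<open>r\<close> of the first summand acts through \<beta>, while the
  second summand contributes the scalar \<open>\<alpha> s\<close>.\<close>

lemma aug_mult:
  assumes "r \<in> carrier R" "s \<in> carrier R"
  shows "aug (r \<otimes>\<^bsub>R\<^esub> s) = r \<otimes>\<^bsub>R\<^esub> aug s \<oplus>\<^bsub>R\<^esub> \<iota> (\<alpha> s) \<otimes>\<^bsub>R\<^esub> aug r"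
proof -
  have *: "\<iota> (\<alpha> r) \<in> carrier R" "\<iota> (\<alpha> s) \<in> carrier R" using assms M.\<chi>_closed by auto
  have 1: "\<iota> (\<alpha> (r \<otimes>\<^bsub>R\<^esub> s)) = \<iota> (\<alpha> s) \<otimes>\<^bsub>R\<^esub> \<iota> (\<alpha> r)"
    using assms \<iota>_central[of "\<alpha> r" "\<iota> (\<alpha> s)"] * by (simp add: M.\<chi>_mult \<iota>_mult M.\<chi>_closed)
  have 2: "r \<otimes>\<^bsub>R\<^esub> \<iota> (\<alpha> s) = \<iota> (\<alpha> s) \<otimes>\<^bsub>R\<^esub> r" using \<iota>_central[of "\<alpha> s" r] assms M.\<chi>_closed by simp
  have "r \<otimes>\<^bsub>R\<^esub> aug s \<oplus>\<^bsub>R\<^esub> \<iota> (\<alpha> s) \<otimes>\<^bsub>R\<^esub> aug r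
      = (r \<otimes>\<^bsub>R\<^esub> s \<oplus>\<^bsub>R\<^esub> \<ominus>\<^bsub>R\<^esub> (r \<otimes>\<^bsub>R\<^esub> \<iota> (\<alpha> s))) \<oplus>\<^bsub>R\<^esub> (\<iota> (\<alpha> s) \<otimes>\<^bsub>R\<^esub> r \<oplus>\<^bsub>R\<^esub> \<ominus>\<^bsub>R\<^esub> (\<iota> (\<alpha> s) \<otimes>\<^bsub>R\<^esub> \<iota> (\<alpha> r)))"
    unfolding aug_def using assms * by (simp add: R.minus_eq R.r_distr R.r_minus)
  also have "\<dots> = r \<otimes>\<^bsub>R\<^esub> s \<oplus>\<^bsub>R\<^esub> \<ominus>\<^bsub>R\<^esub> (\<iota> (\<alpha> s) \<otimes>\<^bsub>R\<^esub> \<iota> (\<alpha> r))"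
    unfolding 2 using assms * by (simp add: R.a_assoc R.r_neg2 R.r_neg1)
  finally show ?thesis unfolding aug_def[of "r \<otimes>\<^bsub>R\<^esub> s"] 1 by (simp add: R.minus_eq)
qed

lemma aug_\<iota>: "c \<in> carrier K \<Longrightarrow> aug (\<iota> c) = \<zero>\<^bsub>R\<^esub>"
  by (simp add: aug_def M.\<chi>_\<iota> R.minus_eq R.r_neg)

lemma cocycle_derivation:
  assumes \<phi>: "\<phi> \<in> module_hom R Z N" shows "derivation (cocycle \<phi>)"
  unfolding derivation_def
proof (intro conjI ballI)
  have cl: "\<phi> (e (aug r)) \<in> carrier N" if "r \<in> carrier R" for r
    using module_hom_mem[OF \<phi> e_aug_in_Z[OF that]] .
  show "cocycle \<phi> \<in> carrier R \<rightarrow> carrier K"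
    unfolding cocycle_def using cl N.coord_closed by blast
  fix c assume c: "c \<in> carrier K"
  have "\<phi> \<zero>\<^bsub>Z\<^esub> = \<zero>\<^bsub>N\<^esub>"
    using module_hom_smult[OF \<phi> R.zero_closed Z.M.zero_closed]
      module_hom_mem[OF \<phi> Z.M.zero_closed]
    by (simp add: Z.smult_l_null N.smult_l_null)
  moreover have "e \<zero>\<^bsub>R\<^esub> = \<zero>\<^bsub>Z\<^esub>"
    unfolding e_def Z_ops by (rule P.smult_l_null[OF basis_closed])
  ultimately show "cocycle \<phi> (\<iota> c) = \<zero>"
    unfolding cocycle_def using c by (simp add: aug_\<iota> N.coord_zero)
next
  fix r s assume rs: "r \<in> carrier R" "s \<in> carrier R"
  have cl: "\<phi> (e (aug r)) \<in> carrier N" "\<phi> (e (aug s)) \<in> carrier N"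
    using module_hom_mem[OF \<phi> e_aug_in_Z] rs by auto
  have "e (aug (r \<oplus>\<^bsub>R\<^esub> s)) = e (aug r) \<oplus>\<^bsub>Z\<^esub> e (aug s)"
    using rs by (simp add: aug_add e_add aug_closed Z_ops)
  then show "cocycle \<phi> (r \<oplus>\<^bsub>R\<^esub> s) = cocycle \<phi> r \<oplus> cocycle \<phi> s"
    unfolding cocycle_def using module_hom_add[OF \<phi> e_aug_in_Z[OF rs(1)] e_aug_in_Z[OF rs(2)]]
    by (simp add: N.coord_add cl)
  have as: "\<alpha> s \<in> carrier K" using rs M.\<chi>_closed by simp
  have "e (aug (r \<otimes>\<^bsub>R\<^esub> s)) = r \<odot>\<^bsub>Z\<^esub> e (aug s) \<oplus>\<^bsub>Z\<^esub> \<iota> (\<alpha> s) \<odot>\<^bsub>Z\<^esub> e (aug r)"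
    using rs as by (simp add: aug_mult e_add e_mult aug_closed Z_ops)
  then have "\<phi> (e (aug (r \<otimes>\<^bsub>R\<^esub> s))) = r \<odot>\<^bsub>N\<^esub> \<phi> (e (aug s)) \<oplus>\<^bsub>N\<^esub> \<iota> (\<alpha> s) \<odot>\<^bsub>N\<^esub> \<phi> (e (aug r))"
    using rs as e_aug_in_Z by (simp add: module_hom_add[OF \<phi>] module_hom_smult[OF \<phi>] Z.smult_closed)
  then show "cocycle \<phi> (r \<otimes>\<^bsub>R\<^esub> s) = \<beta> r \<otimes> cocycle \<phi> s \<oplus> cocycle \<phi> r \<otimes> \<alpha> s"
    unfolding cocycle_def using rs cl as
    by (simp add: N.coord_add N.coord_smult N.smult_closed N.\<chi>_\<iota> K.m_comm N.coord_closed)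
qed

text \<open>An extension \<psi> is determined on multiples of \<open>e \<one>\<close> by the single
  value \<open>p\<close> there, and \<open>aug r\<close> acts on \<open>N\<close> by
  \<open>\<beta> r \<ominus> \<alpha> r\<close>. The constant of the inner derivation is therefore
  the negative of \<open>p\<close>.\<close>

lemma cocycle_restrict_inner:
  assumes \<psi>: "\<psi> \<in> module_hom R P N" and eq: "\<And>f. f \<in> carrier Z \<Longrightarrow> \<phi> f = \<psi> f"
  shows "inner (cocycle \<phi>)"
proof -
  define p where "p = N.coord (\<psi> (e \<one>\<^bsub>R\<^esub>))"
  have e1: "\<psi> (e \<one>\<^bsub>R\<^esub>) \<in> carrier N" using module_hom_mem[OF \<psi> e_closed] by simp
  then have p: "p \<in> carrier K" unfolding p_def by (rule N.coord_closed)
  have "cocycle \<phi> r = (\<ominus> p) \<otimes> (\<alpha> r \<ominus> \<beta> r)" if r: "r \<in> carrier R" for r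
  proof -
    have ab: "\<alpha> r \<in> carrier K" "\<beta> r \<in> carrier K" using r M.\<chi>_closed N.\<chi>_closed by auto
    have "\<psi> (e (aug r)) = aug r \<odot>\<^bsub>N\<^esub> \<psi> (e \<one>\<^bsub>R\<^esub>)"
      using module_hom_smult[OF \<psi> aug_closed[OF r] e_closed[OF R.one_closed]]
        e_mult[OF aug_closed[OF r] R.one_closed] aug_closed[OF r] by simp
    then have "cocycle \<phi> r = (\<beta> r \<ominus> \<alpha> r) \<otimes> p"
      unfolding cocycle_def eq[OF e_aug_in_Z[OF r]] p_def
      using N.coord_smult[OF aug_closed[OF r] e1] by (simp add: \<beta>_aug r)
    also have "\<dots> = (\<ominus> p) \<otimes> (\<alpha> r \<ominus> \<beta> r)"
      using p ab by algebra
    finally show ?thesis .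
  qed
  then show ?thesis unfolding inner_def using p by (intro bexI[of _ "\<ominus> p"]) auto
qed

text \<open>
  The map \<open>f \<mapsto> f - e (\<gamma> f)\<close> sends the free module into the syzygy, so \<open>\<phi>\<close> can be evaluated there;
  innerness of the cocycle supplies the correction on the multiples of \<open>e \<one>\<close>.
\<close>

lemma inner_cocycle_extends:
  assumes \<phi>: "\<phi> \<in> module_hom R Z N" and inner: "inner (cocycle \<phi>)"
  obtains \<psi> where "\<psi> \<in> module_hom R P N" "\<And>f. f \<in> carrier Z \<Longrightarrow> \<phi> f = \<psi> f"
proof -
  obtain c where c: "c \<in> carrier K"
    and coc: "\<And>r. r \<in> carrier R \<Longrightarrow> cocycle \<phi> r = c \<otimes> (\<alpha> r \<ominus> \<beta> r)"
    using inner by (auto simp: inner_def)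
  define \<pi> where "\<pi> f = f \<oplus>\<^bsub>P\<^esub> e (\<ominus>\<^bsub>R\<^esub> \<gamma> f)" for f
  have \<pi>_P: "\<pi> f \<in> carrier P" if "f \<in> carrier P" for f
    unfolding \<pi>_def using that \<gamma>_closed by (intro P.M.a_closed e_closed R.a_inv_closed)
  have \<pi>_Z: "\<pi> f \<in> carrier Z" if f: "f \<in> carrier P" for f
  proof -
    have "\<gamma> (\<pi> f) = \<zero>\<^bsub>R\<^esub>"
      unfolding \<pi>_def using f \<gamma>_closed[OF f] by (simp add: \<gamma>_add e_closed \<gamma>_e R.r_neg)
    moreover have "\<alpha> \<zero>\<^bsub>R\<^esub> = \<zero>"
      using ring_hom_zero[OF M.\<chi>_hom R.ring_axioms K.ring_axioms] .
    ultimately show ?thesis using \<pi>_P[OF f] by (simp add: Z_iff)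
  qed
  have \<pi>_add: "\<pi> (f \<oplus>\<^bsub>P\<^esub> g) = \<pi> f \<oplus>\<^bsub>Z\<^esub> \<pi> g" if "f \<in> carrier P" "g \<in> carrier P" for f g
    unfolding \<pi>_def Z_ops using that \<gamma>_closed
    by (simp add: \<gamma>_add R.minus_add e_add e_closed P.M.a_ac)
  have \<pi>_smult: "\<pi> (r \<odot>\<^bsub>P\<^esub> f) = r \<odot>\<^bsub>Z\<^esub> \<pi> f" if "r \<in> carrier R" "f \<in> carrier P" for r f
  proof -
    have "e (\<ominus>\<^bsub>R\<^esub> (r \<otimes>\<^bsub>R\<^esub> \<gamma> f)) = r \<odot>\<^bsub>P\<^esub> e (\<ominus>\<^bsub>R\<^esub> \<gamma> f)"
      using e_mult[of r "\<ominus>\<^bsub>R\<^esub> \<gamma> f"] that \<gamma>_closed by (simp add: R.r_minus)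
    then show ?thesis
      unfolding \<pi>_def Z_ops using that \<gamma>_closed by (simp add: \<gamma>_smult P.smult_r_distr e_closed)
  qed
  \<comment> \<open>On the syzygy \<open>\<alpha> (\<gamma> f)\<close> vanishes, so innerness says
    that the cocycle at \<open>\<gamma> f\<close> is the negative of \<open>c\<close> times
    \<open>\<beta> (\<gamma> f)\<close>. This formula makes sense on the whole free module and
    defines the correction.\<close>
  define q where "q f = N.vec ((\<ominus> c) \<otimes> \<beta> (\<gamma> f))" for f
  define \<psi> where "\<psi> f = \<phi> (\<pi> f) \<oplus>\<^bsub>N\<^esub> q f" for f
  have \<beta>\<gamma>: "\<beta> (\<gamma> f) \<in> carrier K" if "f \<in> carrier P" for f using N.\<chi>_closed \<gamma>_closed that by blast
  have q_closed: "q f \<in> carrier N" if "f \<in> carrier P" for f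
    unfolding q_def using c \<beta>\<gamma>[OF that] by (intro N.vec_closed) simp
  have \<phi>_closed: "\<phi> (\<pi> f) \<in> carrier N" if "f \<in> carrier P" for f
    using module_hom_mem[OF \<phi> \<pi>_Z[OF that]] .
  have "\<psi> \<in> module_hom R P N"
  proof (rule module_homI)
    fix f assume f: "f \<in> carrier P"
    then show "\<psi> f \<in> carrier N" unfolding \<psi>_def using q_closed \<phi>_closed by simp
    fix r assume r: "r \<in> carrier R"
    have br: "\<beta> r \<in> carrier K" using N.\<chi>_closed r .
    have "q (r \<odot>\<^bsub>P\<^esub> f) = N.vec (\<beta> r \<otimes> ((\<ominus> c) \<otimes> \<beta> (\<gamma> f)))"
      unfolding q_def using r f br c \<beta>\<gamma>[OF f] \<gamma>_closed[OF f]
      by (simp add: \<gamma>_smult N.\<chi>_mult K.m_lcomm)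
    also have "\<dots> = r \<odot>\<^bsub>N\<^esub> q f"
      unfolding q_def using N.smult_vec[OF r, of "(\<ominus> c) \<otimes> \<beta> (\<gamma> f)"] c \<beta>\<gamma>[OF f] by simp
    finally show "\<psi> (r \<odot>\<^bsub>P\<^esub> f) = r \<odot>\<^bsub>N\<^esub> \<psi> f"
      unfolding \<psi>_def using r f \<pi>_Z[OF f] q_closed[OF f] \<phi>_closed[OF f]
      by (simp add: \<pi>_smult module_hom_smult[OF \<phi>] N.smult_r_distr)
  next
    fix f g assume fg: "f \<in> carrier P" "g \<in> carrier P"
    have "q (f \<oplus>\<^bsub>P\<^esub> g) = q f \<oplus>\<^bsub>N\<^esub> q g"
      unfolding q_def using c \<beta>\<gamma>[OF fg(1)] \<beta>\<gamma>[OF fg(2)] \<gamma>_closed fg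
      by (simp add: \<gamma>_add N.\<chi>_add K.r_distr N.vec_add)
    then show "\<psi> (f \<oplus>\<^bsub>P\<^esub> g) = \<psi> f \<oplus>\<^bsub>N\<^esub> \<psi> g"
      unfolding \<psi>_def using fg \<pi>_Z q_closed \<phi>_closed
      by (simp add: \<pi>_add module_hom_add[OF \<phi>] N.M.a_ac)
  qed
  moreover have "\<phi> f = \<psi> f" if f: "f \<in> carrier Z" for f
  proof -
    have fP: "f \<in> carrier P" and a0: "\<alpha> (\<gamma> f) = \<zero>" using f by (auto simp: Z_iff)
    note g = \<gamma>_closed[OF fP]
    have "aug (\<gamma> f) = \<gamma> f" unfolding aug_def a0 \<iota>_zero using g by (simp add: R.minus_eq)
    then have eZ: "e (\<gamma> f) \<in> carrier Z" using e_aug_in_Z[OF g] by simp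
    have "cocycle \<phi> (\<gamma> f) = (\<ominus> c) \<otimes> \<beta> (\<gamma> f)"
      using coc[OF g] a0 c \<beta>\<gamma>[OF fP] by (simp add: K.minus_eq K.l_minus K.r_minus)
    then have "N.coord (\<phi> (e (\<gamma> f))) = (\<ominus> c) \<otimes> \<beta> (\<gamma> f)"
      unfolding cocycle_def \<open>aug (\<gamma> f) = \<gamma> f\<close> .
    then have q: "q f = \<phi> (e (\<gamma> f))"
      unfolding q_def using N.vec_coord[OF module_hom_mem[OF \<phi> eZ]] by simp
    have "e (\<ominus>\<^bsub>R\<^esub> \<gamma> f) \<oplus>\<^bsub>P\<^esub> e (\<gamma> f) = \<zero>\<^bsub>P\<^esub>"
      using e_add[of "\<ominus>\<^bsub>R\<^esub> \<gamma> f" "\<gamma> f"] g P.smult_l_null[OF basis_closed] by (simp add: R.l_neg e_def)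
    then have "f = \<pi> f \<oplus>\<^bsub>Z\<^esub> e (\<gamma> f)"
      unfolding \<pi>_def Z_ops using fP g e_closed by (simp add: P.M.a_assoc)
    then show ?thesis unfolding \<psi>_def q using module_hom_add[OF \<phi> \<pi>_Z[OF fP] eZ] by simp
  qed
  ultimately show ?thesis using that by blast
qed

definition realize :: "('r \<Rightarrow> 'k) \<Rightarrow> ('m \<Rightarrow> 'r) \<Rightarrow> 'n" where
  "realize D f = N.vec (D (\<gamma> f))"

text \<open>On ker \<alpha> the second summand of the Leibniz rule disappears, so a derivation is
  linear there with the ring acting through \<beta>.\<close>

lemma realize_hom:
  assumes D: "derivation D" shows "realize D \<in> module_hom R Z N"
proof (rule module_homI)
  have Dcl: "D r \<in> carrier K" if "r \<in> carrier R" for r using D that by (auto simp: derivation_def)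
  {
    fix f assume f: "f \<in> carrier Z"
    have fP: "f \<in> carrier P" and a0: "\<alpha> (\<gamma> f) = \<zero>" using f by (auto simp: Z_iff)
    note g = \<gamma>_closed[OF fP]
    show "realize D f \<in> carrier N" unfolding realize_def using N.vec_closed Dcl[OF g] .
    fix r assume r: "r \<in> carrier R"
    have "D (r \<otimes>\<^bsub>R\<^esub> \<gamma> f) = \<beta> r \<otimes> D (\<gamma> f)"
      using D r g a0 Dcl[OF g] Dcl[OF r] N.\<chi>_closed[OF r] by (simp add: derivation_def)
    then show "realize D (r \<odot>\<^bsub>Z\<^esub> f) = r \<odot>\<^bsub>N\<^esub> realize D f"
      unfolding realize_def Z_ops \<gamma>_smult[OF r fP] using N.smult_vec[OF r Dcl[OF g]] by simp
  next
    fix f h assume "f \<in> carrier Z" "h \<in> carrier Z"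
    then have fh: "f \<in> carrier P" "h \<in> carrier P" by (auto simp: Z_iff)
    then show "realize D (f \<oplus>\<^bsub>Z\<^esub> h) = realize D f \<oplus>\<^bsub>N\<^esub> realize D h"
      unfolding realize_def Z_ops \<gamma>_add[OF fh]
      using D \<gamma>_closed[OF fh(1)] \<gamma>_closed[OF fh(2)] N.vec_add Dcl by (simp add: derivation_def)
  }
qed

text \<open>Passing from \<open>r\<close> to \<open>aug r\<close> only removes a scalar, and
  derivations vanish on scalars.\<close>

lemma cocycle_realize:
  assumes D: "derivation D" and r: "r \<in> carrier R" shows "cocycle (realize D) r = D r"
proof -
  have ar: "\<alpha> r \<in> carrier K" using M.\<chi>_closed[OF r] .
  have Dcl: "D s \<in> carrier K" if "s \<in> carrier R" for s using D that by (auto simp: derivation_def)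
  have "cocycle (realize D) r = D (aug r)"
    unfolding cocycle_def realize_def \<gamma>_e[OF aug_closed[OF r]]
    by (rule N.coord_unique[OF Dcl[OF aug_closed[OF r]]])
  moreover have "aug r \<oplus>\<^bsub>R\<^esub> \<iota> (\<alpha> r) = r"
    unfolding aug_def using r ar by (simp add: R.minus_eq R.a_assoc R.l_neg)
  then have "D r = D (aug r) \<oplus> D (\<iota> (\<alpha> r))"
    using D aug_closed[OF r] \<iota>_closed[OF ar] unfolding derivation_def by metis
  ultimately show ?thesis using D ar Dcl[OF aug_closed[OF r]] by (simp add: derivation_def)
qed

lemma inner_cong:
  assumes "\<And>r. r \<in> carrier R \<Longrightarrow> D r = D' r"
  shows "inner D \<longleftrightarrow> inner D'"
  unfolding inner_def by (intro bex_cong ball_cong refl arg_cong2[of _ _ _ _ "(=)"] assms)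

lemma cocycle_cong:
  assumes "\<And>f. f \<in> carrier Z \<Longrightarrow> \<phi> f = \<psi> f" and "r \<in> carrier R"
  shows "cocycle \<phi> r = cocycle \<psi> r"
  unfolding cocycle_def assms(1)[OF e_aug_in_Z[OF assms(2)]] ..

text \<open>Taking cocycles is linear, reaches every derivation, and by \<open>W_iff\<close> sends
  exactly the restrictions from the free module to inner derivations. The derivation
  \<open>D\<^sub>0\<close> supplies the one vector that generates the cokernel.\<close>

lemma Ext1_dim_pos_iff:
  assumes D0: "derivation D\<^sub>0"
    and gen: "\<And>D. derivation D \<Longrightarrow> \<exists>c\<in>carrier K. inner (\<lambda>r. D r \<ominus> c \<otimes> D\<^sub>0 r)"
  shows "0 < vectorspace.dim K (Ext1 R \<iota> M N) \<longleftrightarrow> (\<exists>D. derivation D \<and> \<not> inner D)"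
proof -
  let ?V = "hom_space R \<iota> Z N"
  define W where "W = (\<lambda>\<phi>. restrict \<phi> (carrier Z)) ` module_hom R P N"
  interpret V: vectorspace K ?V
    by (rule hom_space_vectorspace[OF Z.left_module_axioms N.left_module_axioms])
  have V: "\<phi> \<in> carrier ?V \<longleftrightarrow> \<phi> \<in> module_hom R Z N \<and> \<phi> \<in> extensional (carrier Z)" for \<phi>
    by (simp add: hom_space_def)
  have ops: "\<zero>\<^bsub>?V\<^esub> = (\<lambda>x\<in>carrier Z. \<zero>\<^bsub>N\<^esub>)"
    "\<phi> \<oplus>\<^bsub>?V\<^esub> \<psi> = (\<lambda>x\<in>carrier Z. \<phi> x \<oplus>\<^bsub>N\<^esub> \<psi> x)"
    "c \<odot>\<^bsub>?V\<^esub> \<phi> = (\<lambda>x\<in>carrier Z. \<iota> c \<odot>\<^bsub>N\<^esub> \<phi> x)" for \<phi> \<psi> c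
    by (simp_all add: hom_space_def)
  have restr: "restrict \<phi> (carrier Z) \<in> carrier ?V" if "\<phi> \<in> module_hom R Z N" for \<phi>
    unfolding V using that
    by (intro conjI restrict_extensional module_homI)
      (simp_all add: module_hom_mem[OF that] module_hom_add[OF that] module_hom_smult[OF that] Z.smult_closed)
  have PZ: "\<psi> \<in> module_hom R Z N" if "\<psi> \<in> module_hom R P N" for \<psi>
    by (intro module_homI) (simp_all add: Z_ops Z_subset module_hom_mem[OF that]
          module_hom_add[OF that] module_hom_smult[OF that])
  have W_iff: "\<phi> \<in> W \<longleftrightarrow> inner (cocycle \<phi>)" if \<phi>: "\<phi> \<in> carrier ?V" for \<phi>
  proof
    assume "\<phi> \<in> W"
    then obtain \<psi> where "\<psi> \<in> module_hom R P N" "\<phi> = restrict \<psi> (carrier Z)" by (auto simp: W_def)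
    then show "inner (cocycle \<phi>)" using cocycle_restrict_inner[of \<psi> \<phi>] by simp
  next
    assume "inner (cocycle \<phi>)"
    moreover have "\<phi> \<in> module_hom R Z N" using \<phi> V by blast
    ultimately obtain \<psi> where \<psi>: "\<psi> \<in> module_hom R P N" "\<And>f. f \<in> carrier Z \<Longrightarrow> \<phi> f = \<psi> f"
      using inner_cocycle_extends by blast
    have "\<phi> = restrict \<psi> (carrier Z)"
      using \<phi> \<psi>(2) V by (intro extensionalityI[of _ "carrier Z"]) auto
    then show "\<phi> \<in> W" using \<psi>(1) by (auto simp: W_def)
  qed
  have WV: "W \<subseteq> carrier ?V" unfolding W_def using restr PZ by blast
  have coc_cl: "cocycle \<phi> r \<in> carrier K" if "\<phi> \<in> carrier ?V" "r \<in> carrier R" for \<phi> r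
    using cocycle_derivation[of \<phi>] that V by (auto simp: derivation_def)
  have val: "\<phi> (e (aug r)) \<in> carrier N" if "\<phi> \<in> carrier ?V" "r \<in> carrier R" for \<phi> r
    using module_hom_mem[of \<phi> R Z N] e_aug_in_Z[OF that(2)] that V by blast
  have coc_add: "cocycle (\<phi> \<oplus>\<^bsub>?V\<^esub> \<psi>) r = cocycle \<phi> r \<oplus> cocycle \<psi> r"
    if "\<phi> \<in> carrier ?V" "\<psi> \<in> carrier ?V" "r \<in> carrier R" for \<phi> \<psi> r
    unfolding cocycle_def ops using e_aug_in_Z[OF that(3)] val that by (simp add: N.coord_add)
  have coc_smult: "cocycle (c \<odot>\<^bsub>?V\<^esub> \<phi>) r = c \<otimes> cocycle \<phi> r"
    if "\<phi> \<in> carrier ?V" "c \<in> carrier K" "r \<in> carrier R" for \<phi> c r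
    unfolding cocycle_def ops using e_aug_in_Z[OF that(3)] val that by (simp add: N.coord_smult N.\<chi>_\<iota>)
  have Dab: "\<alpha> r \<in> carrier K" "\<beta> r \<in> carrier K" if "r \<in> carrier R" for r
    using M.\<chi>_closed N.\<chi>_closed that by auto
  have sm: "c \<odot>\<^bsub>?V\<^esub> \<phi> \<in> W" if c: "c \<in> carrier K" and \<phi>: "\<phi> \<in> W" for c \<phi>
  proof -
    have \<phi>V: "\<phi> \<in> carrier ?V" using WV \<phi> by blast
    obtain d where d: "d \<in> carrier K" "\<And>r. r \<in> carrier R \<Longrightarrow> cocycle \<phi> r = d \<otimes> (\<alpha> r \<ominus> \<beta> r)"
      using W_iff[OF \<phi>V] \<phi> by (auto simp: inner_def)
    have "inner (cocycle (c \<odot>\<^bsub>?V\<^esub> \<phi>))" unfolding inner_def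
      using c d Dab by (intro bexI[of _ "c \<otimes> d"]) (auto simp: coc_smult[OF \<phi>V c] K.m_assoc)
    then show ?thesis using W_iff V.smult_closed[OF c \<phi>V] by blast
  qed
  have ad: "\<phi> \<oplus>\<^bsub>?V\<^esub> \<psi> \<in> W" if \<phi>: "\<phi> \<in> W" and \<psi>: "\<psi> \<in> W" for \<phi> \<psi>
  proof -
    have inV: "\<phi> \<in> carrier ?V" "\<psi> \<in> carrier ?V" using WV \<phi> \<psi> by auto
    obtain c d where c: "c \<in> carrier K" "\<And>r. r \<in> carrier R \<Longrightarrow> cocycle \<phi> r = c \<otimes> (\<alpha> r \<ominus> \<beta> r)"
      and d: "d \<in> carrier K" "\<And>r. r \<in> carrier R \<Longrightarrow> cocycle \<psi> r = d \<otimes> (\<alpha> r \<ominus> \<beta> r)"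
      using W_iff[OF inV(1)] W_iff[OF inV(2)] \<phi> \<psi> by (auto simp: inner_def)
    have "inner (cocycle (\<phi> \<oplus>\<^bsub>?V\<^esub> \<psi>))" unfolding inner_def
      using c d Dab by (intro bexI[of _ "c \<oplus> d"]) (auto simp: coc_add[OF inV] K.l_distr)
    then show ?thesis using W_iff V.M.a_closed[OF inV] by blast
  qed
  have neg: "\<ominus>\<^bsub>?V\<^esub> \<phi> = (\<ominus> \<one>) \<odot>\<^bsub>?V\<^esub> \<phi>" if "\<phi> \<in> carrier ?V" for \<phi>
    using V.smult_l_minus[OF K.one_closed that] that by simp
  have "\<zero>\<^bsub>?V\<^esub> \<in> W"
  proof -
    have "(\<lambda>_. \<zero>\<^bsub>N\<^esub>) \<in> module_hom R P N" by (intro module_homI) (auto simp: N.smult_r_null)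
    then show ?thesis unfolding W_def ops by (rule image_eqI[rotated]) simp
  qed
  then have sub: "Module.submodule W K ?V"
    using WV sm ad neg by (intro V.submoduleI) auto
  \<comment> \<open>The homomorphism with cocycle \<open>D\<^sub>0\<close>; its class spans the
    quotient.\<close>
  define v where "v = restrict (realize D\<^sub>0) (carrier Z)"
  have v: "v \<in> carrier ?V" unfolding v_def by (rule restr[OF realize_hom[OF D0]])
  have coc_v: "cocycle v r = D\<^sub>0 r" if "r \<in> carrier R" for r
    using cocycle_cong[of v "realize D\<^sub>0" r] cocycle_realize[OF D0 that] that by (simp add: v_def)
  have "0 < vectorspace.dim K (quotient_module ?V W) \<longleftrightarrow> \<not> carrier ?V \<subseteq> W"
  proof (rule dim_quotient_pos_iff[OF V.vectorspace_axioms sub v])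
    fix \<phi> assume \<phi>: "\<phi> \<in> carrier ?V"
    then have "derivation (cocycle \<phi>)" using V cocycle_derivation by blast
    then obtain c where c: "c \<in> carrier K" and inn: "inner (\<lambda>r. cocycle \<phi> r \<ominus> c \<otimes> D\<^sub>0 r)"
      using gen by blast
    have cv: "c \<odot>\<^bsub>?V\<^esub> v \<in> carrier ?V" using c v by simp
    have eq: "\<phi> \<ominus>\<^bsub>?V\<^esub> c \<odot>\<^bsub>?V\<^esub> v = \<phi> \<oplus>\<^bsub>?V\<^esub> (\<ominus> \<one>) \<odot>\<^bsub>?V\<^esub> (c \<odot>\<^bsub>?V\<^esub> v)"
      using neg[OF cv] by (simp add: a_minus_def)
    have "cocycle (\<phi> \<ominus>\<^bsub>?V\<^esub> c \<odot>\<^bsub>?V\<^esub> v) r = cocycle \<phi> r \<ominus> c \<otimes> D\<^sub>0 r" if r: "r \<in> carrier R" for r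
    proof -
      have "D\<^sub>0 r \<in> carrier K" using coc_cl[OF v r] coc_v[OF r] by simp
      then show ?thesis unfolding eq using \<phi> c v cv r
        by (simp add: coc_add coc_smult coc_v K.minus_eq K.l_minus)
    qed
    then have "inner (cocycle (\<phi> \<ominus>\<^bsub>?V\<^esub> c \<odot>\<^bsub>?V\<^esub> v))" by (rule iffD2[OF inner_cong inn])
    then have "\<phi> \<ominus>\<^bsub>?V\<^esub> c \<odot>\<^bsub>?V\<^esub> v \<in> W"
      using W_iff[OF V.M.minus_closed[OF \<phi> cv]] by (rule iffD2[rotated])
    then show "\<exists>c\<in>carrier K. \<phi> \<ominus>\<^bsub>?V\<^esub> c \<odot>\<^bsub>?V\<^esub> v \<in> W"
      using c by (rule bexI)
  qed
  also have "\<not> carrier ?V \<subseteq> W \<longleftrightarrow> (\<exists>D. derivation D \<and> \<not> inner D)"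
  proof
    assume "\<not> carrier ?V \<subseteq> W"
    then obtain \<phi> where \<phi>: "\<phi> \<in> carrier ?V" "\<not> inner (cocycle \<phi>)" using W_iff by blast
    have "derivation (cocycle \<phi>)" using \<phi>(1) V cocycle_derivation by simp
    with \<phi>(2) show "\<exists>D. derivation D \<and> \<not> inner D" by (intro exI conjI)
  next
    assume "\<exists>D. derivation D \<and> \<not> inner D"
    then obtain D where D: "derivation D" "\<not> inner D" by blast
    let ?\<phi> = "restrict (realize D) (carrier Z)"
    have \<phi>: "?\<phi> \<in> carrier ?V" by (rule restr[OF realize_hom[OF D(1)]])
    have "cocycle ?\<phi> r = D r" if "r \<in> carrier R" for r
      using cocycle_cong[of ?\<phi> "realize D" r] cocycle_realize[OF D(1) that] that by simp
    then have "inner (cocycle ?\<phi>) \<longleftrightarrow> inner D" by (rule inner_cong)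
    with D(2) have "\<not> inner (cocycle ?\<phi>)" by simp
    then show "\<not> carrier ?V \<subseteq> W" using W_iff[OF \<phi>] \<phi> by blast
  qed
  finally show ?thesis unfolding Ext1_def W_def .
qed

end

section \<open>Characters and derivations of the algebra of a quiver\<close>

text \<open>
  The triple \<open>(b, d, a)\<close> stands for the upper triangular matrix with diagonal \<open>b, a\<close> and corner \<open>d\<close>.
  A ring homomorphism into this ring is a pair of characters with a derivation between them.
\<close>

definition triangular_ring :: "('k, 'w) ring_scheme \<Rightarrow> ('k \<times> 'k \<times> 'k) ring" where
  "triangular_ring K =
     \<lparr>carrier = carrier K \<times> carrier K \<times> carrier K,
      monoid.mult = (\<lambda>(b, d, a) (b', d', a').
        (b \<otimes>\<^bsub>K\<^esub> b', b \<otimes>\<^bsub>K\<^esub> d' \<oplus>\<^bsub>K\<^esub> d \<otimes>\<^bsub>K\<^esub> a', a \<otimes>\<^bsub>K\<^esub> a')),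
      one = (\<one>\<^bsub>K\<^esub>, \<zero>\<^bsub>K\<^esub>, \<one>\<^bsub>K\<^esub>), zero = (\<zero>\<^bsub>K\<^esub>, \<zero>\<^bsub>K\<^esub>, \<zero>\<^bsub>K\<^esub>),
      add = (\<lambda>(b, d, a) (b', d', a'). (b \<oplus>\<^bsub>K\<^esub> b', d \<oplus>\<^bsub>K\<^esub> d', a \<oplus>\<^bsub>K\<^esub> a'))\<rparr>"

lemma triangular_simps:
  "carrier (triangular_ring K) = carrier K \<times> carrier K \<times> carrier K"
  "\<one>\<^bsub>triangular_ring K\<^esub> = (\<one>\<^bsub>K\<^esub>, \<zero>\<^bsub>K\<^esub>, \<one>\<^bsub>K\<^esub>)"
  "\<zero>\<^bsub>triangular_ring K\<^esub> = (\<zero>\<^bsub>K\<^esub>, \<zero>\<^bsub>K\<^esub>, \<zero>\<^bsub>K\<^esub>)"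
  "(b, d, a) \<otimes>\<^bsub>triangular_ring K\<^esub> (b', d', a')
     = (b \<otimes>\<^bsub>K\<^esub> b', b \<otimes>\<^bsub>K\<^esub> d' \<oplus>\<^bsub>K\<^esub> d \<otimes>\<^bsub>K\<^esub> a', a \<otimes>\<^bsub>K\<^esub> a')"
  "(b, d, a) \<oplus>\<^bsub>triangular_ring K\<^esub> (b', d', a') = (b \<oplus>\<^bsub>K\<^esub> b', d \<oplus>\<^bsub>K\<^esub> d', a \<oplus>\<^bsub>K\<^esub> a')"
  by (simp_all add: triangular_ring_def)

lemma (in cring) ring_triangular: "ring (triangular_ring R)" (is "ring ?T")
proof (rule ringI)
  show "abelian_group ?T"
  proof (rule abelian_groupI)
    fix x assume "x \<in> carrier ?T"
    then show "\<exists>y\<in>carrier ?T.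
        y \<oplus>\<^bsub>?T\<^esub> x = \<zero>\<^bsub>?T\<^esub>"
      by (auto simp: triangular_simps intro!: bexI[of _ "(\<ominus> fst x, \<ominus> fst (snd x), \<ominus> snd (snd x))"] l_neg)
  qed (auto simp: triangular_simps a_ac)
  show "monoid ?T"
  proof (rule monoidI)
    fix x y z
    assume "x \<in> carrier ?T" "y \<in> carrier ?T"
      "z \<in> carrier ?T"
    then show "x \<otimes>\<^bsub>?T\<^esub> y \<otimes>\<^bsub>?T\<^esub> z
        = x \<otimes>\<^bsub>?T\<^esub> (y \<otimes>\<^bsub>?T\<^esub> z)"
      by (auto simp: triangular_simps m_assoc l_distr r_distr a_assoc)
  qed (auto simp: triangular_simps)
qed (auto simp: triangular_simps l_distr r_distr a_ac)

section \<open>Characters of the algebra, indexed by sets of vertices\<close>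

locale acyclic_quiver_algebra = quiver_algebra K Q + Q: fin_digraph Q
  for K (structure) and Q :: "('v, 'e) pre_digraph" +
  assumes acyclic: "acyclic (arcs_ends Q)"
begin

abbreviation V where "V \<equiv> verts Q"
abbreviation E where "E \<equiv> arcs_ends Q"

sublocale alg: central_algebra K R \<iota>
  by (intro central_algebra.intro central_algebra_axioms.intro K.field_axioms ring_R unit_hom unit_central)

definition ind :: "'v set \<Rightarrow> 'v \<Rightarrow> 'a" where "ind A t = (if t \<in> A then \<one> else \<zero>)"

lemma ind_closed [simp]: "ind A t \<in> carrier K"
  by (simp add: ind_def)

lemma hom_eq:
  assumes "\<phi> \<in> ring_hom R K" "\<psi> \<in> ring_hom R K"
    and "\<And>c. c \<in> carrier K \<Longrightarrow> \<phi> (\<iota> c) = \<psi> (\<iota> c)" "\<And>t. t \<in> V \<Longrightarrow> \<phi> (X t) = \<psi> (X t)"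
    and "r \<in> carrier R"
  shows "\<phi> r = \<psi> r"
  using assms(5)
proof (rule generated)
  fix r s assume "r \<in> carrier R" "s \<in> carrier R" "\<phi> r = \<psi> r" "\<phi> s = \<psi> s"
  then show "\<phi> (r \<oplus>\<^bsub>R\<^esub> s) = \<psi> (r \<oplus>\<^bsub>R\<^esub> s)" "\<phi> (r \<otimes>\<^bsub>R\<^esub> s) = \<psi> (r \<otimes>\<^bsub>R\<^esub> s)"
    using ring_hom_add[OF assms(1)] ring_hom_add[OF assms(2)]
      ring_hom_mult[OF assms(1)] ring_hom_mult[OF assms(2)] by simp_all
qed (use assms in auto)

text \<open>In a commutative ring, idempotents satisfy all three families of relations whatever the
  arrows are, so every choice of values 0 and 1 is admissible.\<close>

lemma character_exists:
  "\<exists>\<chi>. \<chi> \<in> ring_hom R K \<and> (\<forall>c\<in>carrier K. \<chi> (\<iota> c) = c) \<and> (\<forall>t\<in>V. \<chi> (X t) = ind A t)"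
proof -
  have "(\<lambda>c. c) \<in> ring_hom K K" by (rule ring_hom_memI) auto
  then obtain \<chi> where "\<chi> \<in> ring_hom R K" "\<And>c. c \<in> carrier K \<Longrightarrow> \<chi> (\<iota> c) = c"
      "\<And>t. t \<in> V \<Longrightarrow> \<chi> (X t) = ind A t"
    by (rule universal[OF K.ring_axioms, where x = "ind A"])
      (auto simp: K.m_comm, auto simp: ind_def)
  then show ?thesis by blast
qed

definition character :: "'v set \<Rightarrow> ('v list \<Rightarrow> 'a) set \<Rightarrow> 'a" where
  "character A = (SOME \<chi>. \<chi> \<in> ring_hom R K \<and> (\<forall>c\<in>carrier K. \<chi> (\<iota> c) = c)
     \<and> (\<forall>t\<in>V. \<chi> (X t) = ind A t))"

lemma character_hom: "character A \<in> ring_hom R K"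
  and character_unit: "c \<in> carrier K \<Longrightarrow> character A (\<iota> c) = c"
  and character_X: "t \<in> V \<Longrightarrow> character A (X t) = ind A t"
  using someI_ex[OF character_exists[of A]] unfolding character_def by blast+

definition is_character_module ::
    "'v set \<Rightarrow> (('v list \<Rightarrow> 'a) set, 'm, 'y) module_scheme \<Rightarrow> bool" where
  "is_character_module A M \<longleftrightarrow> (\<exists>m. character_module K R \<iota> M (character A) m)"

end

section \<open>Derivations between the characters of two vertex sets\<close>

locale BQ_character_modules = acyclic_quiver_algebra K Q
    + pair: character_module_pair K "BQ K Q" "BQ_unit K Q" M "acyclic_quiver_algebra.character K Q A" m\<^sub>0
        N "acyclic_quiver_algebra.character K Q B" n\<^sub>0
  for K :: "('a, 'w) ring_scheme" (structure) and Q :: "('v, 'e) pre_digraph"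
    and M :: "(('v list \<Rightarrow> 'a) set, 'm, 'y) module_scheme" and A m\<^sub>0
    and N :: "(('v list \<Rightarrow> 'a) set, 'n, 'z) module_scheme" and B n\<^sub>0
begin

abbreviation "\<alpha> \<equiv> character A"
abbreviation "\<beta> \<equiv> character B"

lemma \<alpha>_closed: "r \<in> carrier R \<Longrightarrow> \<alpha> r \<in> carrier K" and \<beta>_closed: "r \<in> carrier R \<Longrightarrow> \<beta> r \<in> carrier K"
  using ring_hom_closed[OF character_hom] by auto

lemma D_closed: "pair.derivation D \<Longrightarrow> r \<in> carrier R \<Longrightarrow> D r \<in> carrier K"
  and D_unit: "pair.derivation D \<Longrightarrow> c \<in> carrier K \<Longrightarrow> D (\<iota> c) = \<zero>"
  and D_add: "pair.derivation D \<Longrightarrow> r \<in> carrier R \<Longrightarrow> s \<in> carrier R \<Longrightarrow> D (r \<oplus>\<^bsub>R\<^esub> s) = D r \<oplus> D s"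
  and D_mult: "pair.derivation D \<Longrightarrow> r \<in> carrier R \<Longrightarrow> s \<in> carrier R \<Longrightarrow>
    D (r \<otimes>\<^bsub>R\<^esub> s) = \<beta> r \<otimes> D s \<oplus> D r \<otimes> \<alpha> s"
  unfolding pair.derivation_def by blast+

lemma derivation_eq:
  assumes "pair.derivation D" "pair.derivation D'" "\<And>t. t \<in> V \<Longrightarrow> D (X t) = D' (X t)"
    and "r \<in> carrier R"
  shows "D r = D' r"
  using assms(4)
proof (rule generated)
  fix r s assume "r \<in> carrier R" "s \<in> carrier R" "D r = D' r" "D s = D' s"
  then show "D (r \<oplus>\<^bsub>R\<^esub> s) = D' (r \<oplus>\<^bsub>R\<^esub> s)" "D (r \<otimes>\<^bsub>R\<^esub> s) = D' (r \<otimes>\<^bsub>R\<^esub> s)"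
    by (simp_all add: D_add[OF assms(1)] D_add[OF assms(2)] D_mult[OF assms(1)] D_mult[OF assms(2)])
next
  fix c assume "c \<in> carrier K"
  then show "D (\<iota> c) = D' (\<iota> c)" by (simp add: D_unit[OF assms(1)] D_unit[OF assms(2)])
qed (rule assms)

lemma inner_derivation:
  assumes "c \<in> carrier K" shows "pair.derivation (\<lambda>r. c \<otimes> (\<alpha> r \<ominus> \<beta> r))"
  unfolding pair.derivation_def
proof (intro conjI ballI Pi_I)
  fix r assume "r \<in> carrier R"
  then show "c \<otimes> (\<alpha> r \<ominus> \<beta> r) \<in> carrier K" using assms \<alpha>_closed \<beta>_closed by simp
next
  fix d assume "d \<in> carrier K"
  then show "c \<otimes> (\<alpha> (\<iota> d) \<ominus> \<beta> (\<iota> d)) = \<zero>"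
    using assms by (simp add: character_unit K.minus_eq K.r_neg)
next
  fix r s assume rs: "r \<in> carrier R" "s \<in> carrier R"
  have cl: "\<alpha> r \<in> carrier K" "\<alpha> s \<in> carrier K" "\<beta> r \<in> carrier K" "\<beta> s \<in> carrier K"
    using rs \<alpha>_closed \<beta>_closed by auto
  show "c \<otimes> (\<alpha> (r \<oplus>\<^bsub>R\<^esub> s) \<ominus> \<beta> (r \<oplus>\<^bsub>R\<^esub> s))
      = c \<otimes> (\<alpha> r \<ominus> \<beta> r) \<oplus> c \<otimes> (\<alpha> s \<ominus> \<beta> s)"
    unfolding ring_hom_add[OF character_hom rs] using cl assms by algebra
  show "c \<otimes> (\<alpha> (r \<otimes>\<^bsub>R\<^esub> s) \<ominus> \<beta> (r \<otimes>\<^bsub>R\<^esub> s))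
      = \<beta> r \<otimes> (c \<otimes> (\<alpha> s \<ominus> \<beta> s)) \<oplus> c \<otimes> (\<alpha> r \<ominus> \<beta> r) \<otimes> \<alpha> s"
    unfolding ring_hom_mult[OF character_hom rs] using cl assms by algebra
qed

text \<open>Both sides of the defining equation of an inner derivation are derivations, so comparing
  them on the generators is enough.\<close>

lemma inner_iff:
  assumes "pair.derivation D"
  shows "pair.inner D \<longleftrightarrow> (\<exists>c\<in>carrier K. \<forall>t\<in>V. D (X t) = c \<otimes> (ind A t \<ominus> ind B t))"
proof -
  have "(\<forall>r\<in>carrier R. D r = c \<otimes> (\<alpha> r \<ominus> \<beta> r))
      \<longleftrightarrow> (\<forall>t\<in>V. D (X t) = c \<otimes> (ind A t \<ominus> ind B t))" if "c \<in> carrier K" for c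
    using derivation_eq[OF assms inner_derivation[OF that]] X_closed
    by (auto simp: character_X)
  then show ?thesis unfolding pair.inner_def by blast
qed

lemma derivation_diff:
  assumes D: "pair.derivation D" and D': "pair.derivation D'" and c: "c \<in> carrier K"
  shows "pair.derivation (\<lambda>r. D r \<ominus> c \<otimes> D' r)"
  unfolding pair.derivation_def
proof (intro conjI ballI Pi_I)
  fix r assume "r \<in> carrier R"
  then show "D r \<ominus> c \<otimes> D' r \<in> carrier K" using c D_closed[OF D] D_closed[OF D'] by simp
next
  fix d assume "d \<in> carrier K"
  then show "D (\<iota> d) \<ominus> c \<otimes> D' (\<iota> d) = \<zero>" using c by (simp add: D_unit[OF D] D_unit[OF D'] K.minus_eq)
next
  fix r s assume rs: "r \<in> carrier R" "s \<in> carrier R"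
  have cl: "D r \<in> carrier K" "D s \<in> carrier K" "D' r \<in> carrier K" "D' s \<in> carrier K"
    "\<alpha> s \<in> carrier K" "\<beta> r \<in> carrier K"
    using rs D_closed[OF D] D_closed[OF D'] \<alpha>_closed \<beta>_closed by auto
  show "D (r \<oplus>\<^bsub>R\<^esub> s) \<ominus> c \<otimes> D' (r \<oplus>\<^bsub>R\<^esub> s) = (D r \<ominus> c \<otimes> D' r) \<oplus> (D s \<ominus> c \<otimes> D' s)"
    unfolding D_add[OF D rs] D_add[OF D' rs] using cl c by algebra
  show "D (r \<otimes>\<^bsub>R\<^esub> s) \<ominus> c \<otimes> D' (r \<otimes>\<^bsub>R\<^esub> s)
      = \<beta> r \<otimes> (D s \<ominus> c \<otimes> D' s) \<oplus> (D r \<ominus> c \<otimes> D' r) \<otimes> \<alpha> s"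
    unfolding D_mult[OF D rs] D_mult[OF D' rs] using cl c by algebra
qed

lemma DX_closed: "pair.derivation D \<Longrightarrow> t \<in> V \<Longrightarrow> D (X t) \<in> carrier K"
  using D_closed X_closed by blast

lemma D_X2:
  assumes "pair.derivation D" "s \<in> V" "t \<in> V"
  shows "D (X s \<otimes>\<^bsub>R\<^esub> X t) = ind B s \<otimes> D (X t) \<oplus> D (X s) \<otimes> ind A t"
  using D_mult[OF assms(1) X_closed[OF assms(2)] X_closed[OF assms(3)]] assms by (simp add: character_X)

lemma D_X3:
  assumes "pair.derivation D" "s \<in> V" "t \<in> V"
  shows "D (X s \<otimes>\<^bsub>R\<^esub> X t \<otimes>\<^bsub>R\<^esub> X s)
    = ind B s \<otimes> ind B t \<otimes> D (X s) \<oplus> (ind B s \<otimes> D (X t) \<oplus> D (X s) \<otimes> ind A t) \<otimes> ind A s"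
  using D_mult[OF assms(1) ring.ring_simprules(5)[OF ring_R X_closed[OF assms(2)] X_closed[OF assms(3)]] X_closed[OF assms(2)]]
    ring_hom_mult[OF character_hom[of B] X_closed[OF assms(2)] X_closed[OF assms(3)]]
  by (simp add: D_X2[OF assms] character_X assms)

text \<open>Idempotence of \<open>X t\<close> equates \<open>D (X t)\<close> with its product by the
  sum of the two character values. For equal values this reads d = 0 or d = d + d.\<close>

lemma derivation_support:
  assumes D: "pair.derivation D" and t: "t \<in> V" "t \<in> A \<longleftrightarrow> t \<in> B"
  shows "D (X t) = \<zero>"
proof -
  note cl = DX_closed[OF D t(1)]
  have "D (X t) = ind B t \<otimes> D (X t) \<oplus> D (X t) \<otimes> ind A t"
    using D_X2[OF D t(1) t(1)] relations(1)[OF t(1) t(1)] by simp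
  then show ?thesis using t(2) cl by (cases "t \<in> A") (auto simp: ind_def)
qed

text \<open>The braid relation is evaluated at \<open>s\<close> and \<open>t\<close>: within either
  difference, one side collapses to \<open>D (X s)\<close> and the other to
  \<open>D (X t)\<close>.\<close>

lemma derivation_const:
  assumes D: "pair.derivation D" and s: "s \<in> V" and t: "t \<in> V"
    and st: "s \<in> A - B \<and> t \<in> A - B \<or> s \<in> B - A \<and> t \<in> B - A"
  shows "D (X s) = D (X t)"
  using D_X3[OF D s t] D_X3[OF D t s] relations(2)[OF s t] st DX_closed[OF D s] DX_closed[OF D t]
  by (auto simp: ind_def)

text \<open>Without an arrow from \<open>s\<close> to \<open>t\<close>, \<open>X s\<close> times
  \<open>X t\<close> times \<open>X s\<close> equals \<open>X t\<close> times \<open>X s\<close>.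
  The derivation kills the former, as \<beta> vanishes at \<open>X s\<close> and \<alpha> at
  \<open>X t\<close>; on the latter it gives the sum.\<close>

lemma derivation_opposite:
  assumes D: "pair.derivation D" and s: "s \<in> V" "s \<in> A - B" and t: "t \<in> V" "t \<in> B - A"
    and no: "(s, t) \<notin> E"
  shows "D (X s) \<oplus> D (X t) = \<zero>"
  using D_X3[OF D s(1) t(1)] D_X2[OF D t(1) s(1)] relations(3)[OF t(1) s(1) no]
    s t DX_closed[OF D s(1)] DX_closed[OF D t(1)]
  by (auto simp: ind_def)

text \<open>The generators are sent to triangular matrices whose diagonal prescribes the two
  characters and whose corner is 1 on \<open>A - B\<close> only. The corner of the resulting
  homomorphism is the derivation.\<close>

lemma derivation_exists:
  assumes AB: "A \<subseteq> V" "B \<subseteq> V" and ex: "exchange E A B"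
  obtains D where "pair.derivation D" "\<And>t. t \<in> V \<Longrightarrow> D (X t) = ind (A - B) t"
proof -
  let ?T = "triangular_ring K"
  let ?x = "\<lambda>t. (ind B t, ind (A - B) t, ind A t)"
  have arrow: "(s, t) \<in> E" if "s \<in> A" "s \<notin> B" "t \<in> B" "t \<notin> A" for s t
    using ex that by (auto simp: exchange_def)
  obtain \<rho> where \<rho>: "\<rho> \<in> ring_hom R ?T" "\<And>c. c \<in> carrier K \<Longrightarrow> \<rho> (\<iota> c) = (c, \<zero>, c)"
    "\<And>t. t \<in> V \<Longrightarrow> \<rho> (X t) = ?x t"
  proof (rule universal[OF K.ring_triangular, of "\<lambda>c. (c, \<zero>, c)" ?x])
    show "(\<lambda>c. (c, \<zero>, c)) \<in> ring_hom K ?T"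
      by (rule ring_hom_memI) (auto simp: triangular_simps)
  next
    fix c r assume "c \<in> carrier K" "r \<in> carrier ?T"
    then show "(c, \<zero>, c) \<otimes>\<^bsub>?T\<^esub> r = r \<otimes>\<^bsub>?T\<^esub> (c, \<zero>, c)"
      by (cases r) (simp add: triangular_simps K.m_comm)
  next
    fix t show "?x t \<in> carrier ?T" by (simp add: triangular_simps)
  next
    fix s show "?x s \<otimes>\<^bsub>?T\<^esub> ?x s = ?x s" by (simp add: triangular_simps ind_def)
  next
    fix s t show "?x s \<otimes>\<^bsub>?T\<^esub> ?x t \<otimes>\<^bsub>?T\<^esub> ?x s = ?x t \<otimes>\<^bsub>?T\<^esub> ?x s \<otimes>\<^bsub>?T\<^esub> ?x t"
      by (simp add: triangular_simps ind_def)
  next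
    \<comment> \<open>The absorption relation is where the exchange condition enters: it excludes
      \<open>t\<close> in \<open>A - B\<close> with \<open>s\<close> in \<open>B - A\<close> when
      there is no arrow from \<open>t\<close> to \<open>s\<close>.\<close>
    fix s t assume "(t, s) \<notin> E"
    then show "?x t \<otimes>\<^bsub>?T\<^esub> ?x s \<otimes>\<^bsub>?T\<^esub> ?x t = ?x s \<otimes>\<^bsub>?T\<^esub> ?x t"
      using arrow[of t s] by (auto simp: triangular_simps ind_def)
  qed (auto simp: triangular_simps)
  define D where "D r = fst (snd (\<rho> r))" for r
  have split: "\<rho> r = (fst (\<rho> r), D r, snd (snd (\<rho> r)))" for r by (simp add: D_def)
  have cl: "\<rho> r \<in> carrier ?T" if "r \<in> carrier R" for r using ring_hom_closed[OF \<rho>(1) that] .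
  note mult = ring_hom_mult[OF \<rho>(1)] and add = ring_hom_add[OF \<rho>(1)]
  have one: "\<rho> \<one>\<^bsub>R\<^esub> = \<one>\<^bsub>?T\<^esub>" using ring_hom_one[OF \<rho>(1)] .
  have \<rho>_mult: "\<rho> (r \<otimes>\<^bsub>R\<^esub> s) = (fst (\<rho> r) \<otimes> fst (\<rho> s),
      fst (\<rho> r) \<otimes> D s \<oplus> D r \<otimes> snd (snd (\<rho> s)), snd (snd (\<rho> r)) \<otimes> snd (snd (\<rho> s)))"
    if "r \<in> carrier R" "s \<in> carrier R" for r s
    using mult[OF that] split[of r] split[of s] by (metis triangular_simps(4))
  have \<rho>_add: "\<rho> (r \<oplus>\<^bsub>R\<^esub> s) = (fst (\<rho> r) \<oplus> fst (\<rho> s), D r \<oplus> D s, snd (snd (\<rho> r)) \<oplus> snd (snd (\<rho> s)))"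
    if "r \<in> carrier R" "s \<in> carrier R" for r s
    using add[OF that] split[of r] split[of s] by (metis triangular_simps(5))
  have "(\<lambda>r. fst (\<rho> r)) \<in> ring_hom R K" "(\<lambda>r. snd (snd (\<rho> r))) \<in> ring_hom R K"
    using cl by (auto intro!: ring_hom_memI simp: \<rho>_mult \<rho>_add one triangular_simps mem_Times_iff)
  \<comment> \<open>The diagonal entries are ring homomorphisms to \<open>K\<close> with the right
    values on generators, hence the chosen characters.\<close>
  then have proj: "fst (\<rho> r) = \<beta> r" "snd (snd (\<rho> r)) = \<alpha> r" if "r \<in> carrier R" for r
    using hom_eq[OF _ character_hom, of "\<lambda>r. fst (\<rho> r)" B r]
      hom_eq[OF _ character_hom, of "\<lambda>r. snd (snd (\<rho> r))" A r] that
    by (auto simp: \<rho> character_unit character_X)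
  have "pair.derivation D"
    unfolding pair.derivation_def
    using cl by (auto simp: D_def[of "_ \<oplus>\<^bsub>R\<^esub> _"] D_def[of "_ \<otimes>\<^bsub>R\<^esub> _"] \<rho>_mult \<rho>_add proj)
      (auto simp: D_def \<rho> triangular_simps mem_Times_iff)
  moreover have "D (X t) = ind (A - B) t" if "t \<in> V" for t using \<rho>(3)[OF that] by (simp add: D_def)
  ultimately show ?thesis using that by blast
qed

lemma zero_derivation: "pair.derivation (\<lambda>_. \<zero>)"
  unfolding pair.derivation_def using \<alpha>_closed \<beta>_closed by simp

theorem Ext1_pos_iff_exchange:
  assumes AB: "A \<subseteq> V" "B \<subseteq> V"
  shows "0 < vectorspace.dim K (Ext1 R \<iota> M N) \<longleftrightarrow> exchange E A B"
proof (cases "exchange E A B")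
  case True
  then obtain s t where s: "s \<in> A - B" and t: "t \<in> B - A" by (auto simp: exchange_def)
  then have V: "s \<in> V" "t \<in> V" using AB by auto
  obtain D\<^sub>0 where D0: "pair.derivation D\<^sub>0" "\<And>t. t \<in> V \<Longrightarrow> D\<^sub>0 (X t) = ind (A - B) t"
    using derivation_exists[OF AB True] by blast
  \<comment> \<open>An inner derivation takes opposite values on the two differences, whereas
    \<open>D\<^sub>0\<close> takes the values 1 and 0.\<close>
  have "\<not> pair.inner D\<^sub>0"
  proof
    assume "pair.inner D\<^sub>0"
    then obtain c where c: "c \<in> carrier K" "\<And>t. t \<in> V \<Longrightarrow> ind (A - B) t = c \<otimes> (ind A t \<ominus> ind B t)"
      unfolding inner_iff[OF D0(1)] using D0(2) by metis
    have "c = \<one>" using c(2)[OF V(1)] s c(1) by (simp add: ind_def K.minus_eq)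
    moreover have "\<ominus> c = \<zero>" using c(2)[OF V(2)] t c(1) by (simp add: ind_def K.minus_eq K.r_minus)
    ultimately show False using K.minus_minus[of c] c(1) by simp
  qed
  moreover have "\<exists>c\<in>carrier K. pair.inner (\<lambda>r. D r \<ominus> c \<otimes> D\<^sub>0 r)" if D: "pair.derivation D" for D
  proof -
    let ?p = "D (X s)" and ?q = "D (X t)"
    have pq: "?p \<in> carrier K" "?q \<in> carrier K" using DX_closed[OF D] V by auto
    \<comment> \<open>A derivation has the value p on \<open>A - B\<close> and q on
      \<open>B - A\<close>. Subtracting p + q times \<open>D\<^sub>0\<close> leaves the opposite
      values -q and q, which is inner with constant -q.\<close>
    have "D (X u) \<ominus> (?p \<oplus> ?q) \<otimes> D\<^sub>0 (X u) = (\<ominus> ?q) \<otimes> (ind A u \<ominus> ind B u)" if u: "u \<in> V" for u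
    proof -
      consider "u \<in> A - B" | "u \<in> B - A" | "u \<in> A \<longleftrightarrow> u \<in> B" by blast
      then show ?thesis
      proof cases
        case 1
        have "?p \<ominus> (?p \<oplus> ?q) = \<ominus> ?q" using pq by algebra
        then show ?thesis using 1 derivation_const[OF D u V(1)] s pq D0(2)[OF u]
          by (simp add: ind_def K.minus_eq)
      next
        case 2
        then show ?thesis using derivation_const[OF D u V(2)] t pq D0(2)[OF u]
          by (simp add: ind_def K.minus_eq K.l_minus K.r_minus)
      next
        case 3
        then show ?thesis using derivation_support[OF D u] pq D0(2)[OF u]
          by (auto simp: ind_def K.minus_eq K.r_neg)
      qed
    qed
    then have "pair.inner (\<lambda>r. D r \<ominus> (?p \<oplus> ?q) \<otimes> D\<^sub>0 r)"
      unfolding inner_iff[OF derivation_diff[OF D D0(1) K.a_closed[OF pq]]]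
      using pq by (intro bexI[of _ "\<ominus> ?q"]) auto
    then show ?thesis using pq by (intro bexI[of _ "?p \<oplus> ?q"]) auto
  qed
  ultimately show ?thesis using pair.Ext1_dim_pos_iff[OF D0(1)] D0(1) True by blast
next
  case False
  have inner: "pair.inner D" if D: "pair.derivation D" for D
  proof -
    \<comment> \<open>The constant is the common value on \<open>A - B\<close>; if that set is
      empty, it is the negative of the common value on \<open>B - A\<close>, and 0 if both are
      empty.\<close>
    obtain c where c: "c \<in> carrier K" and cA: "\<And>u. u \<in> A - B \<Longrightarrow> D (X u) = c"
      and cB: "\<And>u. u \<in> B - A \<Longrightarrow> D (X u) = \<ominus> c"
    proof (cases "A - B = {}")
      case True
      show ?thesis
      proof (cases "B - A = {}")
        case BA: True
        show ?thesis by (rule that[of \<zero>]) (use True BA in auto)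
      next
        case False
        then obtain t where t: "t \<in> B - A" by blast
        then have cl: "D (X t) \<in> carrier K" using DX_closed[OF D] AB by blast
        have "D (X u) = D (X t)" if "u \<in> B - A" for u
          using derivation_const[OF D, of u t] t that AB by blast
        then show ?thesis using True cl by (intro that[of "\<ominus> D (X t)"]) auto
      qed
    next
      case notAB: False
      then obtain s where s: "s \<in> A - B" by blast
      then have cl: "D (X s) \<in> carrier K" using DX_closed[OF D] AB by blast
      have p: "D (X u) = D (X s)" if "u \<in> A - B" for u
        using derivation_const[OF D, of u s] s that AB by blast
      have "D (X u) = \<ominus> D (X s)" if u: "u \<in> B - A" for u
      proof -
        \<comment> \<open>Both differences are nonempty here, so the failure of the exchange is a
          missing arrow. Constancy on each side carries the relation for this one pair over to
          \<open>s\<close> and \<open>u\<close>.\<close>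
        obtain s' t' where st: "s' \<in> A - B" "t' \<in> B - A" "(s', t') \<notin> E"
          using False notAB u by (auto simp: exchange_def)
        have "D (X s') \<oplus> D (X t') = \<zero>" using derivation_opposite[OF D _ st(1) _ st(2,3)] st AB by blast
        moreover have "D (X t') = D (X u)" using derivation_const[OF D, of t' u] st u AB by blast
        ultimately have "D (X u) \<oplus> D (X s) = \<zero>"
          using p[OF st(1)] cl DX_closed[OF D, of u] u AB by (auto simp: K.a_comm)
        then show ?thesis using K.minus_equality[of "D (X u)" "D (X s)"] cl DX_closed[OF D, of u] u AB by auto
      qed
      then show ?thesis using that[of "D (X s)"] cl p by blast
    qed
    have "D (X u) = c \<otimes> (ind A u \<ominus> ind B u)" if u: "u \<in> V" for u
    proof -
      consider "u \<in> A - B" | "u \<in> B - A" | "u \<in> A \<longleftrightarrow> u \<in> B" by blast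
      then show ?thesis
      proof cases
        case 1
        then show ?thesis using cA[OF 1] c by (simp add: ind_def K.minus_eq)
      next
        case 2
        then show ?thesis using cB[OF 2] c by (simp add: ind_def K.minus_eq K.r_minus)
      next
        case 3
        then show ?thesis using derivation_support[OF D u] c by (auto simp: ind_def K.minus_eq K.r_neg)
      qed
    qed
    then show ?thesis unfolding inner_iff[OF D] using c by blast
  qed
  \<comment> \<open>Since all derivations are inner, the zero derivation serves as the generator
    that the criterion asks for.\<close>
  have "\<exists>c\<in>carrier K. pair.inner (\<lambda>r. D r \<ominus> c \<otimes> \<zero>)" if "pair.derivation D" for D
    using inner[OF derivation_diff[OF that zero_derivation K.zero_closed]] K.zero_closed by (rule bexI)
  then show ?thesis using pair.Ext1_dim_pos_iff[OF zero_derivation] inner False by blast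
qed

end

section \<open>Simple modules\<close>

context character_module
begin

text \<open>A nonzero element of a submodule has an invertible coordinate, so its scalar multiples
  already fill the module.\<close>

lemma submodule_trivial:
  assumes H: "Module.submodule H R M" shows "H = {\<zero>\<^bsub>M\<^esub>} \<or> H = carrier M"
proof (cases "H \<subseteq> {\<zero>\<^bsub>M\<^esub>}")
  case True
  interpret H: Module.submodule H R M by fact
  show ?thesis using True H.one_closed by auto
next
  case False
  interpret H: Module.submodule H R M by fact
  obtain h where h: "h \<in> H" "h \<noteq> \<zero>\<^bsub>M\<^esub>" using False by blast
  have hM: "h \<in> carrier M" using h H.subset by auto
  let ?c = "coord h"
  have c: "?c \<in> carrier K" using coord_closed[OF hM] .
  have "?c \<noteq> \<zero>" using vec_coord[OF hM] vec_zero h(2) by metis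
  then have u: "?c \<in> Units K" using c by (simp add: K.field_Units)
  have "m \<in> H" if m: "m \<in> carrier M" for m
  proof -
    have d: "coord m \<in> carrier K" "inv ?c \<in> carrier K" using coord_closed[OF m] u by auto
    have "\<iota> (coord m \<otimes> inv ?c) \<odot>\<^bsub>M\<^esub> vec ?c = vec (coord m \<otimes> inv ?c \<otimes> ?c)"
      using smult_vec[of "\<iota> (coord m \<otimes> inv ?c)" ?c] d c by (simp add: \<chi>_\<iota>)
    also have "\<dots> = m" using d c u vec_coord[OF m] by (simp add: K.m_assoc)
    finally have "\<iota> (coord m \<otimes> inv ?c) \<odot>\<^bsub>M\<^esub> h = m" using vec_coord[OF hM] by simp
    then show ?thesis using H.smult_closed[OF \<iota>_closed h(1), of "coord m \<otimes> inv ?c"] d by simp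
  qed
  then show ?thesis using H.subset by auto
qed

lemma simple: "simple_module R M"
  unfolding simple_module_def
  using M.left_module_axioms submodule_trivial m0_closed m0_nonzero by blast

end

lemma character_module_iso:
  assumes "character_module K R \<iota> M \<chi> m" "character_module K R \<iota> N \<chi> n"
  shows "module_iso R M N"
proof -
  interpret M: character_module K R \<iota> M \<chi> m by fact
  interpret N: character_module K R \<iota> N \<chi> n by fact
  let ?f = "\<lambda>x. N.vec (M.coord x)"
  have "?f \<in> module_hom R M N"
    by (intro module_homI) (simp_all add: N.vec_closed M.coord_closed M.coord_add N.vec_add
        M.coord_smult N.smult_vec)
  moreover have "bij_betw ?f (carrier M) (carrier N)"
    by (rule bij_betw_byWitness[where f' = "\<lambda>y. M.vec (N.coord y)"])
      (auto simp: N.coord_unique M.coord_unique M.coord_closed N.coord_closed M.vec_coord N.vec_coord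
        M.vec_closed N.vec_closed)
  ultimately show ?thesis unfolding module_iso_def by blast
qed

text \<open>The ring element \<open>r\<close> acts on all of \<open>M\<close> as the scalar
  \<open>\<chi> r\<close>. An isomorphism transports this to the basis vector of \<open>N\<close>,
  where scalars are determined by their action.\<close>

lemma character_module_iso_eq:
  assumes "character_module K R \<iota> M \<chi> m" "character_module K R \<iota> N \<psi> n" "module_iso R M N"
    and r: "r \<in> carrier R"
  shows "\<chi> r = \<psi> r"
proof -
  interpret M: character_module K R \<iota> M \<chi> m by fact
  interpret N: character_module K R \<iota> N \<psi> n by fact
  obtain f where f: "f \<in> module_hom R M N" "bij_betw f (carrier M) (carrier N)"
    using assms(3) by (auto simp: module_iso_def)
  obtain x where x: "x \<in> carrier M" "f x = n" using f(2) N.m0_closed by (metis bij_betw_def imageE)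
  let ?c = "\<chi> r"
  have c: "?c \<in> carrier K" using M.\<chi>_closed[OF r] .
  have "r \<odot>\<^bsub>M\<^esub> x = \<iota> ?c \<odot>\<^bsub>M\<^esub> x"
    using M.smult_vec[OF r M.coord_closed[OF x(1)]] M.smult_vec[OF M.\<iota>_closed[OF c] M.coord_closed[OF x(1)]]
      M.vec_coord[OF x(1)] M.\<chi>_\<iota>[OF c] by simp
  then have "r \<odot>\<^bsub>N\<^esub> n = \<iota> ?c \<odot>\<^bsub>N\<^esub> n"
    using module_hom_smult[OF f(1) r x(1)] module_hom_smult[OF f(1) M.\<iota>_closed[OF c] x(1)] x(2) by simp
  then have "N.vec (\<psi> r) = N.vec ?c" using N.acts[OF r] by (simp add: N.vec_def)
  then show ?thesis using N.vec_inj[OF N.\<chi>_closed[OF r] c] by simp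
qed

context central_algebra
begin

text \<open>
  The scalar \<open>c\<close> is represented by the singleton \<open>{\<iota> c}\<close>, since the modules in \<^const>\<open>simple_classes\<close>
  consist of subsets of \<open>R\<close>.
\<close>

definition character_model :: "('r \<Rightarrow> 'k) \<Rightarrow> 'r set_module" where
  "character_model \<chi> =
     \<lparr>carrier = (\<lambda>c. {\<iota> c}) ` carrier K, monoid.mult = undefined, one = undefined, zero = {\<zero>\<^bsub>R\<^esub>},
      add = (\<lambda>x y. {the_elem x \<oplus>\<^bsub>R\<^esub> the_elem y}),
      smult = (\<lambda>r x. {\<iota> (\<chi> r) \<otimes>\<^bsub>R\<^esub> the_elem x})\<rparr>"

lemma character_module_model:
  assumes \<chi>: "\<chi> \<in> ring_hom R K" "\<And>c. c \<in> carrier K \<Longrightarrow> \<chi> (\<iota> c) = c"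
  shows "character_module K R \<iota> (character_model \<chi>) \<chi> {\<one>\<^bsub>R\<^esub>}"
proof -
  let ?M = "character_model \<chi>"
  have carr: "carrier ?M = (\<lambda>c. {\<iota> c}) ` carrier K" and zero: "\<zero>\<^bsub>?M\<^esub> = {\<iota> \<zero>}"
    by (simp_all add: character_model_def \<iota>_zero)
  have add: "{\<iota> c} \<oplus>\<^bsub>?M\<^esub> {\<iota> d} = {\<iota> (c \<oplus> d)}" if "c \<in> carrier K" "d \<in> carrier K" for c d
    using that by (simp add: character_model_def \<iota>_add)
  have \<chi>_cl: "\<chi> r \<in> carrier K" if "r \<in> carrier R" for r using ring_hom_closed[OF \<chi>(1) that] .
  have smult: "r \<odot>\<^bsub>?M\<^esub> {\<iota> c} = {\<iota> (\<chi> r \<otimes> c)}" if "r \<in> carrier R" "c \<in> carrier K" for r c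
    using that \<chi>_cl by (simp add: character_model_def \<iota>_mult)
  have "abelian_group ?M"
  proof (rule abelian_groupI)
    fix x assume "x \<in> carrier ?M"
    then obtain c where c: "c \<in> carrier K" "x = {\<iota> c}" by (auto simp: carr)
    then have "{\<iota> (\<ominus> c)} \<oplus>\<^bsub>?M\<^esub> x = \<zero>\<^bsub>?M\<^esub>" by (simp add: add zero K.l_neg)
    moreover have "{\<iota> (\<ominus> c)} \<in> carrier ?M" using c by (simp add: carr)
    ultimately show "\<exists>y\<in>carrier ?M. y \<oplus>\<^bsub>?M\<^esub> x = \<zero>\<^bsub>?M\<^esub>" by blast
  qed (auto simp: carr add zero K.a_ac)
  then have "left_module R ?M"
    using R.ring_axioms
    by (intro left_module_moduleI)
      (auto simp: carr add smult \<chi>_cl ring_hom_add[OF \<chi>(1)] ring_hom_mult[OF \<chi>(1)] ring_hom_one[OF \<chi>(1)]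
        K.l_distr K.r_distr K.m_assoc)
  moreover have "{\<iota> c} = \<iota> c \<odot>\<^bsub>?M\<^esub> {\<iota> \<one>}" if "c \<in> carrier K" for c
    using that by (simp add: smult \<chi>(2))
  \<comment> \<open>The character is a left inverse of \<iota>, so 0 and 1 stay distinct in
    \<open>R\<close>.\<close>
  moreover have "\<iota> \<one> \<noteq> \<iota> \<zero>"
    using \<chi>(2)[of "\<one>"] \<chi>(2)[of "\<zero>"] K.one_not_zero by (metis K.one_closed K.zero_closed)
  moreover have "r \<odot>\<^bsub>?M\<^esub> {\<iota> \<one>} = \<iota> (\<chi> r) \<odot>\<^bsub>?M\<^esub> {\<iota> \<one>}" if "r \<in> carrier R" for r
    using that \<chi>_cl[OF that] by (simp add: smult \<chi>(2))
  ultimately have M: "left_module R ?M"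
    and line: "\<And>c. c \<in> carrier K \<Longrightarrow> {\<iota> c} = \<iota> c \<odot>\<^bsub>?M\<^esub> {\<iota> \<one>}"
    and nz: "{\<iota> \<one>} \<noteq> \<zero>\<^bsub>?M\<^esub>"
    and acts: "\<And>r. r \<in> carrier R \<Longrightarrow> r \<odot>\<^bsub>?M\<^esub> {\<iota> \<one>} = \<iota> (\<chi> r) \<odot>\<^bsub>?M\<^esub> {\<iota> \<one>}"
    unfolding zero by blast+
  have "character_module K R \<iota> ?M \<chi> {\<iota> \<one>}"
  proof (intro character_module.intro character_module_axioms.intro)
    fix m assume "m \<in> carrier ?M"
    then obtain c where "c \<in> carrier K" "m = {\<iota> c}" unfolding carr by blast
    then show "\<exists>c\<in>carrier K. m = \<iota> c \<odot>\<^bsub>?M\<^esub> {\<iota> \<one>}" using line by blast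
  next
    show "{\<iota> \<one>} \<in> carrier ?M" unfolding carr by simp
  qed (rule central_algebra_axioms M \<chi>(1) nz | erule \<chi>(2) | erule acts)+
  then show ?thesis by (simp add: \<iota>_one)
qed

end

section \<open>Classification of the simple modules and their isomorphism classes\<close>

context acyclic_quiver_algebra
begin

text \<open>
  Once the successors of \<open>t\<close> act as scalars, the absorption relations make the image of \<open>X t\<close> a
  submodule.
\<close>

lemma simple_acts_by_projection:
  assumes M: "simple_module R M" and t: "t \<in> V"
  shows "(\<forall>m\<in>carrier M. X t \<odot>\<^bsub>M\<^esub> m = \<zero>\<^bsub>M\<^esub>) \<or> (\<forall>m\<in>carrier M. X t \<odot>\<^bsub>M\<^esub> m = m)"
proof -
  interpret M: left_module R M using M unfolding simple_module_def by blast
  have "finite E" unfolding arcs_ends_def by simp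
  \<comment> \<open>Induction along the reversed arrows: the hypothesis concerns the successors of
    \<open>t\<close>, and sinks come first.\<close>
  then have "wf (E\<inverse>)" using acyclic by (rule finite_acyclic_wf_converse)
  then show ?thesis using t
  proof (induction t rule: wf_induct_rule)
    case (less t)
    note Xt = X_closed[OF less.prems]
    let ?H = "(\<lambda>m. X t \<odot>\<^bsub>M\<^esub> m) ` carrier M"
    have HM: "?H \<subseteq> carrier M" using M.smult_closed[OF Xt] by blast
    have add: "x \<oplus>\<^bsub>M\<^esub> y \<in> ?H" if "x \<in> ?H" "y \<in> ?H" for x y
    proof -
      obtain m n where mn: "m \<in> carrier M" "n \<in> carrier M" "x = X t \<odot>\<^bsub>M\<^esub> m" "y = X t \<odot>\<^bsub>M\<^esub> n"
        using \<open>x \<in> ?H\<close> \<open>y \<in> ?H\<close> by blast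
      then have "x \<oplus>\<^bsub>M\<^esub> y = X t \<odot>\<^bsub>M\<^esub> (m \<oplus>\<^bsub>M\<^esub> n)" using M.smult_r_distr[OF Xt] by simp
      then show ?thesis using mn M.M.a_closed by blast
    qed
    have zero: "\<zero>\<^bsub>M\<^esub> \<in> ?H" using M.smult_r_null[OF Xt] by (metis M.M.zero_closed image_eqI)
    have gen: "X s \<odot>\<^bsub>M\<^esub> h \<in> ?H" if s: "s \<in> V" and h: "h \<in> ?H" for s h
    proof (cases "(t, s) \<in> E")
      case True
      then have "X s \<odot>\<^bsub>M\<^esub> h = \<zero>\<^bsub>M\<^esub> \<or> X s \<odot>\<^bsub>M\<^esub> h = h"
        using less.IH[of s] s h HM by auto
      then show ?thesis using zero h by auto
    next
      \<comment> \<open>Without an arrow from \<open>t\<close> to \<open>s\<close>,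
        \<open>X s\<close> times \<open>X t\<close> can be rewritten as a product beginning with
        \<open>X t\<close>, whose values lie in the image.\<close>
      case False
      obtain m where m: "m \<in> carrier M" "h = X t \<odot>\<^bsub>M\<^esub> m" using h by blast
      note Xs = X_closed[OF s]
      have "X s \<odot>\<^bsub>M\<^esub> h = (X t \<otimes>\<^bsub>R\<^esub> X s \<otimes>\<^bsub>R\<^esub> X t) \<odot>\<^bsub>M\<^esub> m"
        using M.smult_assoc[OF Xs Xt m(1)] relations(3)[OF s less.prems False] m(2) by simp
      also have "\<dots> = X t \<odot>\<^bsub>M\<^esub> (X s \<odot>\<^bsub>M\<^esub> (X t \<odot>\<^bsub>M\<^esub> m))"
        using M.smult_assoc[OF ring.ring_simprules(5)[OF ring_R Xt Xs] Xt m(1)]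
          M.smult_assoc[OF Xt Xs M.smult_closed[OF Xt m(1)]] by simp
      finally show ?thesis using M.smult_closed[OF Xs M.smult_closed[OF Xt m(1)]] by blast
    qed
    have act: "\<forall>h\<in>?H. r \<odot>\<^bsub>M\<^esub> h \<in> ?H" if "r \<in> carrier R" for r
      using that
    proof (rule generated)
      fix c assume c: "c \<in> carrier K"
      show "\<forall>h\<in>?H. \<iota> c \<odot>\<^bsub>M\<^esub> h \<in> ?H"
        using alg.scalar_commute[OF M.left_module_axioms c Xt] M.smult_closed[OF alg.\<iota>_closed[OF c]]
        by auto
    next
      fix r s assume rs: "r \<in> carrier R" "s \<in> carrier R" "\<forall>h\<in>?H. r \<odot>\<^bsub>M\<^esub> h \<in> ?H" "\<forall>h\<in>?H. s \<odot>\<^bsub>M\<^esub> h \<in> ?H"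
      show "\<forall>h\<in>?H. (r \<oplus>\<^bsub>R\<^esub> s) \<odot>\<^bsub>M\<^esub> h \<in> ?H"
      proof
        fix h assume h: "h \<in> ?H"
        then have "h \<in> carrier M" using HM by blast
        then show "(r \<oplus>\<^bsub>R\<^esub> s) \<odot>\<^bsub>M\<^esub> h \<in> ?H"
          using M.smult_l_distr[OF rs(1,2)] add[OF rs(3)[rule_format, OF h] rs(4)[rule_format, OF h]] by simp
      qed
      show "\<forall>h\<in>?H. (r \<otimes>\<^bsub>R\<^esub> s) \<odot>\<^bsub>M\<^esub> h \<in> ?H"
      proof
        fix h assume h: "h \<in> ?H"
        then have "h \<in> carrier M" using HM by blast
        then show "(r \<otimes>\<^bsub>R\<^esub> s) \<odot>\<^bsub>M\<^esub> h \<in> ?H"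
          using M.smult_assoc[OF rs(1,2)] rs(3)[rule_format, OF rs(4)[rule_format, OF h]] by simp
      qed
    qed (use gen in blast)
    have "Module.submodule ?H R M"
    proof (intro Module.submodule.intro subgroup.intro Module.submodule_axioms.intro)
      show "?H \<subseteq> carrier (add_monoid M)" using HM by simp
      fix x assume x: "x \<in> ?H"
      then have xM: "x \<in> carrier M" using HM by blast
      have m1: "\<ominus>\<^bsub>R\<^esub> \<one>\<^bsub>R\<^esub> \<in> carrier R" using ring_R by (simp add: ring.ring_simprules)
      have "\<ominus>\<^bsub>M\<^esub> x = (\<ominus>\<^bsub>R\<^esub> \<one>\<^bsub>R\<^esub>) \<odot>\<^bsub>M\<^esub> x"
        using M.smult_l_minus[OF ring.ring_simprules(6)[OF ring_R] xM] M.smult_one[OF xM] by simp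
      then have "\<ominus>\<^bsub>M\<^esub> x \<in> ?H" using act[OF m1] x by metis
      then show "inv\<^bsub>add_monoid M\<^esub> x \<in> ?H" unfolding a_inv_def .
    qed (use add zero act in auto)
    then have "?H = {\<zero>\<^bsub>M\<^esub>} \<or> ?H = carrier M" using M by (simp add: simple_module_def)
    then show ?case
    proof
      assume "?H = {\<zero>\<^bsub>M\<^esub>}"
      then show ?thesis by blast
    next
      assume H: "?H = carrier M"
      \<comment> \<open>The image is all of \<open>M\<close>, and by idempotence \<open>X t\<close>
        fixes its image.\<close>
      have "X t \<odot>\<^bsub>M\<^esub> m = m" if "m \<in> carrier M" for m
      proof -
        obtain n where n: "n \<in> carrier M" "m = X t \<odot>\<^bsub>M\<^esub> n" using \<open>m \<in> carrier M\<close> H by blast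
        then show ?thesis using M.smult_assoc[OF Xt Xt n(1)] relations(1)[OF less.prems less.prems] by simp
      qed
      then show ?thesis by blast
    qed
  qed
qed

text \<open>If every generator acts on all of \<open>M\<close> as 0 or as the identity, then every
  line is stable, and simplicity leaves room for one line only.\<close>

lemma simple_is_character_module:
  assumes M: "simple_module R M"
  shows "\<exists>A\<subseteq>V. is_character_module A M"
proof -
  interpret M: left_module R M using M unfolding simple_module_def by blast
  define A where "A = {t \<in> V. \<forall>m\<in>carrier M. X t \<odot>\<^bsub>M\<^esub> m = m}"
  have "carrier M \<noteq> {\<zero>\<^bsub>M\<^esub>}" using M by (simp add: simple_module_def)
  then obtain m where m: "m \<in> carrier M" "m \<noteq> \<zero>\<^bsub>M\<^esub>" using M.M.zero_closed by blast
  have acts: "r \<odot>\<^bsub>M\<^esub> m = \<iota> (character A r) \<odot>\<^bsub>M\<^esub> m" if "r \<in> carrier R" for r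
    using that
  proof (rule generated)
    fix c assume "c \<in> carrier K"
    then show "\<iota> c \<odot>\<^bsub>M\<^esub> m = \<iota> (character A (\<iota> c)) \<odot>\<^bsub>M\<^esub> m" by (simp add: character_unit)
  next
    fix t assume t: "t \<in> V"
    show "X t \<odot>\<^bsub>M\<^esub> m = \<iota> (character A (X t)) \<odot>\<^bsub>M\<^esub> m"
    proof (cases "t \<in> A")
      case True
      then show ?thesis using t m M.smult_one by (simp add: A_def character_X ind_def alg.\<iota>_one)
    next
      case False
      then have "X t \<odot>\<^bsub>M\<^esub> m = \<zero>\<^bsub>M\<^esub>"
        using simple_acts_by_projection[OF M t] t m by (auto simp: A_def)
      then show ?thesis using False t m M.smult_l_null by (simp add: character_X ind_def alg.\<iota>_zero)
    qed
  next
    fix r s assume rs: "r \<in> carrier R" "s \<in> carrier R"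
      "r \<odot>\<^bsub>M\<^esub> m = \<iota> (character A r) \<odot>\<^bsub>M\<^esub> m" "s \<odot>\<^bsub>M\<^esub> m = \<iota> (character A s) \<odot>\<^bsub>M\<^esub> m"
    have cl: "character A r \<in> carrier K" "character A s \<in> carrier K"
      using rs ring_hom_closed[OF character_hom] by auto
    note il = alg.\<iota>_closed[OF cl(1)] alg.\<iota>_closed[OF cl(2)]
    show "(r \<oplus>\<^bsub>R\<^esub> s) \<odot>\<^bsub>M\<^esub> m = \<iota> (character A (r \<oplus>\<^bsub>R\<^esub> s)) \<odot>\<^bsub>M\<^esub> m"
      using M.smult_l_distr[OF rs(1,2) m(1)] M.smult_l_distr[OF il m(1)] rs(3,4)
        ring_hom_add[OF character_hom[of A] rs(1,2)] alg.\<iota>_add[OF cl] by simp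
    \<comment> \<open>The scalar by which \<open>s\<close> acts is moved past \<open>r\<close>. This
      reverses the order of the two scalars, which is repaired by commutativity of
      \<open>K\<close>.\<close>
    have "(r \<otimes>\<^bsub>R\<^esub> s) \<odot>\<^bsub>M\<^esub> m = \<iota> (character A s) \<odot>\<^bsub>M\<^esub> (\<iota> (character A r) \<odot>\<^bsub>M\<^esub> m)"
      using M.smult_assoc[OF rs(1,2) m(1)] alg.scalar_commute[OF M.left_module_axioms cl(2) rs(1) m(1)]
        rs(3,4) by simp
    also have "\<dots> = \<iota> (character A s \<otimes> character A r) \<odot>\<^bsub>M\<^esub> m"
      using M.smult_assoc[OF il(2,1) m(1)] alg.\<iota>_mult[OF cl(2,1)] by simp
    finally show "(r \<otimes>\<^bsub>R\<^esub> s) \<odot>\<^bsub>M\<^esub> m = \<iota> (character A (r \<otimes>\<^bsub>R\<^esub> s)) \<odot>\<^bsub>M\<^esub> m"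
      using ring_hom_mult[OF character_hom[of A] rs(1,2)] K.m_comm[OF cl] by simp
  qed
  let ?H = "(\<lambda>c. \<iota> c \<odot>\<^bsub>M\<^esub> m) ` carrier K"
  have HM: "?H \<subseteq> carrier M" using M.smult_closed[OF alg.\<iota>_closed m(1)] by blast
  have "Module.submodule ?H R M"
  proof (intro Module.submodule.intro subgroup.intro Module.submodule_axioms.intro)
    show "?H \<subseteq> carrier (add_monoid M)" using HM by simp
    have "\<zero>\<^bsub>M\<^esub> = \<iota> \<zero> \<odot>\<^bsub>M\<^esub> m" using M.smult_l_null[OF m(1)] by (simp add: alg.\<iota>_zero)
    then show "\<one>\<^bsub>add_monoid M\<^esub> \<in> ?H" by auto
  next
    fix x y assume "x \<in> ?H" "y \<in> ?H"
    then obtain c d where cd: "c \<in> carrier K" "d \<in> carrier K" "x = \<iota> c \<odot>\<^bsub>M\<^esub> m" "y = \<iota> d \<odot>\<^bsub>M\<^esub> m" by blast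
    then have "x \<oplus>\<^bsub>M\<^esub> y = \<iota> (c \<oplus> d) \<odot>\<^bsub>M\<^esub> m"
      using M.smult_l_distr[OF alg.\<iota>_closed alg.\<iota>_closed m(1), of c d] by (simp add: alg.\<iota>_add)
    then show "x \<otimes>\<^bsub>add_monoid M\<^esub> y \<in> ?H" using cd by auto
  next
    fix x assume "x \<in> ?H"
    then obtain c where c: "c \<in> carrier K" "x = \<iota> c \<odot>\<^bsub>M\<^esub> m" by blast
    have mc: "\<ominus> c \<in> carrier K" using c by simp
    have "\<iota> (\<ominus> c) \<odot>\<^bsub>M\<^esub> m \<oplus>\<^bsub>M\<^esub> x = \<zero>\<^bsub>M\<^esub>"
      using M.smult_l_distr[OF alg.\<iota>_closed[OF mc] alg.\<iota>_closed[OF c(1)] m(1)] alg.\<iota>_add[OF mc c(1)] c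
        M.smult_l_null[OF m(1)] by (simp add: K.l_neg alg.\<iota>_zero)
    then have "\<ominus>\<^bsub>M\<^esub> x = \<iota> (\<ominus> c) \<odot>\<^bsub>M\<^esub> m"
      using c M.smult_closed[OF alg.\<iota>_closed m(1)] mc by (intro M.M.minus_equality) auto
    then show "inv\<^bsub>add_monoid M\<^esub> x \<in> ?H" using mc by (auto simp: a_inv_def)
  next
    fix r x assume r: "r \<in> carrier R" and "x \<in> ?H"
    then obtain c where c: "c \<in> carrier K" "x = \<iota> c \<odot>\<^bsub>M\<^esub> m" by blast
    have a: "character A r \<in> carrier K" using ring_hom_closed[OF character_hom r] .
    have "r \<odot>\<^bsub>M\<^esub> x = \<iota> c \<odot>\<^bsub>M\<^esub> (\<iota> (character A r) \<odot>\<^bsub>M\<^esub> m)"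
      using alg.scalar_commute[OF M.left_module_axioms c(1) r m(1)] acts[OF r] c by simp
    also have "\<dots> = \<iota> (c \<otimes> character A r) \<odot>\<^bsub>M\<^esub> m"
      using M.smult_assoc[OF alg.\<iota>_closed[OF c(1)] alg.\<iota>_closed[OF a] m(1)] alg.\<iota>_mult[OF c(1) a] by simp
    finally show "r \<odot>\<^bsub>M\<^esub> x \<in> ?H" using c a by auto
  qed
  moreover have "m \<in> ?H" using M.smult_one[OF m(1)] by (intro image_eqI[of _ _ \<one>]) (simp_all add: alg.\<iota>_one)
  ultimately have line: "?H = carrier M" using M m by (auto simp: simple_module_def)
  have "character_module K R \<iota> M (character A) m"
  proof (intro character_module.intro character_module_axioms.intro)
    fix x assume "x \<in> carrier M"
    then show "\<exists>c\<in>carrier K. x = \<iota> c \<odot>\<^bsub>M\<^esub> m" using line by blast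
  qed (rule alg.central_algebra_axioms M.left_module_axioms character_hom m
      | erule character_unit | erule acts)+
  moreover have "A \<subseteq> V" by (auto simp: A_def)
  ultimately show ?thesis unfolding is_character_module_def by blast
qed

text \<open>The isomorphism class of the simple module of \<open>A\<close>, described by the
  character rather than by a representative, so that nothing depends on a choice.\<close>

definition cls :: "'v set \<Rightarrow> ('v list \<Rightarrow> 'a) set set_module set" where
  "cls A = {M. is_character_module A M}"

lemma model_in_cls: "alg.character_model (character A) \<in> cls A"
  unfolding cls_def is_character_module_def
  using alg.character_module_model[OF character_hom character_unit] by blast

lemma character_inj:
  assumes "A \<subseteq> V" "B \<subseteq> V" "\<And>r. r \<in> carrier R \<Longrightarrow> character A r = character B r"
  shows "A = B"
proof -
  have "t \<in> A \<longleftrightarrow> t \<in> B" if t: "t \<in> V" for t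
    using assms(3)[OF X_closed[OF t]] t K.one_not_zero by (auto simp: character_X ind_def split: if_splits)
  then show ?thesis using assms(1,2) by blast
qed

lemma is_character_module_unique:
  assumes "A \<subseteq> V" "B \<subseteq> V" "is_character_module A M" "is_character_module B N" "module_iso R M N"
  shows "A = B"
proof -
  obtain m n where "character_module K R \<iota> M (character A) m" "character_module K R \<iota> N (character B) n"
    using assms(3,4) unfolding is_character_module_def by blast
  from character_module_iso_eq[OF this assms(5)] show ?thesis by (rule character_inj[OF assms(1,2)])
qed

text \<open>Isomorphic modules have the same character, and equal characters give isomorphic
  modules. This identifies the classes of \<open>simple_classes\<close> with those given by
  characters.\<close>

lemma cls_eq:
  fixes M :: "('v list \<Rightarrow> 'a) set set_module"
  assumes A: "A \<subseteq> V" and M: "is_character_module A M"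
  shows "{N :: ('v list \<Rightarrow> 'a) set set_module. simple_module R N \<and> module_iso R M N} = cls A"
proof (intro equalityI subsetI)
  fix N :: "('v list \<Rightarrow> 'a) set set_module"
  assume "N \<in> {N. simple_module R N \<and> module_iso R M N}"
  then have N: "simple_module R N" "module_iso R M N" by auto
  obtain B where B: "B \<subseteq> V" "is_character_module B N" using simple_is_character_module[OF N(1)] by blast
  have "A = B" by (rule is_character_module_unique[OF A B(1) M B(2) N(2)])
  then show "N \<in> cls A" using B by (simp add: cls_def)
next
  fix N assume "N \<in> cls A"
  then obtain n where n: "character_module K R \<iota> N (character A) n"
    by (auto simp: cls_def is_character_module_def)
  obtain m where m: "character_module K R \<iota> M (character A) m" using M by (auto simp: is_character_module_def)
  show "N \<in> {N. simple_module R N \<and> module_iso R M N}"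
    using character_module.simple[OF n] character_module_iso[OF m n] by simp
qed

lemma cls_inj: "inj_on cls (Pow V)"
proof (rule inj_onI)
  fix A B assume AB: "A \<in> Pow V" "B \<in> Pow V" "cls A = cls B"
  let ?M = "alg.character_model (character A)"
  obtain m where m: "character_module K R \<iota> ?M (character A) m"
    using model_in_cls[of A] by (auto simp: cls_def is_character_module_def)
  have "is_character_module A ?M" "is_character_module B ?M"
    using model_in_cls[of A] AB(3) by (auto simp: cls_def)
  then show "A = B" using AB character_module_iso[OF m m] by (intro is_character_module_unique[of A B ?M ?M]) auto
qed

lemma simple_classes_eq: "simple_classes R = cls ` Pow V"
proof (intro equalityI subsetI)
  fix C assume "C \<in> simple_classes R"
  then obtain M :: "('v list \<Rightarrow> 'a) set set_module" where M: "simple_module R M" "C = {N. simple_module R N \<and> module_iso R M N}"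
    unfolding simple_classes_def by blast
  obtain A where "A \<subseteq> V" "is_character_module A M" using simple_is_character_module[OF M(1)] by blast
  then show "C \<in> cls ` Pow V" using cls_eq M by blast
next
  fix C assume "C \<in> cls ` Pow V"
  then obtain A where A: "A \<subseteq> V" "C = cls A" by blast
  let ?M = "alg.character_model (character A)"
  have M: "is_character_module A ?M" using model_in_cls[of A] by (simp add: cls_def)
  then have "simple_module R ?M" using character_module.simple by (auto simp: is_character_module_def)
  then show "C \<in> simple_classes R"
    unfolding simple_classes_def A(2) cls_eq[OF A(1) M, symmetric] by blast
qed

text \<open>The Gabriel quiver uses representatives picked by choice. The criterion refers only to
  their characters, so membership in the classes is all that has to be known about them.\<close>

lemma Ext1_cls_pos_iff:
  assumes AB: "A \<subseteq> V" "B \<subseteq> V"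
  shows "0 < vectorspace.dim K (Ext1 R \<iota> (SOME M. M \<in> cls A) (SOME N. N \<in> cls B)) \<longleftrightarrow> exchange E A B"
proof -
  have "(SOME M. M \<in> cls A) \<in> cls A" "(SOME N. N \<in> cls B) \<in> cls B"
    by (rule someI, rule model_in_cls)+
  then obtain m n where m: "character_module K R \<iota> (SOME M. M \<in> cls A) (character A) m"
    and n: "character_module K R \<iota> (SOME N. N \<in> cls B) (character B) n"
    unfolding cls_def is_character_module_def by blast
  interpret BQ_character_modules K Q "SOME M. M \<in> cls A" A m "SOME N. N \<in> cls B" B n
    by (intro BQ_character_modules.intro acyclic_quiver_algebra_axioms character_module_pair.intro
        alg.central_algebra_axioms m n)
  show ?thesis by (rule Ext1_pos_iff_exchange[OF AB])
qed

end

section \<open>The Gabriel quiver\<close>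

lemma arcs_ends_mk_symmetric: "arcs_ends (mk_symmetric Q) = arcs_ends Q \<union> (arcs_ends Q)\<inverse>"
  by (auto simp: arcs_ends_conv mk_symmetric_def)

lemma gabriel_quiver_dominates:
  fixes R :: "('r, 'x) ring_scheme"
  shows "(C, D) \<in> arcs_ends (gabriel_quiver K R \<iota>) \<longleftrightarrow> C \<in> simple_classes R \<and> D \<in> simple_classes R \<and>
     0 < vectorspace.dim K (Ext1 R \<iota> (SOME M. M \<in> C) (SOME N. N \<in> D))" (is "_ \<longleftrightarrow> ?R")
proof
  assume "(C, D) \<in> arcs_ends (gabriel_quiver K R \<iota>)"
  then obtain a where "a \<in> arcs (gabriel_quiver K R \<iota>)"
    "tail (gabriel_quiver K R \<iota>) a = C" "head (gabriel_quiver K R \<iota>) a = D" by (rule reachableE)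
  then show ?R by (cases a) (simp add: gabriel_quiver_def)
next
  assume ?R
  \<comment> \<open>Parallel arrows are numbered from 0, so a positive dimension is witnessed by the
    arrow with number 0.\<close>
  then have "(C, D, 0) \<in> arcs (gabriel_quiver K R \<iota>)" by (simp add: gabriel_quiver_def)
  then show "(C, D) \<in> arcs_ends (gabriel_quiver K R \<iota>)"
    unfolding arcs_ends_conv by (rule image_eqI[rotated]) (simp add: gabriel_quiver_def)
qed

context acyclic_quiver_algebra
begin

abbreviation G where "G \<equiv> gabriel_quiver K R \<iota>"

lemma gabriel_dominates_iff:
  assumes "A \<subseteq> V" "B \<subseteq> V"
  shows "(cls A, cls B) \<in> arcs_ends G \<longleftrightarrow> exchange E A B"
proof -
  have "cls A \<in> simple_classes R" "cls B \<in> simple_classes R"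
    unfolding simple_classes_eq using assms by blast+
  then show ?thesis unfolding gabriel_quiver_dominates Ext1_cls_pos_iff[OF assms] by blast
qed

lemma gabriel_arcs_ends:
  "arcs_ends (mk_symmetric G) = (\<lambda>(A, B). (cls A, cls B)) ` exchange_rel E V"
proof (intro equalityI subsetI)
  fix p assume p: "p \<in> arcs_ends (mk_symmetric G)"
  obtain C D where CD: "p = (C, D)" by (rule prod.exhaust)
  have or: "(C, D) \<in> arcs_ends G \<or> (D, C) \<in> arcs_ends G"
    using p unfolding CD arcs_ends_mk_symmetric Un_iff converse_iff .
  then have "C \<in> cls ` Pow V" "D \<in> cls ` Pow V"
    unfolding gabriel_quiver_dominates simple_classes_eq by blast+
  then obtain A B where AB: "A \<subseteq> V" "B \<subseteq> V" "C = cls A" "D = cls B" by blast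
  have "(A, B) \<in> exchange_rel E V"
    using or AB(1,2) gabriel_dominates_iff unfolding AB(3,4) exchange_rel_def by simp
  then show "p \<in> (\<lambda>(A, B). (cls A, cls B)) ` exchange_rel E V"
    unfolding CD AB(3,4) by (rule image_eqI[rotated]) simp
next
  fix p assume "p \<in> (\<lambda>(A, B). (cls A, cls B)) ` exchange_rel E V"
  then obtain A B where p: "p = (cls A, cls B)" and AB: "(A, B) \<in> exchange_rel E V" by auto
  then have "A \<subseteq> V" "B \<subseteq> V" "exchange E A B \<or> exchange E B A" by (auto simp: exchange_rel_def)
  then show "p \<in> arcs_ends (mk_symmetric G)"
    unfolding p arcs_ends_mk_symmetric Un_iff converse_iff using gabriel_dominates_iff by blast
qed

lemma gabriel_symmetric_wf:
  "verts (mk_symmetric G) = cls ` Pow V" "wf_digraph (mk_symmetric G)" "symmetric (mk_symmetric G)"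
proof -
  show v: "verts (mk_symmetric G) = cls ` Pow V"
    by (simp add: mk_symmetric_def gabriel_quiver_def simple_classes_eq)
  have a: "arcs (mk_symmetric G) = (\<lambda>(A, B). (cls A, cls B)) ` exchange_rel E V"
    using gabriel_arcs_ends by (simp add: arcs_ends_conv)
  show "wf_digraph (mk_symmetric G)"
    by unfold_locales (auto simp: v a exchange_rel_def simp del: with_proj_simps(1,2))
  show "symmetric (mk_symmetric G)"
    unfolding symmetric_def gabriel_arcs_ends by (rule symI) (auto dest: exchange_rel_sym)
qed

text \<open>Chains of exchanges and walks in the symmetrized quiver correspond under
  \<open>cls\<close>; injectivity is needed to match the end of one edge with the start of the
  next.\<close>

lemma gabriel_reachable_iff:
  assumes A: "A \<subseteq> V" and B: "B \<subseteq> V"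
  shows "cls A \<rightarrow>\<^sup>*\<^bsub>mk_symmetric G\<^esub> cls B \<longleftrightarrow> (A, B) \<in> (exchange_rel E V)\<^sup>*"
proof -
  interpret S: wf_digraph "mk_symmetric G" by (rule gabriel_symmetric_wf)
  have *: "\<exists>B\<subseteq>V. v = cls B \<and> (A, B) \<in> (exchange_rel E V)\<^sup>*" if "cls A \<rightarrow>\<^sup>*\<^bsub>mk_symmetric G\<^esub> v" for v
    using that
  proof (induction rule: S.reachable_induct)
    case base
    then show ?case using A by blast
  next
    case (step x y)
    then obtain B where B: "B \<subseteq> V" "x = cls B" "(A, B) \<in> (exchange_rel E V)\<^sup>*" by blast
    obtain B' C where BC: "(B', C) \<in> exchange_rel E V" "x = cls B'" "y = cls C"
      using step(2) unfolding gabriel_arcs_ends by auto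
    then have sub: "B' \<subseteq> V" "C \<subseteq> V" by (auto simp: exchange_rel_def)
    then have "B' = B" using cls_inj B BC(2) by (simp add: inj_on_def)
    then have "(A, C) \<in> (exchange_rel E V)\<^sup>*" using B(3) BC(1) by simp
    then show ?case using BC(3) sub(2) by blast
  qed
  show ?thesis
  proof
    assume "cls A \<rightarrow>\<^sup>*\<^bsub>mk_symmetric G\<^esub> cls B"
    then obtain C where C: "C \<subseteq> V" "cls B = cls C" "(A, C) \<in> (exchange_rel E V)\<^sup>*" using * by blast
    then have "B = C" using cls_inj B by (simp add: inj_on_def)
    then show "(A, B) \<in> (exchange_rel E V)\<^sup>*" using C by simp
  next
    assume "(A, B) \<in> (exchange_rel E V)\<^sup>*"
    then show "cls A \<rightarrow>\<^sup>*\<^bsub>mk_symmetric G\<^esub> cls B"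
    proof induction
      case base
      then show ?case using A by (intro S.reachable_refl) (simp only: gabriel_symmetric_wf(1), blast)
    next
      case (step B C)
      then have "(cls B, cls C) \<in> arcs_ends (mk_symmetric G)" unfolding gabriel_arcs_ends by force
      with step.IH show ?case by (rule S.reachable_adj_trans)
    qed
  qed
qed

text \<open>An invariant of vertex sets is carried over to classes along the inverse of
  \<open>cls\<close>, after which components are counted by its values.\<close>

lemma num_components_classified:
  assumes "\<And>A B. A \<subseteq> V \<Longrightarrow> B \<subseteq> V \<Longrightarrow> (A, B) \<in> (exchange_rel E V)\<^sup>* \<longleftrightarrow> h A = h B"
  shows "num_connected_components G = card (h ` Pow V)"
proof -
  define g where "g C = h (the_inv_into (Pow V) cls C)" for C
  have g: "g (cls A) = h A" if "A \<subseteq> V" for A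
    unfolding g_def using the_inv_into_f_f[OF cls_inj, of A] that by simp
  have "card (pre_digraph.sccs_verts (mk_symmetric G)) = card (g ` verts (mk_symmetric G))"
  proof (rule card_sccs_verts_classified[OF gabriel_symmetric_wf(2,3)])
    fix u v assume "u \<in> verts (mk_symmetric G)" "v \<in> verts (mk_symmetric G)"
    then obtain A B where AB: "A \<subseteq> V" "B \<subseteq> V" "u = cls A" "v = cls B"
      unfolding gabriel_symmetric_wf(1) by blast
    then show "u \<rightarrow>\<^sup>*\<^bsub>mk_symmetric G\<^esub> v \<longleftrightarrow> g u = g v"
      using gabriel_reachable_iff[OF AB(1,2)] assms[OF AB(1,2)] g by simp
  qed
  also have "g ` verts (mk_symmetric G) = h ` Pow V"
    unfolding gabriel_symmetric_wf(1) image_image using g by (intro image_cong) auto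
  finally show ?thesis unfolding num_connected_components_def .
qed

end

section \<open>Translation of the hypotheses on the quiver, and the count\<close>

lemma acyclic_quiver_arcs_ends:
  assumes "wf_digraph Q" "acyclic_quiver Q" shows "acyclic (arcs_ends Q)"
proof -
  interpret wf_digraph Q by fact
  show ?thesis
  proof (rule acyclicI, clarify)
    fix u assume "u \<rightarrow>\<^sup>+\<^bsub>Q\<^esub> u"
    then obtain p where "awalk u p u" "p \<noteq> []" by (auto simp: reachable1_awalk)
    then have "closed_w p" by (auto simp: closed_w_def)
    then show False using closed_w_imp_cycle assms(2) by (auto simp: acyclic_quiver_def)
  qed
qed

lemma connected_arcs_ends:
  assumes "Digraph_Component.connected Q"
  shows "verts Q \<times> verts Q \<subseteq> (arcs_ends Q \<union> (arcs_ends Q)\<inverse>)\<^sup>*"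
proof clarify
  fix u v assume uv: "u \<in> verts Q" "v \<in> verts Q"
  have "u \<rightarrow>\<^sup>*\<^bsub>mk_symmetric Q\<^esub> v"
    using assms uv by (auto simp: connected_def strongly_connected_def mk_symmetric_def)
  from reachable_rtranclI[OF this] show "(u, v) \<in> (arcs_ends Q \<union> (arcs_ends Q)\<inverse>)\<^sup>*"
    unfolding arcs_ends_mk_symmetric .
qed

text \<open>Along an arrow the number of a vertex increases by one, so either end of an arrow
  determines the other. The degree bounds and the number of vertices are all that the count extracts
  from linearity.\<close>

lemma linear_quiver_iso_cases:
  assumes "digraph_iso Q (linear_quiver n)"
  shows "card (verts Q) = n" "single_valued (arcs_ends Q)" "single_valued ((arcs_ends Q)\<inverse>)"
proof -
  obtain f where f: "pre_digraph.digraph_isomorphism Q f" and lin: "linear_quiver n = app_iso f Q"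
    using assms by (auto simp: digraph_iso_def)
  let ?v = "iso_verts f"
  have wf: "wf_digraph Q" and inj: "inj_on ?v (verts Q)"
    using f by (auto simp: pre_digraph.digraph_isomorphism_def)
  interpret wf_digraph Q by (rule wf)
  have "?v ` verts Q = {1..n}" "iso_tail f = (\<lambda>i. i)" "iso_head f = Suc"
    using lin by (auto simp: linear_quiver_def app_iso_def)
  note l = this
  show "card (verts Q) = n" using card_image[OF inj] l(1) by simp
  have succ: "u \<in> verts Q \<and> w \<in> verts Q \<and> ?v w = Suc (?v u)" if "(u, w) \<in> arcs_ends Q" for u w
  proof -
    obtain a where "a \<in> arcs Q" "tail Q a = u" "head Q a = w" using \<open>(u, w) \<in> arcs_ends Q\<close> by (rule reachableE)
    then show ?thesis using f l by (auto simp: pre_digraph.digraph_isomorphism_def)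
  qed
  show "single_valued (arcs_ends Q)"
  proof (rule single_valuedI)
    fix x y z assume "(x, y) \<in> arcs_ends Q" "(x, z) \<in> arcs_ends Q"
    then show "y = z" using succ[of x y] succ[of x z] inj by (simp add: inj_on_def)
  qed
  show "single_valued ((arcs_ends Q)\<inverse>)"
  proof (rule single_valuedI)
    fix x y z assume "(x, y) \<in> (arcs_ends Q)\<inverse>" "(x, z) \<in> (arcs_ends Q)\<inverse>"
    then show "y = z" using succ[of y x] succ[of z x] inj by (simp add: inj_on_def)
  qed
qed

text \<open>Acyclicity forbids loops, so a quiver on one vertex has no arrows and the value 1 of the
  arrow map is arbitrary. This shows that part (b) never meets a single vertex.\<close>

lemma singleton_quiver_iso:
  assumes wf: "wf_digraph Q" and V: "verts Q = {v}" and ac: "acyclic (arcs_ends Q)"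
  shows "digraph_iso Q (linear_quiver 1)"
proof -
  interpret wf_digraph Q by fact
  have "arcs Q = {}"
  proof (rule ccontr)
    assume "arcs Q \<noteq> {}"
    then obtain a where "a \<in> arcs Q" by blast
    then have "tail Q a = v" "head Q a = v" using V tail_in_verts head_in_verts by auto
    then have "(v, v) \<in> arcs_ends Q" using \<open>a \<in> arcs Q\<close> by (auto simp: arcs_ends_conv)
    then show False using ac by (auto simp: acyclic_def)
  qed
  define h :: "('a, 'b, nat, nat) digraph_isomorphism" where
    "h = \<lparr>iso_verts = \<lambda>_. 1, iso_arcs = \<lambda>_. 1, iso_head = Suc, iso_tail = \<lambda>i. i\<rparr>"
  have "digraph_isomorphism h" using V \<open>arcs Q = {}\<close> wf by (simp add: digraph_isomorphism_def)
  moreover have "linear_quiver 1 = app_iso h Q"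
    using V \<open>arcs Q = {}\<close> by (simp add: linear_quiver_def app_iso_def h_def)
  ultimately show ?thesis unfolding digraph_iso_def by blast
qed

text \<open>The relations only ask whether an arrow exists, so a linear quiver with some arrows
  repeated has the algebra of the plain one and n + 1 components. Such quivers are set aside in (b)
  through \<open>merge_parallel\<close>, from n = 3 on; for n = 2 the numbers n + 1 and 3
  agree.\<close>

theorem proposition1p3:
  fixes K :: "('k, 'w) ring_scheme" and Q :: "('v, 'e) pre_digraph"
  assumes "field K"
    and "fin_digraph Q"
    and "Digraph_Component.connected Q"
    and "acyclic_quiver Q"
  shows "(\<forall>n. digraph_iso Q (linear_quiver n) \<longrightarrow>
            num_connected_components (gabriel_quiver K (BQ K Q) (BQ_unit K Q)) = n + 1)
       \<and> ((\<forall>n. \<not> digraph_iso Q (linear_quiver n)) \<and>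
           (\<forall>n\<ge>3. \<not> digraph_iso (merge_parallel Q) (linear_quiver n)) \<longrightarrow>
            num_connected_components (gabriel_quiver K (BQ K Q) (BQ_unit K Q)) = 3)"
proof -
  interpret Q: fin_digraph Q by fact
  have ac: "acyclic (arcs_ends Q)" using acyclic_quiver_arcs_ends[OF Q.wf_digraph assms(4)] .
  interpret acyclic_quiver_algebra K Q
    by (intro acyclic_quiver_algebra.intro quiver_algebra.intro word_functions.intro
        acyclic_quiver_algebra_axioms.intro assms(1,2) ac)
  have EV: "E \<subseteq> V \<times> V" using Q.adj_in_verts by auto
  have fin: "finite V" by simp
  have conn: "V \<times> V \<subseteq> (E \<union> E\<inverse>)\<^sup>*" by (rule connected_arcs_ends[OF assms(3)])
  have linear: "num_connected_components G = n + 1" if iso: "digraph_iso Q (linear_quiver n)" for n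
  proof -
    note l = linear_quiver_iso_cases[OF iso]
    have "num_connected_components G = card (card ` Pow V)"
      using exchange_connected_linear[OF EV fin conn l(2,3)] by (rule num_components_classified)
    also have "card ` Pow V = {..n}"
    proof (intro equalityI subsetI)
      fix k assume "k \<in> {..n}"
      then obtain A where "A \<subseteq> V" "card A = k" using obtain_subset_with_card_n[of k V] l(1) by auto
      then show "k \<in> card ` Pow V" by blast
    qed (use l(1) card_mono[OF fin] in auto)
    finally show ?thesis by simp
  qed
  have branched: "num_connected_components G = 3"
    if no_iso: "\<And>n. \<not> digraph_iso Q (linear_quiver n)"
      and no_merge: "\<And>n. n \<ge> 3 \<Longrightarrow> \<not> digraph_iso (merge_parallel Q) (linear_quiver n)"
  proof -
    have ne: "V \<noteq> {}" using assms(3) by (auto simp: connected_def strongly_connected_def mk_symmetric_def)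
    \<comment> \<open>At least two vertices make a singleton both nonempty and proper, so that the
      third class of sets is inhabited.\<close>
    have "card V \<noteq> 1"
    proof
      assume "card V = 1"
      then obtain v where "V = {v}" by (auto simp: card_1_singleton_iff)
      then show False using singleton_quiver_iso[OF Q.wf_digraph _ ac] no_iso by blast
    qed
    then have card2: "card V \<ge> 2" using card_0_eq[OF fin] ne by linarith
    have branch: "\<exists>v a b. a \<noteq> b \<and> v \<noteq> a \<and> v \<noteq> b \<and>
        ((v, a) \<in> E \<and> (v, b) \<in> E \<or> (a, v) \<in> E \<and> (b, v) \<in> E)" if "card V \<ge> 3"
    proof -
      \<comment> \<open>If both degree bounds held, the merged quiver would be linear with at least
        three vertices, which is excluded; a violated bound is a branching vertex.\<close>
      have "\<not> single_valued E \<or> \<not> single_valued (E\<inverse>)"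
        using linear_iso_merge_parallel[OF fin Q.wf_digraph ac conn] no_merge[OF that] by blast
      then obtain v a b where "a \<noteq> b" "(v, a) \<in> E \<and> (v, b) \<in> E \<or> (a, v) \<in> E \<and> (b, v) \<in> E"
        unfolding single_valued_def converse_iff by blast
      moreover have "u \<noteq> w" if "(u, w) \<in> E" for u w using that ac by (auto simp: acyclic_def)
      ultimately show ?thesis by metis
    qed
    \<comment> \<open>The three components: the empty set, the full vertex set, and everything else.\<close>
    let ?h = "\<lambda>A. if A = {} then 0 else if A = V then 2 else (1::nat)"
    have "num_connected_components G = card (?h ` Pow V)"
    proof (rule num_components_classified)
      fix A B assume AB: "A \<subseteq> V" "B \<subseteq> V"
      show "(A, B) \<in> (exchange_rel E V)\<^sup>* \<longleftrightarrow> ?h A = ?h B"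
      proof
        assume r: "(A, B) \<in> (exchange_rel E V)\<^sup>*"
        show "?h A = ?h B"
        proof (cases "A = B")
          case False
          then have "A \<noteq> {} \<and> A \<noteq> V" "B \<noteq> {} \<and> B \<noteq> V"
            using exchange_trivial[OF r] exchange_trivial[OF exchange_rel_rtrancl_sym[OF r]] by blast+
          then show ?thesis by simp
        qed simp
      next
        assume h: "?h A = ?h B"
        show "(A, B) \<in> (exchange_rel E V)\<^sup>*"
        proof (cases "A = {} \<or> A = V")
          case True
          then have "A = B" using h ne by (simp split: if_splits)
          then show ?thesis by simp
        next
          case False
          then have "A \<noteq> {}" "A \<noteq> V" "B \<noteq> {}" "B \<noteq> V" using h by (simp_all split: if_splits)
          from exchange_connected_branched[OF EV fin conn branch AB this(1,3,2,4)] show ?thesis .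
        qed
      qed
    qed
    also have "?h ` Pow V = {0, 1, 2}"
    proof -
      obtain v where v: "v \<in> V" using ne by blast
      have "{v} \<noteq> V"
      proof
        assume "{v} = V"
        from arg_cong[OF this, of card] show False using card2 by simp
      qed
      then have "1 = ?h {v}" by simp
      then have "1 \<in> ?h ` Pow V" using v by (intro image_eqI[of _ _ "{v}"]) auto
      moreover have "0 \<in> ?h ` Pow V" "2 \<in> ?h ` Pow V" using ne by (auto intro!: rev_image_eqI)
      ultimately show ?thesis by auto
    qed
    finally show ?thesis by simp
  qed
  show ?thesis using linear branched by blast
qed

end
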